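(* Let $H$ be a finite-dimensional Hopf algebra and let $(X,\alpha,\beta)$ be a right-right $(H,\widehat H)$-Yetter--Drinfeld algebra. Then $(X,\alpha,\beta)$ is braided commutative (in the sense of the Heisenberg-algebra condition given in the context) if and only if the (left-right) Yetter--Drinfeld algebra $(X,\rhd_\beta,\alpha)$ over $H$ is braided commutative, i.e. $xy=(S(x_{[1]})\rhd_\beta y)\,x_{[0]}$ for all $x,y\in X$, where $\alpha(x)=x_{[0]}\otimes x_{[1]}^{\mathrm{op}}$ and $h\rhd_\beta x=(\mathrm{id}_X\otimes\mathbf p(h,\cdot))(\beta(x))$.
   Context: $\Bbbk$ is a field, algebras are unital $\Bbbk$-algebras. $H$ has structure maps $\Delta,\varepsilon,S$ ($S$ bijective), with Sweedler notation; $\widehat H$ is the dual Hopf algebra and $\mathbf p(h,\theta)=\theta(h)$, with $\mathbf p(h,\theta\theta')=\mathbf p(h_{(1)},\theta)\mathbf p(h_{(2)},\theta')$, $\mathbf p(hh',\theta)=\mathbf p(h,\theta_{(1)})\mathbf p(h',\theta_{(2)})$. $H^{\mathrm{op}}$ is the Hopf algebra with opposite product (elements $h^{\mathrm{op}}$) and the same coproduct. $U=\sum_ih_i\otimes\widehat h_i\in H\otimes\widehat H$ (dual bases), and ${}^{\circ}U=\sum_i h_i^{\mathrm{op}}\otimes\widehat h_i\in H^{\mathrm{op}}\otimes\widehat H$, which is invertible. $\mathrm{Ad}(W)(z)=WzW^{-1}$; $\Sigma$ is the flip. A right coaction of a Hopf algebra $K$ on an algebra $X$ is an algebra homomorphism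 $\alpha:X\to X\otimes K$ with $(\alpha\otimes\mathrm{id})\alpha=(\mathrm{id}\otimes\Delta_K)\alpha$, $(\mathrm{id}\otimes\varepsilon_K)\alpha=\mathrm{id}$. A right-right $(H,\widehat H)$-Yetter--Drinfeld algebra is a triple $(X,\alpha,\beta)$ with right coactions $\alpha:X\to X\otimes H^{\mathrm{op}}$ of $H^{\mathrm{op}}$ and $\beta:X\to X\otimes\widehat H$ of $\widehat H$ such that $(\alpha\otimes\mathrm{id}_{\widehat H})\beta=(\mathrm{id}_X\otimes\mathrm{Ad}({}^{\circ}U)^{-1})(\mathrm{id}_X\otimes\Sigma)(\beta\otimes\mathrm{id}_{H^{\mathrm{op}}})\alpha$. In that case $(X,\rhd_\beta,\alpha)$ is a (left-right) Yetter--Drinfeld algebra over $H$. The Heisenberg algebra $\mathcal H(H)=H\#\widehat H$ is $H\otimes\widehat H$ with product $(h\#\theta)(h'\#\theta')=h\,h'_{(1)}\,\mathbf p(h'_{(2)},\theta_{(1)})\#\theta_{(2)}\theta'$. $X\otimes\mathcal H(H)$ is the tensor product algebra with multiplication map $\mathfrak m_{X\otimes\mathcal H(H)}$. Put $\iota_{X,1}:X\otimes H\to X\otimes\mathcal H(H)$, $x\otimes h\mapsto x\otimes h\#1$, $\iota_{X,2}:X\otimes\widehat H\to X\otimes\mathcal H(H)$, $x\otimes\theta\mapsto x\otimes1\#\theta$, and let $\dot\alpha:X\to X\otimes H$ be the linear map $x\mapsto x_{[0]}\otimes x_{[1]}$. $(X,\alpha,\beta)$ is called braided commutative if for all $x,y\in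 X$ $$\mathfrak m_{X\otimes\mathcal H(H)}(\iota_{X,1}\otimes\iota_{X,2})((\mathrm{id}\otimes S)\dot\alpha(x)\otimes\beta(y))=\mathfrak m_{X\otimes\mathcal H(H)}(\iota_{X,2}\otimes\iota_{X,1})(\beta(y)\otimes(\mathrm{id}\otimes S)\dot\alpha(x)).$$ *)

theory Defs
  imports "HOL-Algebra.Module"
begin

section \<open>Algebras and finite bases over a field\<close>

text \<open>The locale of the same purpose in HOL-Algebra only covers commutative algebras.\<close>

locale kalgebra = module K A + K?: field K + A?: ring A
    for K (structure) and A (structure) +
  assumes smult_mult_left:
      "\<lbrakk>c \<in> carrier K; x \<in> carrier A; y \<in> carrier A\<rbrakk> \<Longrightarrow>
        (c \<odot>\<^bsub>A\<^esub> x) \<otimes>\<^bsub>A\<^esub> y = c \<odot>\<^bsub>A\<^esub> (x \<otimes>\<^bsub>A\<^esub> y)"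
    and smult_mult_right:
      "\<lbrakk>c \<in> carrier K; x \<in> carrier A; y \<in> carrier A\<rbrakk> \<Longrightarrow>
        x \<otimes>\<^bsub>A\<^esub> (c \<odot>\<^bsub>A\<^esub> y) = c \<odot>\<^bsub>A\<^esub> (x \<otimes>\<^bsub>A\<^esub> y)"

definition klinear ::
    "('k, 'm) ring_scheme \<Rightarrow> ('k, 'a, 'm1) module_scheme \<Rightarrow> ('k, 'b, 'm2) module_scheme \<Rightarrow> ('a \<Rightarrow> 'b) set"
  where "klinear K A B = {f. f \<in> carrier A \<rightarrow> carrier B \<and>
     (\<forall>x \<in> carrier A. \<forall>y \<in> carrier A. f (x \<oplus>\<^bsub>A\<^esub> y) = f x \<oplus>\<^bsub>B\<^esub> f y) \<and>
     (\<forall>c \<in> carrier K. \<forall>x \<in> carrier A. f (c \<odot>\<^bsub>A\<^esub> x) = c \<odot>\<^bsub>B\<^esub> f x)}"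

definition kalg_hom ::
    "('k, 'm) ring_scheme \<Rightarrow> ('k, 'a, 'm1) module_scheme \<Rightarrow> ('k, 'b, 'm2) module_scheme \<Rightarrow> ('a \<Rightarrow> 'b) set"
  where "kalg_hom K A B = ring_hom A B \<inter> klinear K A B"

text \<open>The base field, regarded as an algebra over itself.\<close>

definition self_alg :: "('k, 'm) ring_scheme \<Rightarrow> ('k, 'k) module"
  where "self_alg K = \<lparr>carrier = carrier K, mult = mult K, one = one K, zero = zero K,
     add = add K, smult = mult K\<rparr>"

definition finite_basis :: "('k, 'm) ring_scheme \<Rightarrow> ('k, 'a, 'm1) module_scheme \<Rightarrow> 'a set \<Rightarrow> bool"
  where "finite_basis K V B \<longleftrightarrow> finite B \<and> B \<subseteq> carrier V \<and>
     (\<forall>v \<in> carrier V. \<exists>!c. c \<in> B \<rightarrow>\<^sub>E carrier K \<and> v = (\<Oplus>\<^bsub>V\<^esub>b\<in>B. c b \<odot>\<^bsub>V\<^esub> b))"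

definition finite_dim :: "('k, 'm) ring_scheme \<Rightarrow> ('k, 'a, 'm1) module_scheme \<Rightarrow> bool"
  where "finite_dim K V \<longleftrightarrow> (\<exists>B. finite_basis K V B)"

definition coord ::
    "('k, 'm) ring_scheme \<Rightarrow> ('k, 'a, 'm1) module_scheme \<Rightarrow> 'a set \<Rightarrow> 'a \<Rightarrow> 'a \<Rightarrow> 'k"
  where "coord K V B b = (\<lambda>v \<in> carrier V.
     (THE c. c \<in> B \<rightarrow>\<^sub>E carrier K \<and> v = (\<Oplus>\<^bsub>V\<^esub>b'\<in>B. c b' \<odot>\<^bsub>V\<^esub> b')) b)"


section \<open>Tensor products\<close>

text \<open>A list \<open>[(a\<^sub>1, b\<^sub>1), \<dots>, (a\<^sub>n, b\<^sub>n)]\<close> stands for the formal sum of the symbols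
  \<open>a\<^sub>i \<otimes> b\<^sub>i\<close>.  The tensor product over \<open>K\<close> is the quotient of these formal
  sums by the least congruence that makes addition commutative and the symbol \<open>a \<otimes> b\<close>
  \<open>K\<close>-bilinear; an element of it is an equivalence class of lists.\<close>

inductive tensor_eq ::
    "('k, 'm) ring_scheme \<Rightarrow> ('k, 'a, 'm1) module_scheme \<Rightarrow> ('k, 'b, 'm2) module_scheme
      \<Rightarrow> ('a \<times> 'b) list \<Rightarrow> ('a \<times> 'b) list \<Rightarrow> bool"
  for K and A and B where
    refl: "set xs \<subseteq> carrier A \<times> carrier B \<Longrightarrow> tensor_eq K A B xs xs"
  | sym: "tensor_eq K A B xs ys \<Longrightarrow> tensor_eq K A B ys xs"
  | trans: "tensor_eq K A B xs ys \<Longrightarrow> tensor_eq K A B ys zs \<Longrightarrow> tensor_eq K A B xs zs"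
  | append: "tensor_eq K A B xs xs' \<Longrightarrow> tensor_eq K A B ys ys' \<Longrightarrow>
      tensor_eq K A B (xs @ ys) (xs' @ ys')"
  | commute: "set xs \<subseteq> carrier A \<times> carrier B \<Longrightarrow> set ys \<subseteq> carrier A \<times> carrier B \<Longrightarrow>
      tensor_eq K A B (xs @ ys) (ys @ xs)"
  | add_left: "a \<in> carrier A \<Longrightarrow> a' \<in> carrier A \<Longrightarrow> b \<in> carrier B \<Longrightarrow>
      tensor_eq K A B [(a \<oplus>\<^bsub>A\<^esub> a', b)] [(a, b), (a', b)]"
  | add_right: "a \<in> carrier A \<Longrightarrow> b \<in> carrier B \<Longrightarrow> b' \<in> carrier B \<Longrightarrow>
      tensor_eq K A B [(a, b \<oplus>\<^bsub>B\<^esub> b')] [(a, b), (a, b')]"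
  | balanced: "c \<in> carrier K \<Longrightarrow> a \<in> carrier A \<Longrightarrow> b \<in> carrier B \<Longrightarrow>
      tensor_eq K A B [(c \<odot>\<^bsub>A\<^esub> a, b)] [(a, c \<odot>\<^bsub>B\<^esub> b)]"
  | zero: "b \<in> carrier B \<Longrightarrow> tensor_eq K A B [(\<zero>\<^bsub>A\<^esub>, b)] []"

type_synonym ('a, 'b) tens = "('a \<times> 'b) list set"

definition tclass ::
    "('k, 'm) ring_scheme \<Rightarrow> ('k, 'a, 'm1) module_scheme \<Rightarrow> ('k, 'b, 'm2) module_scheme
      \<Rightarrow> ('a \<times> 'b) list \<Rightarrow> ('a, 'b) tens"
  where "tclass K A B xs = {ys. tensor_eq K A B xs ys}"

definition trep :: "('a, 'b) tens \<Rightarrow> ('a \<times> 'b) list"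
  where "trep t = (SOME xs. xs \<in> t)"

definition pure ::
    "('k, 'm) ring_scheme \<Rightarrow> ('k, 'a, 'm1) module_scheme \<Rightarrow> ('k, 'b, 'm2) module_scheme
      \<Rightarrow> 'a \<Rightarrow> 'b \<Rightarrow> ('a, 'b) tens"
  where "pure K A B a b = tclass K A B [(a, b)]"

text \<open>The underlying vector space of \<open>tensor K A B\<close> depends only on those of \<open>A\<close> and
  \<open>B\<close>; the multiplicative part is the tensor product algebra.\<close>

definition tensor ::
    "('k, 'm) ring_scheme \<Rightarrow> ('k, 'a, 'm1) module_scheme \<Rightarrow> ('k, 'b, 'm2) module_scheme
      \<Rightarrow> ('k, ('a, 'b) tens) module"
  where "tensor K A B =
    \<lparr>carrier = tclass K A B ` {xs. set xs \<subseteq> carrier A \<times> carrier B},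
     mult = (\<lambda>s t. tclass K A B
        [(a \<otimes>\<^bsub>A\<^esub> a', b \<otimes>\<^bsub>B\<^esub> b'). (a, b) \<leftarrow> trep s, (a', b') \<leftarrow> trep t]),
     one = pure K A B \<one>\<^bsub>A\<^esub> \<one>\<^bsub>B\<^esub>,
     zero = tclass K A B [],
     add = (\<lambda>s t. tclass K A B (trep s @ trep t)),
     smult = (\<lambda>c t. tclass K A B [(c \<odot>\<^bsub>A\<^esub> a, b). (a, b) \<leftarrow> trep t])\<rparr>"

text \<open>\<open>tlift M f\<close> is the linear map with values in \<open>M\<close> given by \<open>a \<otimes> b \<mapsto> f a b\<close>.
  It does not depend on the representing list as long as \<open>f\<close> is bilinear.  Nested uses of it
  spell out Sweedler notation.\<close>

definition tlift :: "('c, 'm) ring_scheme \<Rightarrow> ('a \<Rightarrow> 'b \<Rightarrow> 'c) \<Rightarrow> ('a, 'b) tens \<Rightarrow> 'c"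
  where "tlift M f t = foldr (\<lambda>(a, b) s. f a b \<oplus>\<^bsub>M\<^esub> s) (trep t) \<zero>\<^bsub>M\<^esub>"

text \<open>\<open>tmap K A' B' f g\<close> is \<open>f \<otimes> g\<close>, where \<open>A'\<close> and \<open>B'\<close> are the codomains of
  \<open>f\<close> and \<open>g\<close>.\<close>

definition tmap ::
    "('k, 'm) ring_scheme \<Rightarrow> ('k, 'a1, 'm1) module_scheme \<Rightarrow> ('k, 'b1, 'm2) module_scheme
      \<Rightarrow> ('a \<Rightarrow> 'a1) \<Rightarrow> ('b \<Rightarrow> 'b1) \<Rightarrow> ('a, 'b) tens \<Rightarrow> ('a1, 'b1) tens"
  where "tmap K A' B' f g = tlift (tensor K A' B') (\<lambda>a b. pure K A' B' (f a) (g b))"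

text \<open>The flip \<open>A \<otimes> B \<rightarrow> B \<otimes> A\<close> and the identification
  \<open>(A \<otimes> B) \<otimes> C \<rightarrow> A \<otimes> (B \<otimes> C)\<close>.\<close>

definition tflip ::
    "('k, 'm) ring_scheme \<Rightarrow> ('k, 'a, 'm1) module_scheme \<Rightarrow> ('k, 'b, 'm2) module_scheme
      \<Rightarrow> ('a, 'b) tens \<Rightarrow> ('b, 'a) tens"
  where "tflip K A B = tlift (tensor K B A) (\<lambda>a b. pure K B A b a)"

definition tassoc ::
    "('k, 'm) ring_scheme \<Rightarrow> ('k, 'a, 'm1) module_scheme \<Rightarrow> ('k, 'b, 'm2) module_scheme
      \<Rightarrow> ('k, 'c, 'm3) module_scheme \<Rightarrow> (('a, 'b) tens, 'c) tens \<Rightarrow> ('a, ('b, 'c) tens) tens"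
  where "tassoc K A B C = (let T = tensor K A (tensor K B C) in
     tlift T (\<lambda>u c. tlift T (\<lambda>a b. pure K A (tensor K B C) a (pure K B C b c)) u))"

definition mult_map :: "('a, 'm) ring_scheme \<Rightarrow> ('a, 'a) tens \<Rightarrow> 'a"
  where "mult_map A = tlift A (mult A)"


section \<open>Hopf algebras\<close>

record ('k, 'h) hopf = "('k, 'h) module" +
  comult :: "'h \<Rightarrow> ('h, 'h) tens"
  counit :: "'h \<Rightarrow> 'k"
  antipode :: "'h \<Rightarrow> 'h"

locale hopf_algebra = kalgebra K H for K (structure) and H :: "('k, 'h, 'm) hopf_scheme" (structure) +
  assumes comult_hom: "comult H \<in> kalg_hom K H (tensor K H H)"
    and counit_hom: "counit H \<in> kalg_hom K H (self_alg K)"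
    and antipode_linear: "antipode H \<in> klinear K H H"
    and coassoc: "h \<in> carrier H \<Longrightarrow>
        tassoc K H H H (tmap K (tensor K H H) H (comult H) (\<lambda>h. h) (comult H h))
        = tmap K H (tensor K H H) (\<lambda>h. h) (comult H) (comult H h)"
    and counit_left: "h \<in> carrier H \<Longrightarrow>
        tlift H (\<lambda>h1 h2. counit H h1 \<odot>\<^bsub>H\<^esub> h2) (comult H h) = h"
    and counit_right: "h \<in> carrier H \<Longrightarrow>
        tlift H (\<lambda>h1 h2. counit H h2 \<odot>\<^bsub>H\<^esub> h1) (comult H h) = h"
    and antipode_left: "h \<in> carrier H \<Longrightarrow>
        tlift H (\<lambda>h1 h2. antipode H h1 \<otimes>\<^bsub>H\<^esub> h2) (comult H h) = counit H h \<odot>\<^bsub>H\<^esub> \<one>\<^bsub>H\<^esub>"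
    and antipode_right: "h \<in> carrier H \<Longrightarrow>
        tlift H (\<lambda>h1 h2. h1 \<otimes>\<^bsub>H\<^esub> antipode H h2) (comult H h) = counit H h \<odot>\<^bsub>H\<^esub> \<one>\<^bsub>H\<^esub>"
    and antipode_bij: "bij_betw (antipode H) (carrier H) (carrier H)"

text \<open>The element written \<open>h\<^sup>o\<^sup>p\<close> in the opposite Hopf algebra is represented by \<open>h\<close>
  itself; as vector spaces \<open>H\<close> and \<open>opp H\<close> coincide.\<close>

definition opp :: "('k, 'h, 'm) hopf_scheme \<Rightarrow> ('k, 'h, 'm) hopf_scheme"
  where "opp H = H\<lparr>mult := (\<lambda>x y. y \<otimes>\<^bsub>H\<^esub> x),
     antipode := inv_into (carrier H) (antipode H)\<rparr>"

text \<open>The dual Hopf algebra consists of the linear functionals on \<open>carrier H\<close> (extended by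
  \<open>undefined\<close> outside, so that equality of functionals is equality of functions).  Thus the
  pairing \<open>p(h, \<theta>)\<close> is \<open>\<theta> h\<close>, and the product and coproduct are determined by
  \<open>p(h, \<theta>\<theta>') = p(h\<^sub>(\<^sub>1\<^sub>), \<theta>) p(h\<^sub>(\<^sub>2\<^sub>), \<theta>')\<close> and
  \<open>p(hh', \<theta>) = p(h, \<theta>\<^sub>(\<^sub>1\<^sub>)) p(h', \<theta>\<^sub>(\<^sub>2\<^sub>))\<close>.  The description of the
  coproduct presupposes that \<open>H\<close> is finite-dimensional.\<close>

definition dual_alg :: "('k, 'm) ring_scheme \<Rightarrow> ('k, 'h, 'm1) hopf_scheme \<Rightarrow> ('k, 'h \<Rightarrow> 'k) module"
  where "dual_alg K H =
    \<lparr>carrier = klinear K H (self_alg K) \<inter> extensional (carrier H),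
     mult = (\<lambda>\<theta> \<theta>'. \<lambda>h \<in> carrier H. tlift K (\<lambda>h1 h2. \<theta> h1 \<otimes>\<^bsub>K\<^esub> \<theta>' h2) (comult H h)),
     one = (\<lambda>h \<in> carrier H. counit H h),
     zero = (\<lambda>h \<in> carrier H. \<zero>\<^bsub>K\<^esub>),
     add = (\<lambda>\<theta> \<theta>'. \<lambda>h \<in> carrier H. \<theta> h \<oplus>\<^bsub>K\<^esub> \<theta>' h),
     smult = (\<lambda>c \<theta>. \<lambda>h \<in> carrier H. c \<otimes>\<^bsub>K\<^esub> \<theta> h)\<rparr>"

definition dual :: "('k, 'm) ring_scheme \<Rightarrow> ('k, 'h, 'm1) hopf_scheme \<Rightarrow> ('k, 'h \<Rightarrow> 'k) hopf"
  where "dual K H = module.extend (dual_alg K H)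
    (hopf.fields
      (\<lambda>\<theta>. THE t. t \<in> carrier (tensor K (dual_alg K H) (dual_alg K H)) \<and>
        (\<forall>h \<in> carrier H. \<forall>h' \<in> carrier H.
          \<theta> (h \<otimes>\<^bsub>H\<^esub> h') = tlift K (\<lambda>\<theta>1 \<theta>2. \<theta>1 h \<otimes>\<^bsub>K\<^esub> \<theta>2 h') t))
      (\<lambda>\<theta>. \<theta> \<one>\<^bsub>H\<^esub>)
      (\<lambda>\<theta>. \<lambda>h \<in> carrier H. \<theta> (antipode H h)))"


section \<open>Coactions and Yetter--Drinfeld algebras\<close>

definition right_coaction ::
    "('k, 'm) ring_scheme \<Rightarrow> ('k, 'x, 'm1) module_scheme \<Rightarrow> ('k, 'l, 'm2) hopf_scheme
      \<Rightarrow> ('x \<Rightarrow> ('x, 'l) tens) \<Rightarrow> bool"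
  where "right_coaction K X L \<alpha> \<longleftrightarrow>
     \<alpha> \<in> kalg_hom K X (tensor K X L) \<and>
     (\<forall>x \<in> carrier X.
        tassoc K X L L (tmap K (tensor K X L) L \<alpha> (\<lambda>l. l) (\<alpha> x))
        = tmap K X (tensor K L L) (\<lambda>x. x) (comult L) (\<alpha> x)) \<and>
     (\<forall>x \<in> carrier X. tlift X (\<lambda>y l. counit L l \<odot>\<^bsub>X\<^esub> y) (\<alpha> x) = x)"

text \<open>The canonical element \<open>\<Sum>\<^sub>i h\<^sub>i\<^sup>o\<^sup>p \<otimes> h\<^sub>i\<^sup>*\<close>, which does not depend on the basis.\<close>

definition U_op :: "('k, 'm) ring_scheme \<Rightarrow> ('k, 'h, 'm1) hopf_scheme \<Rightarrow> ('h, 'h \<Rightarrow> 'k) tens"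
  where "U_op K H = (let B = (SOME B. finite_basis K H B) in
     \<Oplus>\<^bsub>tensor K (opp H) (dual K H)\<^esub>b\<in>B. pure K (opp H) (dual K H) b (coord K H B b))"

text \<open>For invertible \<open>W\<close>, the inverse of \<open>Ad(W)\<close>, where \<open>Ad(W)(z) = W z W\<^sup>-\<^sup>1\<close>.\<close>

definition Ad_inv :: "('a, 'm) ring_scheme \<Rightarrow> 'a \<Rightarrow> 'a \<Rightarrow> 'a"
  where "Ad_inv A W z = inv\<^bsub>A\<^esub> W \<otimes>\<^bsub>A\<^esub> z \<otimes>\<^bsub>A\<^esub> W"

definition yetter_drinfeld_algebra ::
    "('k, 'm) ring_scheme \<Rightarrow> ('k, 'h, 'm1) hopf_scheme \<Rightarrow> ('k, 'x, 'm2) module_scheme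
      \<Rightarrow> ('x \<Rightarrow> ('x, 'h) tens) \<Rightarrow> ('x \<Rightarrow> ('x, 'h \<Rightarrow> 'k) tens) \<Rightarrow> bool"
  where "yetter_drinfeld_algebra K H X \<alpha> \<beta> \<longleftrightarrow>
     kalgebra K X \<and>
     right_coaction K X (opp H) \<alpha> \<and>
     right_coaction K X (dual K H) \<beta> \<and>
     (let Ho = opp H; D = dual K H in
      \<forall>x \<in> carrier X.
        tassoc K X Ho D (tmap K (tensor K X Ho) D \<alpha> (\<lambda>\<theta>. \<theta>) (\<beta> x))
        = tmap K X (tensor K Ho D) (\<lambda>x. x) (Ad_inv (tensor K Ho D) (U_op K H))
            (tmap K X (tensor K Ho D) (\<lambda>x. x) (tflip K D Ho)
              (tassoc K X D Ho (tmap K (tensor K X D) Ho \<beta> (\<lambda>h. h) (\<alpha> x)))))"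


section \<open>Braided commutativity\<close>

text \<open>The Heisenberg algebra: the vector space \<open>H \<otimes> dual K H\<close> with the product
  \<open>(h # \<theta>) (h' # \<theta>') = h h'\<^sub>(\<^sub>1\<^sub>) p(h'\<^sub>(\<^sub>2\<^sub>), \<theta>\<^sub>(\<^sub>1\<^sub>)) # \<theta>\<^sub>(\<^sub>2\<^sub>) \<theta>'\<close>.\<close>

definition heisenberg ::
    "('k, 'm) ring_scheme \<Rightarrow> ('k, 'h, 'm1) hopf_scheme \<Rightarrow> ('k, ('h, 'h \<Rightarrow> 'k) tens) module"
  where "heisenberg K H = (let D = dual K H; T = tensor K H D in
     T\<lparr>mult := (\<lambda>s t.
        tlift T (\<lambda>h \<theta>.
          tlift T (\<lambda>h' \<theta>'.
            tlift T (\<lambda>h'1 h'2.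
              tlift T (\<lambda>\<theta>1 \<theta>2.
                pure K H D (\<theta>1 h'2 \<odot>\<^bsub>H\<^esub> (h \<otimes>\<^bsub>H\<^esub> h'1)) (\<theta>2 \<otimes>\<^bsub>D\<^esub> \<theta>'))
              (comult D \<theta>))
            (comult H h'))
          t)
        s)\<rparr>)"

definition iota1 ::
    "('k, 'm) ring_scheme \<Rightarrow> ('k, 'h, 'm1) hopf_scheme \<Rightarrow> ('k, 'x, 'm2) module_scheme
      \<Rightarrow> ('x, 'h) tens \<Rightarrow> ('x, ('h, 'h \<Rightarrow> 'k) tens) tens"
  where "iota1 K H X = tmap K X (heisenberg K H) (\<lambda>x. x)
     (\<lambda>h. pure K H (dual K H) h \<one>\<^bsub>dual K H\<^esub>)"

definition iota2 ::
    "('k, 'm) ring_scheme \<Rightarrow> ('k, 'h, 'm1) hopf_scheme \<Rightarrow> ('k, 'x, 'm2) module_scheme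
      \<Rightarrow> ('x, 'h \<Rightarrow> 'k) tens \<Rightarrow> ('x, ('h, 'h \<Rightarrow> 'k) tens) tens"
  where "iota2 K H X = tmap K X (heisenberg K H) (\<lambda>x. x)
     (\<lambda>\<theta>. pure K H (dual K H) \<one>\<^bsub>H\<^esub> \<theta>)"

text \<open>The linear map \<open>x \<mapsto> x\<^sub>[\<^sub>0\<^sub>] \<otimes> x\<^sub>[\<^sub>1\<^sub>]\<close> where
  \<open>\<alpha>(x) = x\<^sub>[\<^sub>0\<^sub>] \<otimes> x\<^sub>[\<^sub>1\<^sub>]\<^sup>o\<^sup>p\<close>.\<close>

definition alpha_dot ::
    "('k, 'm) ring_scheme \<Rightarrow> ('k, 'h, 'm1) hopf_scheme \<Rightarrow> ('k, 'x, 'm2) module_scheme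
      \<Rightarrow> ('x \<Rightarrow> ('x, 'h) tens) \<Rightarrow> 'x \<Rightarrow> ('x, 'h) tens"
  where "alpha_dot K H X \<alpha> x = tmap K X H (\<lambda>x. x) (\<lambda>h. h) (\<alpha> x)"

definition braided_commutative_heisenberg ::
    "('k, 'm) ring_scheme \<Rightarrow> ('k, 'h, 'm1) hopf_scheme \<Rightarrow> ('k, 'x, 'm2) module_scheme
      \<Rightarrow> ('x \<Rightarrow> ('x, 'h) tens) \<Rightarrow> ('x \<Rightarrow> ('x, 'h \<Rightarrow> 'k) tens) \<Rightarrow> bool"
  where "braided_commutative_heisenberg K H X \<alpha> \<beta> \<longleftrightarrow>
     (let D = dual K H; T = tensor K X (heisenberg K H); XH = tensor K X H; XD = tensor K X D;
          S\<alpha> = (\<lambda>x. tmap K X H (\<lambda>x. x) (antipode H) (alpha_dot K H X \<alpha> x))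
      in \<forall>x \<in> carrier X. \<forall>y \<in> carrier X.
        mult_map T (tmap K T T (iota1 K H X) (iota2 K H X) (pure K XH XD (S\<alpha> x) (\<beta> y)))
        = mult_map T (tmap K T T (iota2 K H X) (iota1 K H X) (pure K XD XH (\<beta> y) (S\<alpha> x))))"

text \<open>The left action \<open>h \<rhd>\<^sub>\<beta> x = (id \<otimes> p(h, -))(\<beta>(x))\<close>.\<close>

definition act ::
    "('k, 'x, 'm2) module_scheme \<Rightarrow> ('x \<Rightarrow> ('x, 'h \<Rightarrow> 'k) tens) \<Rightarrow> 'h \<Rightarrow> 'x \<Rightarrow> 'x"
  where "act X \<beta> h x = tlift X (\<lambda>y \<theta>. \<theta> h \<odot>\<^bsub>X\<^esub> y) (\<beta> x)"

text \<open>Braided commutativity \<open>x y = (S(x\<^sub>[\<^sub>1\<^sub>]) \<rhd> y) x\<^sub>[\<^sub>0\<^sub>]\<close> of a left-right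
  Yetter--Drinfeld algebra \<open>(X, \<rhd>, \<alpha>)\<close> over \<open>H\<close>.\<close>

definition braided_commutative ::
    "('k, 'h, 'm1) hopf_scheme \<Rightarrow> ('k, 'x, 'm2) module_scheme
      \<Rightarrow> ('h \<Rightarrow> 'x \<Rightarrow> 'x) \<Rightarrow> ('x \<Rightarrow> ('x, 'h) tens) \<Rightarrow> bool"
  where "braided_commutative H X actn \<alpha> \<longleftrightarrow>
     (\<forall>x \<in> carrier X. \<forall>y \<in> carrier X.
        x \<otimes>\<^bsub>X\<^esub> y = tlift X (\<lambda>x0 x1. actn (antipode H x1) y \<otimes>\<^bsub>X\<^esub> x0) (\<alpha> x))"

end

theory Submission
  imports Defs
begin

text \<open>
  Write \<open>\<alpha>(x) = x\<^sub>0 \<otimes> x\<^sub>1\<close>, \<open>\<beta>(y) = y\<^sub>0 \<otimes> y\<^sub>1\<close> and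
  \<open>R(x, y) = (S(x\<^sub>1) \<rhd> y) x\<^sub>0\<close>, so that braided commutativity over \<open>H\<close> says
  \<open>x y = R(x, y)\<close>.  The left-hand side of the Heisenberg condition is
  \<open>x\<^sub>0 y\<^sub>0 \<otimes> (S(x\<^sub>1) # y\<^sub>1)\<close>, because \<open>(h # 1)(1 # \<theta>) = h # \<theta>\<close>.
  The right-hand side straightens \<open>(1 # y\<^sub>1)(S(x\<^sub>1) # 1)\<close>.  The Heisenberg product splits
  both \<open>S(x\<^sub>1)\<close> and \<open>y\<^sub>1\<close> and pairs the second part of the former with the first
  part of the latter; the antipode reverses the coproduct, so after applying the coaction axioms of
  \<open>\<alpha>\<close> and \<open>\<beta>\<close> the paired factors are exactly those which form \<open>R\<close>, and
  the right-hand side is \<open>R(x\<^sub>0, y\<^sub>0) \<otimes> (S(x\<^sub>1) # y\<^sub>1)\<close>.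

  Both sides are thus obtained by one and the same procedure from a bilinear map
  \<open>P : X \<times> X \<rightarrow> X\<close>, namely
  \<open>(x, y) \<mapsto> P(x\<^sub>0, y\<^sub>0) \<otimes> (S(x\<^sub>1) # y\<^sub>1)\<close>, with \<open>P\<close> the
  product of \<open>X\<close> on the left and \<open>P = R\<close> on the right (\<open>left_side\<close>,
  \<open>right_side\<close>).  This procedure has a left inverse: applying \<open>\<epsilon>\<close> to
  \<open>H\<close> and evaluation at \<open>1\<close> to the dual returns \<open>P(x, y)\<close>, by the counit axioms
  and \<open>\<epsilon> \<circ> S = \<epsilon>\<close> (\<open>collapse_spread\<close>).  Hence the two sides agree for
  all \<open>x, y\<close> if and only if \<open>x y = R(x, y)\<close> for all \<open>x, y\<close>.

  Sweedler notation is rendered by nested uses of \<open>tlift\<close>, with values in an arbitrary vector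
  space.  A tensor identity is used in the form that all multilinear maps take the same value on its two
  sides; coassociativity becomes \<open>coaction_trilinear\<close>, and a computation with Sweedler indices
  becomes a chain of equations in which each step is such a rule, an exchange of two sums
  (\<open>tlift_swap\<close>) or the passage of a linear map through a sum (\<open>klinear_tlift\<close>).
  The remaining obligations, that the maps are linear in each argument, are discharged by a small set of
  introduction rules.
\<close>

section \<open>Linear and bilinear maps\<close>

lemma klinearI:
  assumes "\<And>x. x \<in> carrier A \<Longrightarrow> f x \<in> carrier B"
    and "\<And>x y. \<lbrakk>x \<in> carrier A; y \<in> carrier A\<rbrakk> \<Longrightarrow> f (x \<oplus>\<^bsub>A\<^esub> y) = f x \<oplus>\<^bsub>B\<^esub> f y"
    and "\<And>c x. \<lbrakk>c \<in> carrier K; x \<in> carrier A\<rbrakk> \<Longrightarrow> f (c \<odot>\<^bsub>A\<^esub> x) = c \<odot>\<^bsub>B\<^esub> f x"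
  shows "f \<in> klinear K A B"
  using assms by (auto simp: klinear_def)

lemma klinear_closed: "\<lbrakk>f \<in> klinear K A B; x \<in> carrier A\<rbrakk> \<Longrightarrow> f x \<in> carrier B"
  by (auto simp: klinear_def)

lemma klinear_add:
  "\<lbrakk>f \<in> klinear K A B; x \<in> carrier A; y \<in> carrier A\<rbrakk> \<Longrightarrow> f (x \<oplus>\<^bsub>A\<^esub> y) = f x \<oplus>\<^bsub>B\<^esub> f y"
  by (auto simp: klinear_def)

lemma klinear_smult:
  "\<lbrakk>f \<in> klinear K A B; c \<in> carrier K; x \<in> carrier A\<rbrakk> \<Longrightarrow> f (c \<odot>\<^bsub>A\<^esub> x) = c \<odot>\<^bsub>B\<^esub> f x"
  by (auto simp: klinear_def)

lemma klinear_zero: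
  assumes "module K A" "module K B" "f \<in> klinear K A B"
  shows "f \<zero>\<^bsub>A\<^esub> = \<zero>\<^bsub>B\<^esub>"
proof -
  interpret A: module K A by fact
  interpret B: module K B by fact
  have "f (\<zero>\<^bsub>K\<^esub> \<odot>\<^bsub>A\<^esub> \<zero>\<^bsub>A\<^esub>) = \<zero>\<^bsub>K\<^esub> \<odot>\<^bsub>B\<^esub> f \<zero>\<^bsub>A\<^esub>"
    using assms(3) by (intro klinear_smult) auto
  then show ?thesis
    using klinear_closed[OF assms(3) A.zero_closed] by (simp add: A.smult_l_null B.smult_l_null)
qed

lemma klinear_ident: "(\<lambda>x. x) \<in> klinear K A A"
  by (auto simp: klinear_def)

lemma klinear_compose:
  "\<lbrakk>g \<in> klinear K B C; f \<in> klinear K A B\<rbrakk> \<Longrightarrow> (\<lambda>x. g (f x)) \<in> klinear K A C"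
  by (auto simp: klinear_def Pi_iff)

lemma klinear_cong:
  assumes "module K A" "f \<in> klinear K A B" "\<And>x. x \<in> carrier A \<Longrightarrow> g x = f x"
  shows "g \<in> klinear K A B"
proof -
  interpret A: module K A by fact
  show ?thesis using assms(2,3) by (auto simp: klinear_def Pi_iff)
qed

definition bilinear ::
    "('k, 'm) ring_scheme \<Rightarrow> ('k, 'a, 'm1) module_scheme \<Rightarrow> ('k, 'b, 'm2) module_scheme
      \<Rightarrow> ('k, 'c, 'm3) module_scheme \<Rightarrow> ('a \<Rightarrow> 'b \<Rightarrow> 'c) \<Rightarrow> bool"
  where "bilinear K A B M f \<longleftrightarrow>
     (\<forall>a \<in> carrier A. (\<lambda>b. f a b) \<in> klinear K B M) \<and> (\<forall>b \<in> carrier B. (\<lambda>a. f a b) \<in> klinear K A M)"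

lemma bilinearI:
  assumes "\<And>b. b \<in> carrier B \<Longrightarrow> (\<lambda>a. f a b) \<in> klinear K A M"
    and "\<And>a. a \<in> carrier A \<Longrightarrow> (\<lambda>b. f a b) \<in> klinear K B M"
  shows "bilinear K A B M f"
  using assms by (simp add: bilinear_def)

lemma bilinear_left:
  "\<lbrakk>bilinear K A B M f; b \<in> carrier B; g \<in> klinear K V A\<rbrakk> \<Longrightarrow> (\<lambda>v. f (g v) b) \<in> klinear K V M"
  unfolding bilinear_def using klinear_compose[of "\<lambda>a. f a b" K A M g V] by blast

lemma bilinear_right:
  "\<lbrakk>bilinear K A B M f; a \<in> carrier A; g \<in> klinear K V B\<rbrakk> \<Longrightarrow> (\<lambda>v. f a (g v)) \<in> klinear K V M"
  unfolding bilinear_def using klinear_compose[of "\<lambda>b. f a b" K B M g V] by blast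

lemma bilinear_closed:
  "\<lbrakk>bilinear K A B M f; a \<in> carrier A; b \<in> carrier B\<rbrakk> \<Longrightarrow> f a b \<in> carrier M"
  by (auto simp: bilinear_def klinear_def)

lemma bilinear_zero_left:
  assumes "module K A" "module K M" "bilinear K A B M f" "b \<in> carrier B"
  shows "f \<zero>\<^bsub>A\<^esub> b = \<zero>\<^bsub>M\<^esub>"
  using klinear_zero[of K A M "\<lambda>a. f a b"] assms by (simp add: bilinear_def)

lemma klinear_smult_const:
  assumes "module K M" "c \<in> carrier K" "f \<in> klinear K V M"
  shows "(\<lambda>v. c \<odot>\<^bsub>M\<^esub> f v) \<in> klinear K V M"
proof -
  interpret M: module K M by fact
  have "c \<odot>\<^bsub>M\<^esub> (d \<odot>\<^bsub>M\<^esub> v) = d \<odot>\<^bsub>M\<^esub> (c \<odot>\<^bsub>M\<^esub> v)" if "d \<in> carrier K" "v \<in> carrier M" for d v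
    using that assms(2) M.R.m_comm[of c d] by (simp add: M.smult_assoc1[symmetric])
  then show ?thesis using assms(2,3)
    by (auto simp: klinear_def Pi_iff M.smult_r_distr)
qed

lemma self_alg_simps [simp]:
  "carrier (self_alg K) = carrier K" "add (self_alg K) = add K" "zero (self_alg K) = zero K"
  "smult (self_alg K) = mult K" "mult (self_alg K) = mult K" "one (self_alg K) = one K"
  by (simp_all add: self_alg_def)

lemma module_self_alg:
  assumes "cring K" shows "module K (self_alg K)"
proof -
  interpret cring K by fact
  show ?thesis
    by (intro module.intro module_axioms.intro abelian_groupI)
      (auto simp: a_ac l_distr r_distr m_assoc intro: is_cring bexI[of _ "\<ominus>\<^bsub>K\<^esub> _"] l_neg)
qed

lemma klinear_smult_vec:
  assumes "module K M" "v \<in> carrier M" "f \<in> klinear K V (self_alg K)"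
  shows "(\<lambda>x. f x \<odot>\<^bsub>M\<^esub> v) \<in> klinear K V M"
proof -
  interpret M: module K M by fact
  show ?thesis using assms(2,3)
    by (auto simp: klinear_def Pi_def M.smult_l_distr M.smult_assoc1)
qed

text \<open>What is linear on \<open>H\<close> is then linear on \<open>opp H\<close>, whose product and
  antipode differ, and what is linear on \<open>tensor K H (dual K H)\<close> is linear on the Heisenberg
  algebra.\<close>

definition same_space :: "('k, 'a, 'm1) module_scheme \<Rightarrow> ('k, 'a, 'm2) module_scheme \<Rightarrow> bool"
  where "same_space A B \<longleftrightarrow> carrier B = carrier A \<and> add B = add A \<and> zero B = zero A \<and> smult B = smult A"

lemma module_same_space:
  assumes "module K A" "same_space A B" shows "module K B"
proof -
  interpret A: module K A by fact
  show ?thesis using assms(2)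
    by (intro module.intro module_axioms.intro abelian_groupI)
      (auto simp: same_space_def A.a_ac A.smult_l_distr A.smult_r_distr A.smult_assoc1
        intro: A.is_cring bexI[of _ "\<ominus>\<^bsub>A\<^esub> _"] A.l_neg)
qed

lemma klinear_same_space:
  "same_space A A' \<Longrightarrow> klinear K A' B = klinear K A B"
  "same_space B B' \<Longrightarrow> klinear K A B' = klinear K A B"
  by (auto simp: klinear_def same_space_def)

section \<open>Sums over lists of pairs\<close>

definition pair_sum :: "('c, 'm) ring_scheme \<Rightarrow> ('a \<Rightarrow> 'b \<Rightarrow> 'c) \<Rightarrow> ('a \<times> 'b) list \<Rightarrow> 'c"
  where "pair_sum M f xs = foldr (\<lambda>(a, b) s. f a b \<oplus>\<^bsub>M\<^esub> s) xs \<zero>\<^bsub>M\<^esub>"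

lemma pair_sum_simps [simp]:
  "pair_sum M f [] = \<zero>\<^bsub>M\<^esub>"
  "pair_sum M f ((a, b) # xs) = f a b \<oplus>\<^bsub>M\<^esub> pair_sum M f xs"
  by (simp_all add: pair_sum_def)

lemma tlift_pair_sum: "tlift M f t = pair_sum M f (trep t)"
  by (simp add: tlift_def pair_sum_def)

lemma pair_sum_closed:
  assumes "abelian_monoid M" "\<And>a b. (a, b) \<in> set xs \<Longrightarrow> f a b \<in> carrier M"
  shows "pair_sum M f xs \<in> carrier M"
proof -
  interpret abelian_monoid M by fact
  show ?thesis using assms(2) by (induction xs) auto
qed

lemma pair_sum_append:
  assumes "abelian_monoid M" "\<And>a b. (a, b) \<in> set xs \<union> set ys \<Longrightarrow> f a b \<in> carrier M"
  shows "pair_sum M f (xs @ ys) = pair_sum M f xs \<oplus>\<^bsub>M\<^esub> pair_sum M f ys"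
proof -
  interpret abelian_monoid M by fact
  show ?thesis using assms(2)
    by (induction xs) (auto simp: a_assoc pair_sum_closed[OF assms(1)])
qed

lemma pair_sum_cong:
  "(\<And>a b. (a, b) \<in> set xs \<Longrightarrow> f a b = g a b) \<Longrightarrow> pair_sum M f xs = pair_sum M g xs"
  by (induction xs) auto

lemma pair_sum_add:
  assumes "abelian_monoid M"
    and "\<And>a b. (a, b) \<in> set xs \<Longrightarrow> f a b \<in> carrier M" "\<And>a b. (a, b) \<in> set xs \<Longrightarrow> g a b \<in> carrier M"
  shows "pair_sum M (\<lambda>a b. f a b \<oplus>\<^bsub>M\<^esub> g a b) xs = pair_sum M f xs \<oplus>\<^bsub>M\<^esub> pair_sum M g xs"
proof -
  interpret abelian_monoid M by fact
  show ?thesis using assms(2,3)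
    by (induction xs) (auto simp: a_ac pair_sum_closed[OF assms(1)])
qed

lemma pair_sum_zero:
  assumes "abelian_monoid M" shows "pair_sum M (\<lambda>a b. \<zero>\<^bsub>M\<^esub>) xs = \<zero>\<^bsub>M\<^esub>"
proof -
  interpret abelian_monoid M by fact
  show ?thesis by (induction xs) auto
qed

lemma pair_sum_swap:
  assumes "abelian_monoid M"
    and "\<And>a b c d. \<lbrakk>(a, b) \<in> set xs; (c, d) \<in> set ys\<rbrakk> \<Longrightarrow> f a b c d \<in> carrier M"
  shows "pair_sum M (\<lambda>a b. pair_sum M (\<lambda>c d. f a b c d) ys) xs
    = pair_sum M (\<lambda>c d. pair_sum M (\<lambda>a b. f a b c d) xs) ys"
  using assms(2)
proof (induction xs)
  case Nil
  then show ?case by (simp add: pair_sum_zero[OF assms(1)])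
next
  case (Cons p xs)
  then show ?case
    by (cases p) (auto simp: pair_sum_add[OF assms(1)] pair_sum_closed[OF assms(1)])
qed

lemma klinear_pair_sum:
  assumes "module K V" "module K M" "\<phi> \<in> klinear K V M"
    and "\<And>a b. (a, b) \<in> set xs \<Longrightarrow> g a b \<in> carrier V"
  shows "\<phi> (pair_sum V g xs) = pair_sum M (\<lambda>a b. \<phi> (g a b)) xs"
proof -
  interpret V: module K V by fact
  show ?thesis using assms(4)
    by (induction xs)
      (auto simp: klinear_zero[OF assms(1-3)] klinear_add[OF assms(3)] pair_sum_closed[OF V.abelian_monoid_axioms])
qed

section \<open>The tensor product of vector spaces\<close>

lemma tensor_eq_carrier:
  assumes "module K A" "module K B" "tensor_eq K A B xs ys"
  shows "set xs \<subseteq> carrier A \<times> carrier B \<and> set ys \<subseteq> carrier A \<times> carrier B"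
proof -
  interpret A: module K A by fact
  interpret B: module K B by fact
  show ?thesis using assms(3) by (induction rule: tensor_eq.induct) auto
qed

text \<open>The universal property of the tensor product, at the level of representing lists: every
  generating relation of the congruence is respected by a bilinear map.\<close>

lemma tensor_eq_pair_sum:
  assumes "module K A" "module K B" "module K M" "bilinear K A B M f" "tensor_eq K A B xs ys"
  shows "pair_sum M f xs = pair_sum M f ys"
proof -
  interpret A: module K A by fact
  interpret B: module K B by fact
  interpret M: module K M by fact
  note am = M.abelian_monoid_axioms
  note cl = bilinear_closed[OF assms(4)]
  have left: "(\<lambda>a. f a b) \<in> klinear K A M" if "b \<in> carrier B" for b
    using assms(4) that by (simp add: bilinear_def)
  have right: "(\<lambda>b. f a b) \<in> klinear K B M" if "a \<in> carrier A" for a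
    using assms(4) that by (simp add: bilinear_def)
  show ?thesis using assms(5)
  proof (induction rule: tensor_eq.induct)
    case (append xs xs' ys ys')
    then show ?case
      using tensor_eq_carrier[OF assms(1,2) append(1)] tensor_eq_carrier[OF assms(1,2) append(2)]
      by (subst (1 2) pair_sum_append[OF am]) (auto intro!: cl)
  next
    case (commute xs ys)
    then have "pair_sum M f xs \<in> carrier M" "pair_sum M f ys \<in> carrier M"
      by (auto intro!: pair_sum_closed[OF am] cl)
    with commute show ?case
      by (subst (1 2) pair_sum_append[OF am]) (auto intro!: cl simp: M.a_comm)
  next
    case (add_left a a' b)
    then show ?case using klinear_add[OF left[of b]] cl by (simp add: M.a_assoc)
  next
    case (add_right a b b')
    then show ?case using klinear_add[OF right[of a]] cl by (simp add: M.a_assoc)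
  next
    case (balanced c a b)
    then show ?case using klinear_smult[OF left[of b]] klinear_smult[OF right[of a]] cl by simp
  next
    case (zero b)
    then show ?case using bilinear_zero_left[OF assms(1,3,4)] by simp
  qed simp_all
qed

lemma tensor_eq_same_space_imp:
  assumes "same_space A A'" "same_space B B'" "tensor_eq K A B xs ys"
  shows "tensor_eq K A' B' xs ys"
  using assms(3)
proof (induction rule: tensor_eq.induct)
  case (trans xs ys zs)
  show ?case by (rule tensor_eq.trans[OF trans.IH])
next
  case (commute xs ys)
  then show ?case by (intro tensor_eq.commute) (use assms(1,2) in \<open>simp_all add: same_space_def\<close>)
next
  case (add_left a a' b)
  then show ?case using tensor_eq.add_left[of a A' a' b B' K] assms(1,2) by (simp add: same_space_def)
next
  case (add_right a b b')
  then show ?case using tensor_eq.add_right[of a A' b B' b' K] assms(1,2) by (simp add: same_space_def)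
next
  case (balanced c a b)
  then show ?case using tensor_eq.balanced[of c K a A' b B'] assms(1,2) by (simp add: same_space_def)
next
  case (zero b)
  then show ?case using tensor_eq.zero[of b B' K A'] assms(1,2) by (simp add: same_space_def)
qed (use assms(1,2) in \<open>auto simp: same_space_def intro: tensor_eq.refl tensor_eq.sym tensor_eq.append\<close>)

lemma same_space_sym: "same_space A B \<Longrightarrow> same_space B A"
  by (simp add: same_space_def)

lemma same_space_refl: "same_space A A"
  by (simp add: same_space_def)

lemma tclass_same_space:
  assumes "same_space A A'" "same_space B B'"
  shows "tclass K A' B' = tclass K A B"
proof -
  have "tensor_eq K A' B' xs ys \<longleftrightarrow> tensor_eq K A B xs ys" for xs ys
    using tensor_eq_same_space_imp[of A A' B B' K xs ys] tensor_eq_same_space_imp[of A' A B' B K xs ys]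
      same_space_sym[OF assms(1)] same_space_sym[OF assms(2)] assms by blast
  then show ?thesis by (auto simp: tclass_def fun_eq_iff)
qed

lemma tensor_same_space:
  assumes "same_space A A'" "same_space B B'"
  shows "same_space (tensor K A B) (tensor K A' B')"
  using assms tclass_same_space[OF assms, of K] by (simp add: same_space_def tensor_def)

lemma tclass_eq:
  "tensor_eq K A B xs ys \<Longrightarrow> tclass K A B xs = tclass K A B ys"
  unfolding tclass_def by (auto intro: tensor_eq.sym tensor_eq.trans)

lemma trep_tclass:
  assumes "set xs \<subseteq> carrier A \<times> carrier B"
  shows "tensor_eq K A B xs (trep (tclass K A B xs))"
proof -
  have "xs \<in> tclass K A B xs" using assms by (simp add: tclass_def tensor_eq.refl)
  then have "trep (tclass K A B xs) \<in> tclass K A B xs" unfolding trep_def by (rule someI)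
  then show ?thesis by (simp add: tclass_def)
qed

lemma tensor_carrier:
  assumes "module K A" "module K B" "t \<in> carrier (tensor K A B)"
  shows "set (trep t) \<subseteq> carrier A \<times> carrier B" "tclass K A B (trep t) = t"
proof -
  obtain xs where xs: "set xs \<subseteq> carrier A \<times> carrier B" "t = tclass K A B xs"
    using assms(3) by (auto simp: tensor_def)
  note eq = trep_tclass[OF xs(1), of K]
  show "set (trep t) \<subseteq> carrier A \<times> carrier B"
    using tensor_eq_carrier[OF assms(1,2) eq] xs(2) by simp
  show "tclass K A B (trep t) = t" using tclass_eq[OF eq] xs(2) by simp
qed

lemma tclass_closed: "set xs \<subseteq> carrier A \<times> carrier B \<Longrightarrow> tclass K A B xs \<in> carrier (tensor K A B)"
  by (simp add: tensor_def)

lemma tclass_add: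
  assumes "set xs \<subseteq> carrier A \<times> carrier B" "set ys \<subseteq> carrier A \<times> carrier B"
  shows "tclass K A B xs \<oplus>\<^bsub>tensor K A B\<^esub> tclass K A B ys = tclass K A B (xs @ ys)"
proof -
  have "tensor_eq K A B (xs @ ys) (trep (tclass K A B xs) @ trep (tclass K A B ys))"
    by (intro tensor_eq.append trep_tclass assms)
  from tclass_eq[OF this] show ?thesis by (simp add: tensor_def)
qed

lemma tensor_eq_smult:
  assumes "module K A" "module K B" "c \<in> carrier K" "tensor_eq K A B xs ys"
  shows "tensor_eq K A B (map (\<lambda>(a, b). (c \<odot>\<^bsub>A\<^esub> a, b)) xs) (map (\<lambda>(a, b). (c \<odot>\<^bsub>A\<^esub> a, b)) ys)"
proof -
  interpret A: module K A by fact
  interpret B: module K B by fact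
  let ?m = "map (\<lambda>(a, b). (c \<odot>\<^bsub>A\<^esub> a, b))"
  have in_carrier: "set (?m zs) \<subseteq> carrier A \<times> carrier B" if "set zs \<subseteq> carrier A \<times> carrier B" for zs
    using that assms(3) by auto
  show ?thesis using assms(4)
  proof (induction rule: tensor_eq.induct)
    case (refl xs)
    show ?case by (rule tensor_eq.refl) (rule in_carrier[OF refl])
  next
    case (commute xs ys)
    show ?case unfolding map_append
      by (rule tensor_eq.commute) (intro in_carrier commute)+
  next
    case (add_left a a' b)
    then show ?case
      using tensor_eq.add_left[of "c \<odot>\<^bsub>A\<^esub> a" A "c \<odot>\<^bsub>A\<^esub> a'" b B K] assms(3)
      by (simp add: A.smult_r_distr)
  next
    case (add_right a b b')
    then show ?case using assms(3) by (simp add: tensor_eq.add_right)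
  next
    case (balanced d a b)
    then show ?case
      using tensor_eq.balanced[of d K "c \<odot>\<^bsub>A\<^esub> a" A b B] assms(3)
      by (simp add: A.smult_assoc1[symmetric] A.m_comm)
  next
    case (zero b)
    then show ?case using assms(3) tensor_eq.zero[of b B K A] by simp
  qed (auto intro: tensor_eq.sym tensor_eq.trans tensor_eq.append)
qed

lemma tclass_smult:
  assumes "module K A" "module K B" "c \<in> carrier K" "set xs \<subseteq> carrier A \<times> carrier B"
  shows "c \<odot>\<^bsub>tensor K A B\<^esub> tclass K A B xs = tclass K A B (map (\<lambda>(a, b). (c \<odot>\<^bsub>A\<^esub> a, b)) xs)"
  using tclass_eq[OF tensor_eq_smult[OF assms(1-3) trep_tclass[OF assms(4)]]] 
  by (simp add: tensor_def)

text \<open>Negatives exist because \<open>(- a) \<otimes> b\<close> cancels \<open>a \<otimes> b\<close>; they are built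
  one list entry at a time.\<close>

lemma tensor_abelian_group:
  assumes "module K A" "module K B"
  shows "abelian_group (tensor K A B)"
proof -
  interpret A: module K A by fact
  interpret B: module K B by fact
  let ?T = "tensor K A B" and ?c = "tclass K A B"
  note cl = tclass_closed[of _ A B K] and add = tclass_add[of _ A B _ K]
  note rep = tensor_carrier[OF assms]
  have zero: "\<zero>\<^bsub>?T\<^esub> = ?c []" by (simp add: tensor_def)
  have pair: "\<exists>t \<in> carrier ?T. t \<oplus>\<^bsub>?T\<^esub> ?c xs = \<zero>\<^bsub>?T\<^esub>" if "set xs \<subseteq> carrier A \<times> carrier B" for xs
    using that
  proof (induction xs)
    case Nil
    then show ?case using add[of "[]" "[]"] cl[of "[]"] zero by auto
  next
    case (Cons p xs)
    obtain a b where p: "p = (a, b)" "a \<in> carrier A" "b \<in> carrier B" using Cons.prems by auto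
    obtain t where t: "t \<in> carrier ?T" "t \<oplus>\<^bsub>?T\<^esub> ?c xs = \<zero>\<^bsub>?T\<^esub>" using Cons by auto
    let ?ys = "trep t @ [(\<ominus>\<^bsub>A\<^esub> a, b)]"
    have ys: "set ?ys \<subseteq> carrier A \<times> carrier B" using rep(1)[OF t(1)] p by auto
    have xs: "set xs \<subseteq> carrier A \<times> carrier B" using Cons.prems by simp
    have sum: "?c [(\<ominus>\<^bsub>A\<^esub> a, b), p] = ?c []"
    proof -
      have "tensor_eq K A B [(\<ominus>\<^bsub>A\<^esub> a \<oplus>\<^bsub>A\<^esub> a, b)] [(\<ominus>\<^bsub>A\<^esub> a, b), (a, b)]"
        by (rule tensor_eq.add_left) (use p in auto)
      from tclass_eq[OF this] show ?thesis
        using tclass_eq[OF tensor_eq.zero[of b B K A]] p by (simp add: A.l_neg)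
    qed
    have "?c ?ys \<oplus>\<^bsub>?T\<^esub> ?c (p # xs) = ?c (trep t @ [(\<ominus>\<^bsub>A\<^esub> a, b), p] @ xs)"
      using add[OF ys Cons.prems] by simp
    also have "\<dots> = ?c (trep t) \<oplus>\<^bsub>?T\<^esub> ?c ([(\<ominus>\<^bsub>A\<^esub> a, b), p] @ xs)"
      by (rule add[symmetric]) (use p ys xs in auto)
    also have "\<dots> = ?c (trep t) \<oplus>\<^bsub>?T\<^esub> (?c [(\<ominus>\<^bsub>A\<^esub> a, b), p] \<oplus>\<^bsub>?T\<^esub> ?c xs)"
      by (subst add[of "[(\<ominus>\<^bsub>A\<^esub> a, b), p]"]) (use p xs in auto)
    also have "\<dots> = ?c (trep t) \<oplus>\<^bsub>?T\<^esub> ?c xs"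
      using xs by (simp add: sum add)
    also have "\<dots> = \<zero>\<^bsub>?T\<^esub>" using t rep(2) by simp
    finally show ?case using cl[OF ys] by blast
  qed
  show ?thesis
  proof (rule abelian_groupI)
    fix s t u assume *: "s \<in> carrier ?T" "t \<in> carrier ?T" "u \<in> carrier ?T"
    note v = rep(1)[OF *(1)] rep(1)[OF *(2)] rep(1)[OF *(3)]
    have "?c (trep s) \<oplus>\<^bsub>?T\<^esub> ?c (trep t) \<oplus>\<^bsub>?T\<^esub> ?c (trep u)
        = ?c (trep s) \<oplus>\<^bsub>?T\<^esub> (?c (trep t) \<oplus>\<^bsub>?T\<^esub> ?c (trep u))"
      using v by (simp add: add)
    then show "s \<oplus>\<^bsub>?T\<^esub> t \<oplus>\<^bsub>?T\<^esub> u = s \<oplus>\<^bsub>?T\<^esub> (t \<oplus>\<^bsub>?T\<^esub> u)" using * rep(2) by simp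
  next
    fix s t assume *: "s \<in> carrier ?T" "t \<in> carrier ?T"
    note v = rep(1)[OF *(1)] rep(1)[OF *(2)]
    have "?c (trep s) \<oplus>\<^bsub>?T\<^esub> ?c (trep t) \<in> carrier ?T"
      using v by (auto simp: add intro!: cl)
    then show "s \<oplus>\<^bsub>?T\<^esub> t \<in> carrier ?T" using * rep(2) by simp
    have "?c (trep s) \<oplus>\<^bsub>?T\<^esub> ?c (trep t) = ?c (trep t) \<oplus>\<^bsub>?T\<^esub> ?c (trep s)"
      using v by (simp add: add tclass_eq[OF tensor_eq.commute])
    then show "s \<oplus>\<^bsub>?T\<^esub> t = t \<oplus>\<^bsub>?T\<^esub> s" using * rep(2) by simp
  next
    fix t assume *: "t \<in> carrier ?T"
    show "\<zero>\<^bsub>?T\<^esub> \<oplus>\<^bsub>?T\<^esub> t = t"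
      using add[OF _ rep(1)[OF *], of "[]"] rep(2)[OF *] zero by simp
    show "\<exists>s \<in> carrier ?T. s \<oplus>\<^bsub>?T\<^esub> t = \<zero>\<^bsub>?T\<^esub>"
      using pair[OF rep(1)[OF *]] rep(2)[OF *] by simp
  next
    show "\<zero>\<^bsub>?T\<^esub> \<in> carrier ?T" using cl[of "[]"] zero by simp
  qed
qed

lemma pure_closed: "\<lbrakk>a \<in> carrier A; b \<in> carrier B\<rbrakk> \<Longrightarrow> pure K A B a b \<in> carrier (tensor K A B)"
  by (simp add: pure_def tclass_closed)

lemma tclass_pair_sum:
  assumes "set xs \<subseteq> carrier A \<times> carrier B"
  shows "tclass K A B xs = pair_sum (tensor K A B) (pure K A B) xs"
  using assms
proof (induction xs)
  case Nil
  then show ?case by (simp add: tensor_def)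
next
  case (Cons p xs)
  then show ?case
    using tclass_add[of "[p]" A B xs K] by (cases p) (simp add: pure_def)
qed

text \<open>The scalars act on the left tensor factor.  Distributivity over a sum of scalars is the only law
  that does not hold entry by entry: it reorders the list, hence the induction for \<open>distr\<close>.\<close>

lemma tensor_module:
  assumes "module K A" "module K B"
  shows "module K (tensor K A B)"
proof -
  interpret A: module K A by fact
  interpret B: module K B by fact
  let ?T = "tensor K A B" and ?c = "tclass K A B"
  interpret T: abelian_group ?T by (rule tensor_abelian_group[OF assms])
  let ?m = "\<lambda>c. map (\<lambda>(a, b). (c \<odot>\<^bsub>A\<^esub> a, b))"
  note cl = tclass_closed[of _ A B K] and add = tclass_add[of _ A B _ K]
  note rep = tensor_carrier[OF assms]
  have m: "set (?m c xs) \<subseteq> carrier A \<times> carrier B"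
    if "c \<in> carrier K" "set xs \<subseteq> carrier A \<times> carrier B" for c xs
    using that by auto
  have sm: "c \<odot>\<^bsub>?T\<^esub> ?c xs = ?c (?m c xs)"
    if "c \<in> carrier K" "set xs \<subseteq> carrier A \<times> carrier B" for c xs
    by (rule tclass_smult[OF assms that])
  have distr: "?c (?m (c \<oplus>\<^bsub>K\<^esub> d) xs) = ?c (?m c xs) \<oplus>\<^bsub>?T\<^esub> ?c (?m d xs)"
    if cd: "c \<in> carrier K" "d \<in> carrier K" and xs: "set xs \<subseteq> carrier A \<times> carrier B" for c d xs
    using xs
  proof (induction xs)
    case Nil
    then show ?case by (simp add: add)
  next
    case (Cons p xs)
    obtain a b where p: "p = (a, b)" "a \<in> carrier A" "b \<in> carrier B" using Cons.prems by auto
    have xs: "set xs \<subseteq> carrier A \<times> carrier B" using Cons.prems by simp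
    have split: "?c (?m e (p # xs)) = ?c [(e \<odot>\<^bsub>A\<^esub> a, b)] \<oplus>\<^bsub>?T\<^esub> ?c (?m e xs)" if "e \<in> carrier K" for e
      using add[of "[(e \<odot>\<^bsub>A\<^esub> a, b)]" "?m e xs", OF _ m[OF that xs]] p that by simp
    have one: "?c [((c \<oplus>\<^bsub>K\<^esub> d) \<odot>\<^bsub>A\<^esub> a, b)] = ?c [(c \<odot>\<^bsub>A\<^esub> a, b)] \<oplus>\<^bsub>?T\<^esub> ?c [(d \<odot>\<^bsub>A\<^esub> a, b)]"
      using tclass_eq[OF tensor_eq.add_left[of "c \<odot>\<^bsub>A\<^esub> a" A "d \<odot>\<^bsub>A\<^esub> a" b B K]] p cd
      by (simp add: add A.smult_l_distr)
    have cls: "?c [(e \<odot>\<^bsub>A\<^esub> a, b)] \<in> carrier ?T" "?c (?m e xs) \<in> carrier ?T" if "e \<in> carrier K" for e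
      using p that cl[OF m[OF that xs]] by (simp_all add: cl)
    show ?case
      using cd Cons.IH[OF xs] cls[OF cd(1)] cls[OF cd(2)]
      by (subst (1 2 3) split) (simp_all add: one T.a_ac)
  qed
  show ?thesis
  proof (intro module.intro module_axioms.intro A.is_cring T.abelian_group_axioms)
    fix c t assume *: "c \<in> carrier K" "t \<in> carrier ?T"
    have "c \<odot>\<^bsub>?T\<^esub> ?c (trep t) \<in> carrier ?T"
      unfolding sm[OF *(1) rep(1)[OF *(2)]] by (rule cl[OF m[OF *(1) rep(1)[OF *(2)]]])
    then show "c \<odot>\<^bsub>?T\<^esub> t \<in> carrier ?T" using rep(2)[OF *(2)] by simp
  next
    fix c d t assume *: "c \<in> carrier K" "d \<in> carrier K" "t \<in> carrier ?T"
    note v = rep(1)[OF *(3)] and r = rep(2)[OF *(3)]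
    have "(c \<oplus>\<^bsub>K\<^esub> d) \<odot>\<^bsub>?T\<^esub> ?c (trep t) = c \<odot>\<^bsub>?T\<^esub> ?c (trep t) \<oplus>\<^bsub>?T\<^esub> d \<odot>\<^bsub>?T\<^esub> ?c (trep t)"
      using *(1,2) v by (simp add: sm distr)
    then show "(c \<oplus>\<^bsub>K\<^esub> d) \<odot>\<^bsub>?T\<^esub> t = c \<odot>\<^bsub>?T\<^esub> t \<oplus>\<^bsub>?T\<^esub> d \<odot>\<^bsub>?T\<^esub> t" by (simp add: r)
    have "?m (c \<otimes>\<^bsub>K\<^esub> d) (trep t) = ?m c (?m d (trep t))"
      using *(1,2) v by (auto simp: A.smult_assoc1)
    then have "(c \<otimes>\<^bsub>K\<^esub> d) \<odot>\<^bsub>?T\<^esub> ?c (trep t) = c \<odot>\<^bsub>?T\<^esub> (d \<odot>\<^bsub>?T\<^esub> ?c (trep t))"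
      using *(1,2) by (simp only: sm[OF _ v] sm[OF _ m[OF _ v]] A.R.m_closed)
    then show "(c \<otimes>\<^bsub>K\<^esub> d) \<odot>\<^bsub>?T\<^esub> t = c \<odot>\<^bsub>?T\<^esub> (d \<odot>\<^bsub>?T\<^esub> t)" by (simp add: r)
  next
    fix c s t assume *: "c \<in> carrier K" "s \<in> carrier ?T" "t \<in> carrier ?T"
    note v = rep(1)[OF *(2)] rep(1)[OF *(3)] and r = rep(2)[OF *(2)] rep(2)[OF *(3)]
    have "c \<odot>\<^bsub>?T\<^esub> (?c (trep s) \<oplus>\<^bsub>?T\<^esub> ?c (trep t)) = c \<odot>\<^bsub>?T\<^esub> ?c (trep s) \<oplus>\<^bsub>?T\<^esub> c \<odot>\<^bsub>?T\<^esub> ?c (trep t)"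
      using *(1) v m[OF *(1) v(1)] m[OF *(1) v(2)] by (simp add: sm add)
    then show "c \<odot>\<^bsub>?T\<^esub> (s \<oplus>\<^bsub>?T\<^esub> t) = c \<odot>\<^bsub>?T\<^esub> s \<oplus>\<^bsub>?T\<^esub> c \<odot>\<^bsub>?T\<^esub> t" by (simp add: r)
  next
    fix t assume *: "t \<in> carrier ?T"
    have "?m \<one>\<^bsub>K\<^esub> (trep t) = trep t"
      using rep(1)[OF *] by (induction "trep t") (auto intro!: map_idI)
    then have "\<one>\<^bsub>K\<^esub> \<odot>\<^bsub>?T\<^esub> ?c (trep t) = ?c (trep t)" using rep(1)[OF *] by (simp add: sm)
    then show "\<one>\<^bsub>K\<^esub> \<odot>\<^bsub>?T\<^esub> t = t" by (simp add: rep(2)[OF *])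
  qed
qed

lemma pure_bilinear:
  assumes "module K A" "module K B"
  shows "bilinear K A B (tensor K A B) (pure K A B)"
proof -
  interpret A: module K A by fact
  interpret B: module K B by fact
  let ?c = "tclass K A B"
  have bal: "?c [(c \<odot>\<^bsub>A\<^esub> a, b)] = ?c [(a, c \<odot>\<^bsub>B\<^esub> b)]"
    if "c \<in> carrier K" "a \<in> carrier A" "b \<in> carrier B" for a b c
    by (rule tclass_eq[OF tensor_eq.balanced]) fact+
  show ?thesis
  proof (intro bilinearI klinearI)
    fix a b c assume *: "c \<in> carrier K" "a \<in> carrier A" "b \<in> carrier B"
    show "pure K A B (c \<odot>\<^bsub>A\<^esub> a) b = c \<odot>\<^bsub>tensor K A B\<^esub> pure K A B a b"
      unfolding pure_def using * by (simp add: tclass_smult[OF assms])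
    show "pure K A B a (c \<odot>\<^bsub>B\<^esub> b) = c \<odot>\<^bsub>tensor K A B\<^esub> pure K A B a b"
      unfolding pure_def using * by (simp add: tclass_smult[OF assms] bal)
  next
    fix a a' b assume *: "a \<in> carrier A" "a' \<in> carrier A" "b \<in> carrier B"
    show "pure K A B (a \<oplus>\<^bsub>A\<^esub> a') b = pure K A B a b \<oplus>\<^bsub>tensor K A B\<^esub> pure K A B a' b"
      unfolding pure_def using * by (simp add: tclass_add tclass_eq[OF tensor_eq.add_left])
  next
    fix a b b' assume *: "a \<in> carrier A" "b \<in> carrier B" "b' \<in> carrier B"
    show "pure K A B a (b \<oplus>\<^bsub>B\<^esub> b') = pure K A B a b \<oplus>\<^bsub>tensor K A B\<^esub> pure K A B a b'"
      unfolding pure_def using * by (simp add: tclass_add tclass_eq[OF tensor_eq.add_right])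
  qed (simp_all add: pure_closed)
qed

section \<open>Linear maps out of a tensor product\<close>

lemma module_abelian_monoid: "module K M \<Longrightarrow> abelian_monoid M"
  by (simp add: module_def abelian_group_def)

lemma tlift_closed:
  assumes "module K A" "module K B" "module K M" "t \<in> carrier (tensor K A B)"
    and "\<And>a b. \<lbrakk>a \<in> carrier A; b \<in> carrier B\<rbrakk> \<Longrightarrow> f a b \<in> carrier M"
  shows "tlift M f t \<in> carrier M"
  unfolding tlift_pair_sum
  by (rule pair_sum_closed[OF module_abelian_monoid[OF assms(3)]])
    (use tensor_carrier(1)[OF assms(1,2,4)] assms(5) in auto)

lemma tlift_cong:
  assumes "module K A" "module K B" "t \<in> carrier (tensor K A B)"
    and "\<And>a b. \<lbrakk>a \<in> carrier A; b \<in> carrier B\<rbrakk> \<Longrightarrow> f a b = g a b"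
  shows "tlift M f t = tlift M g t"
  unfolding tlift_pair_sum
  by (rule pair_sum_cong) (use tensor_carrier(1)[OF assms(1-3)] assms(4) in auto)

lemma klinear_tlift:
  assumes "module K A" "module K B" "module K V" "module K M" "t \<in> carrier (tensor K A B)"
    and "\<phi> \<in> klinear K V M"
    and "\<And>a b. \<lbrakk>a \<in> carrier A; b \<in> carrier B\<rbrakk> \<Longrightarrow> g a b \<in> carrier V"
  shows "\<phi> (tlift V g t) = tlift M (\<lambda>a b. \<phi> (g a b)) t"
  unfolding tlift_pair_sum
  by (rule klinear_pair_sum[OF assms(3,4,6)]) (use tensor_carrier(1)[OF assms(1,2,5)] assms(7) in auto)

text \<open>Every tensor is the sum of its pure parts, so a linear map is determined by its values on pure
  tensors; with \<open>klinear_tlift\<close> this replaces arguments by spanning sets.\<close>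

lemma tlift_pure_id:
  assumes "module K A" "module K B" "t \<in> carrier (tensor K A B)"
  shows "tlift (tensor K A B) (pure K A B) t = t"
  unfolding tlift_pair_sum tclass_pair_sum[OF tensor_carrier(1)[OF assms], symmetric]
  by (rule tensor_carrier(2)[OF assms])

lemma tlift_tclass:
  assumes "module K A" "module K B" "module K M" "bilinear K A B M f"
    and "set xs \<subseteq> carrier A \<times> carrier B"
  shows "tlift M f (tclass K A B xs) = pair_sum M f xs"
  unfolding tlift_pair_sum
  by (rule tensor_eq_pair_sum[OF assms(1-4), symmetric]) (rule trep_tclass[OF assms(5)])

lemma tlift_pure:
  assumes "module K A" "module K B" "module K M" "bilinear K A B M f"
    and "a \<in> carrier A" "b \<in> carrier B"
  shows "tlift M f (pure K A B a b) = f a b"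
proof -
  interpret M: module K M by fact
  show ?thesis
    using tlift_tclass[OF assms(1-4), of "[(a, b)]"] assms(5,6) bilinear_closed[OF assms(4-6)]
    by (simp add: pure_def)
qed

lemma tlift_linear:
  assumes "module K A" "module K B" "module K M" "bilinear K A B M f"
  shows "tlift M f \<in> klinear K (tensor K A B) M"
proof (rule klinearI)
  interpret A: module K A by fact
  interpret M: module K M by fact
  note cl = bilinear_closed[OF assms(4)]
  note rep = tensor_carrier[OF assms(1,2)] and lift = tlift_tclass[OF assms]
  fix s t assume *: "s \<in> carrier (tensor K A B)" "t \<in> carrier (tensor K A B)"
  show "tlift M f s \<in> carrier M" by (rule tlift_closed[OF assms(1-3) *(1) cl])
  have "tlift M f (tclass K A B (trep s) \<oplus>\<^bsub>tensor K A B\<^esub> tclass K A B (trep t))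
      = tlift M f (tclass K A B (trep s)) \<oplus>\<^bsub>M\<^esub> tlift M f (tclass K A B (trep t))"
    using rep(1)[OF *(1)] rep(1)[OF *(2)]
    by (simp add: tclass_add lift) (rule pair_sum_append[OF M.abelian_monoid_axioms], use cl in auto)
  then show "tlift M f (s \<oplus>\<^bsub>tensor K A B\<^esub> t) = tlift M f s \<oplus>\<^bsub>M\<^esub> tlift M f t"
    using * rep(2) by simp
next
  interpret A: module K A by fact
  interpret M: module K M by fact
  note cl = bilinear_closed[OF assms(4)]
  note rep = tensor_carrier[OF assms(1,2)] and lift = tlift_tclass[OF assms]
  fix c t assume *: "c \<in> carrier K" "t \<in> carrier (tensor K A B)"
  have sum: "pair_sum M f (map (\<lambda>(a, b). (c \<odot>\<^bsub>A\<^esub> a, b)) xs) = c \<odot>\<^bsub>M\<^esub> pair_sum M f xs"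
    if "set xs \<subseteq> carrier A \<times> carrier B" for xs
    using that
  proof (induction xs)
    case Nil
    then show ?case using * by simp
  next
    case (Cons p xs)
    obtain a b where p: "p = (a, b)" "a \<in> carrier A" "b \<in> carrier B" using Cons.prems by auto
    have "f (c \<odot>\<^bsub>A\<^esub> a) b = c \<odot>\<^bsub>M\<^esub> f a b"
      using assms(4) * p by (auto simp: bilinear_def intro: klinear_smult)
    moreover have "pair_sum M f xs \<in> carrier M"
      by (rule pair_sum_closed[OF M.abelian_monoid_axioms]) (use Cons.prems cl in auto)
    ultimately show ?case using Cons * p cl by (simp add: M.smult_r_distr)
  qed
  have m: "set (map (\<lambda>(a, b). (c \<odot>\<^bsub>A\<^esub> a, b)) (trep t)) \<subseteq> carrier A \<times> carrier B"
    using rep(1)[OF *(2)] * by auto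
  have "tlift M f (c \<odot>\<^bsub>tensor K A B\<^esub> tclass K A B (trep t)) = c \<odot>\<^bsub>M\<^esub> tlift M f (tclass K A B (trep t))"
    unfolding tclass_smult[OF assms(1,2) *(1) rep(1)[OF *(2)]] lift[OF m] lift[OF rep(1)[OF *(2)]]
    by (rule sum[OF rep(1)[OF *(2)]])
  then show "tlift M f (c \<odot>\<^bsub>tensor K A B\<^esub> t) = c \<odot>\<^bsub>M\<^esub> tlift M f t"
    using * rep(2) by simp
qed

lemma tlift_swap:
  assumes "module K A" "module K B" "module K C" "module K D" "module K M"
    and "s \<in> carrier (tensor K A B)" "t \<in> carrier (tensor K C D)"
    and "\<And>a b c d. \<lbrakk>a \<in> carrier A; b \<in> carrier B; c \<in> carrier C; d \<in> carrier D\<rbrakk> \<Longrightarrow>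
      f a b c d \<in> carrier M"
  shows "tlift M (\<lambda>a b. tlift M (\<lambda>c d. f a b c d) t) s = tlift M (\<lambda>c d. tlift M (\<lambda>a b. f a b c d) s) t"
  unfolding tlift_pair_sum
  by (rule pair_sum_swap[OF module_abelian_monoid[OF assms(5)]])
    (use tensor_carrier(1)[OF assms(1,2,6)] tensor_carrier(1)[OF assms(3,4,7)] assms(8) in blast)

text \<open>A Sweedler sum can depend on a variable through the summand or through the tensor that is split.
  This rule and \<open>klinear_tlift_arg\<close> cover the two cases.\<close>

lemma klinear_tlift_param:
  assumes "module K A" "module K B" "module K M" "t \<in> carrier (tensor K A B)"
    and "\<And>a b. \<lbrakk>a \<in> carrier A; b \<in> carrier B\<rbrakk> \<Longrightarrow> (\<lambda>v. f v a b) \<in> klinear K V M"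
  shows "(\<lambda>v. tlift M (f v) t) \<in> klinear K V M"
proof -
  interpret M: module K M by fact
  note am = M.abelian_monoid_axioms
  have "(\<lambda>v. pair_sum M (f v) xs) \<in> klinear K V M" if "set xs \<subseteq> carrier A \<times> carrier B" for xs
    using that
  proof (induction xs)
    case Nil
    then show ?case by (auto simp: klinear_def)
  next
    case (Cons p xs)
    obtain a b where p: "p = (a, b)" "a \<in> carrier A" "b \<in> carrier B" using Cons.prems by auto
    have "(\<lambda>v. pair_sum M (f v) xs) \<in> klinear K V M" using Cons by simp
    with assms(5)[OF p(2,3)] show ?case
      unfolding p by (auto simp: klinear_def Pi_iff M.add.m_ac M.smult_r_distr)
  qed
  then show ?thesis unfolding tlift_pair_sum using tensor_carrier(1)[OF assms(1,2,4)] by blast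
qed

lemma klinear_tlift_arg:
  assumes "module K A" "module K B" "module K M" "bilinear K A B M f"
    and "\<phi> \<in> klinear K V (tensor K A B)"
  shows "(\<lambda>v. tlift M f (\<phi> v)) \<in> klinear K V M"
  by (rule klinear_compose[OF tlift_linear[OF assms(1-4)] assms(5)])

text \<open>Coassociativity in the form in which Sweedler notation uses it: the two ways of splitting
  an element into three factors agree under every trilinear map.  With \<open>X = L\<close> and
  \<open>\<alpha> = \<delta>\<close> this covers comultiplications as well.\<close>

lemma coaction_trilinear:
  assumes X: "module K X" and L: "module K L" and M: "module K M"
    and \<alpha>: "\<alpha> \<in> klinear K X (tensor K X L)" and \<delta>: "\<delta> \<in> klinear K L (tensor K L L)"
    and t: "t \<in> carrier (tensor K X L)"
    and eq: "tassoc K X L L (tmap K (tensor K X L) L \<alpha> (\<lambda>l. l) t) = tmap K X (tensor K L L) (\<lambda>x. x) \<delta> t"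
    and f1: "\<And>k l. \<lbrakk>k \<in> carrier L; l \<in> carrier L\<rbrakk> \<Longrightarrow> (\<lambda>y. f y k l) \<in> klinear K X M"
    and f2: "\<And>y l. \<lbrakk>y \<in> carrier X; l \<in> carrier L\<rbrakk> \<Longrightarrow> (\<lambda>k. f y k l) \<in> klinear K L M"
    and f3: "\<And>y k. \<lbrakk>y \<in> carrier X; k \<in> carrier L\<rbrakk> \<Longrightarrow> (\<lambda>l. f y k l) \<in> klinear K L M"
  shows "tlift M (\<lambda>u l. tlift M (\<lambda>y k. f y k l) (\<alpha> u)) t = tlift M (\<lambda>y l. tlift M (\<lambda>k l'. f y k l') (\<delta> l)) t"
proof -
  let ?LL = "tensor K L L" and ?XL = "tensor K X L"
  let ?T = "tensor K X ?LL"
  note LL = tensor_module[OF L L] and XL = tensor_module[OF X L]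
  note T = tensor_module[OF X LL]
  \<comment> \<open>The linear map induced by \<open>f\<close> on \<open>X \<otimes> (L \<otimes> L)\<close>, where the
    coaction axiom lives, is lifted from \<open>F\<close>.\<close>
  define F where "F = (\<lambda>y s. tlift M (f y) s)"
  have F: "bilinear K X ?LL M F"
    unfolding F_def
    by (intro bilinearI klinear_tlift_param[OF L L M] tlift_linear[OF L L M] f1 f2 f3) assumption+
  have inner: "bilinear K X L ?T (\<lambda>a b. pure K X ?LL a (pure K L L b c))" if "c \<in> carrier L" for c
    by (intro bilinearI bilinear_right[OF pure_bilinear[OF X LL]] bilinear_left[OF pure_bilinear[OF X LL]]
      bilinear_left[OF pure_bilinear[OF L L]] klinear_ident pure_closed that) assumption+
  have outer: "bilinear K ?XL L ?T (\<lambda>u c. tlift ?T (\<lambda>a b. pure K X ?LL a (pure K L L b c)) u)"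
    by (intro bilinearI tlift_linear[OF X L T] klinear_tlift_param[OF X L T] inner
      bilinear_right[OF pure_bilinear[OF X LL]] bilinear_right[OF pure_bilinear[OF L L]] klinear_ident)
      assumption+
  have \<alpha>c: "\<alpha> x \<in> carrier ?XL" if "x \<in> carrier X" for x using klinear_closed[OF \<alpha> that] .
  have \<delta>c: "\<delta> l \<in> carrier ?LL" if "l \<in> carrier L" for l using klinear_closed[OF \<delta> that] .
  have FT: "tlift M F (tlift ?T g s) = tlift M (\<lambda>a b. tlift M F (g a b)) s"
    if "s \<in> carrier ?XL" "\<And>a b. \<lbrakk>a \<in> carrier X; b \<in> carrier L\<rbrakk> \<Longrightarrow> g a b \<in> carrier ?T" for g s
    by (rule klinear_tlift[OF X L T M that(1) tlift_linear[OF X LL M F] that(2)])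
  have "tassoc K X L L (tmap K ?XL L \<alpha> (\<lambda>l. l) t)
      = tlift ?T (\<lambda>u l. tlift ?T (\<lambda>u c. tlift ?T (\<lambda>a b. pure K X ?LL a (pure K L L b c)) u) (pure K ?XL L (\<alpha> u) l)) t"
    unfolding tassoc_def tmap_def Let_def
    by (rule klinear_tlift[OF X L tensor_module[OF XL L] T t tlift_linear[OF XL L T outer]])
      (intro pure_closed \<alpha>c)
  also have "\<dots> = tlift ?T (\<lambda>u l. tlift ?T (\<lambda>a b. pure K X ?LL a (pure K L L b l)) (\<alpha> u)) t"
    by (rule tlift_cong[OF X L t]) (rule tlift_pure[OF XL L T outer \<alpha>c])
  finally have lhs: "tassoc K X L L (tmap K ?XL L \<alpha> (\<lambda>l. l) t) = \<dots>" .
  have "tlift M (\<lambda>u l. tlift M (\<lambda>y k. f y k l) (\<alpha> u)) t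
      = tlift M (\<lambda>u l. tlift M (\<lambda>a b. tlift M F (pure K X ?LL a (pure K L L b l))) (\<alpha> u)) t"
  proof (intro tlift_cong[OF X L t] tlift_cong[OF X L \<alpha>c])
    fix u l y k assume *: "l \<in> carrier L" "y \<in> carrier X" "k \<in> carrier L"
    have "tlift M F (pure K X ?LL y (pure K L L k l)) = F y (pure K L L k l)"
      by (rule tlift_pure[OF X LL M F]) (use * in \<open>auto intro: pure_closed\<close>)
    also have "\<dots> = f y k l"
      unfolding F_def by (rule tlift_pure[OF L L M]) (use * in \<open>auto intro: bilinearI f2 f3\<close>)
    finally show "f y k l = tlift M F (pure K X ?LL y (pure K L L k l))" by simp
  qed
  also have "\<dots> = tlift M (\<lambda>u l. tlift M F (tlift ?T (\<lambda>a b. pure K X ?LL a (pure K L L b l)) (\<alpha> u))) t"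
    by (intro tlift_cong[OF X L t] FT[symmetric] \<alpha>c pure_closed) assumption+
  also have "\<dots> = tlift M F (tassoc K X L L (tmap K ?XL L \<alpha> (\<lambda>l. l) t))"
    unfolding lhs
    by (intro FT[OF t, symmetric] tlift_closed[OF X L T] \<alpha>c pure_closed) assumption+
  also have "\<dots> = tlift M F (tlift ?T (\<lambda>a b. pure K X ?LL a (\<delta> b)) t)"
    by (simp only: eq) (simp only: tmap_def)
  also have "\<dots> = tlift M (\<lambda>a b. tlift M F (pure K X ?LL a (\<delta> b))) t"
    by (intro FT[OF t] pure_closed \<delta>c) assumption+
  also have "\<dots> = tlift M (\<lambda>y l. F y (\<delta> l)) t"
    by (intro tlift_cong[OF X L t] tlift_pure[OF X LL M F] \<delta>c) assumption+
  finally show ?thesis unfolding F_def .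
qed

section \<open>The multiplication of a tensor product of algebras\<close>

lemma pair_sum_concat:
  assumes "abelian_monoid M"
    and "\<And>a b c d. \<lbrakk>(a, b) \<in> set xs; (c, d) \<in> set ys\<rbrakk> \<Longrightarrow> f (g a c) (h b d) \<in> carrier M"
  shows "pair_sum M f (concat (map (\<lambda>(a, b). map (\<lambda>(c, d). (g a c, h b d)) ys) xs))
    = pair_sum M (\<lambda>a b. pair_sum M (\<lambda>c d. f (g a c) (h b d)) ys) xs"
proof -
  have map: "pair_sum M f (map (\<lambda>(c, d). (g a c, h b d)) zs) = pair_sum M (\<lambda>c d. f (g a c) (h b d)) zs"
    for a b zs by (induction zs) auto
  show ?thesis
    using assms(2)
  proof (induction xs)
    case (Cons p xs)
    obtain a b where p: "p = (a, b)" by (cases p)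
    let ?zs = "concat (map (\<lambda>(a, b). map (\<lambda>(c, d). (g a c, h b d)) ys) xs)"
    have "pair_sum M f (map (\<lambda>(c, d). (g a c, h b d)) ys @ ?zs)
        = pair_sum M (\<lambda>c d. f (g a c) (h b d)) ys \<oplus>\<^bsub>M\<^esub> pair_sum M f ?zs"
      by (subst pair_sum_append[OF assms(1)]) (use Cons.prems p in \<open>auto simp: map\<close>)
    moreover have "pair_sum M f ?zs = pair_sum M (\<lambda>a b. pair_sum M (\<lambda>c d. f (g a c) (h b d)) ys) xs"
      by (rule Cons.IH) (use Cons.prems in auto)
    ultimately show ?case by (simp add: p)
  qed simp
qed

lemma tensor_mult:
  assumes A: "module K A" and B: "module K B"
    and mA: "bilinear K A A A (mult A)" and mB: "bilinear K B B B (mult B)"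
    and s: "s \<in> carrier (tensor K A B)" and t: "t \<in> carrier (tensor K A B)"
  shows "s \<otimes>\<^bsub>tensor K A B\<^esub> t = tlift (tensor K A B)
      (\<lambda>a b. tlift (tensor K A B) (\<lambda>a' b'. pure K A B (a \<otimes>\<^bsub>A\<^esub> a') (b \<otimes>\<^bsub>B\<^esub> b')) t) s"
proof -
  let ?L = "concat (map (\<lambda>(a, b). map (\<lambda>(a', b'). (a \<otimes>\<^bsub>A\<^esub> a', b \<otimes>\<^bsub>B\<^esub> b')) (trep t)) (trep s))"
  note rep = tensor_carrier(1)[OF A B s] tensor_carrier(1)[OF A B t]
  have L: "set ?L \<subseteq> carrier A \<times> carrier B"
    using rep bilinear_closed[OF mA] bilinear_closed[OF mB] by fastforce
  have "s \<otimes>\<^bsub>tensor K A B\<^esub> t = tclass K A B ?L" by (simp add: tensor_def)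
  also have "\<dots> = pair_sum (tensor K A B) (pure K A B) ?L" by (rule tclass_pair_sum[OF L])
  also have "\<dots> = pair_sum (tensor K A B) (\<lambda>a b. pair_sum (tensor K A B)
      (\<lambda>a' b'. pure K A B (a \<otimes>\<^bsub>A\<^esub> a') (b \<otimes>\<^bsub>B\<^esub> b')) (trep t)) (trep s)"
    by (rule pair_sum_concat[OF module_abelian_monoid[OF tensor_module[OF A B]]])
      (use rep in \<open>auto intro!: pure_closed bilinear_closed[OF mA] bilinear_closed[OF mB]\<close>)
  finally show ?thesis unfolding tlift_pair_sum .
qed

text \<open>Stated for any two bilinear products, so that the second factor can be the Heisenberg algebra.\<close>

lemma tensor_mult_bilinear:
  assumes A: "module K A" and B: "module K B"
    and mA: "bilinear K A A A (mult A)" and mB: "bilinear K B B B (mult B)"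
  shows "bilinear K (tensor K A B) (tensor K A B) (tensor K A B) (mult (tensor K A B))"
proof -
  let ?T = "tensor K A B"
  note T = tensor_module[OF A B] and P = pure_bilinear[OF A B]
  note cA = bilinear_closed[OF mA] and cB = bilinear_closed[OF mB]
  show ?thesis
    by (rule bilinearI; rule klinear_cong[OF T _ tensor_mult[OF A B mA mB]])
      (intro klinear_tlift_param[OF A B T] tlift_linear[OF A B T] bilinearI
         bilinear_left[OF P] bilinear_right[OF P] bilinear_left[OF mA] bilinear_right[OF mA]
         bilinear_left[OF mB] bilinear_right[OF mB] klinear_ident cA cB | assumption)+
qed

lemma tensor_mult_pure:
  assumes A: "module K A" and B: "module K B"
    and mA: "bilinear K A A A (mult A)" and mB: "bilinear K B B B (mult B)"
    and "a \<in> carrier A" "b \<in> carrier B" "a' \<in> carrier A" "b' \<in> carrier B"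
  shows "pure K A B a b \<otimes>\<^bsub>tensor K A B\<^esub> pure K A B a' b' = pure K A B (a \<otimes>\<^bsub>A\<^esub> a') (b \<otimes>\<^bsub>B\<^esub> b')"
proof -
  let ?T = "tensor K A B"
  note T = tensor_module[OF A B] and P = pure_bilinear[OF A B]
  note cA = bilinear_closed[OF mA] and cB = bilinear_closed[OF mB]
  note pc = pure_closed[OF assms(5,6)] pure_closed[OF assms(7,8)]
  let ?f = "\<lambda>a b. tlift ?T (\<lambda>a' b'. pure K A B (a \<otimes>\<^bsub>A\<^esub> a') (b \<otimes>\<^bsub>B\<^esub> b')) (pure K A B a' b')"
  have f: "bilinear K A B ?T (\<lambda>x y. pure K A B (a \<otimes>\<^bsub>A\<^esub> x) (b \<otimes>\<^bsub>B\<^esub> y))"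
    by (intro bilinearI bilinear_left[OF P] bilinear_right[OF P] bilinear_right[OF mA] 
        bilinear_right[OF mB] klinear_ident cA cB assms) assumption+
  have g: "bilinear K A B ?T ?f"
    by (intro bilinearI klinear_tlift_param[OF A B T] bilinear_left[OF P] bilinear_right[OF P]
        bilinear_left[OF mA] bilinear_left[OF mB] klinear_ident cA cB pure_closed assms) assumption+
  have "pure K A B a b \<otimes>\<^bsub>?T\<^esub> pure K A B a' b' = ?f a b"
    unfolding tensor_mult[OF A B mA mB pure_closed[OF assms(5,6)] pure_closed[OF assms(7,8)]]
    by (rule tlift_pure[OF A B T g assms(5,6)])
  also have "\<dots> = pure K A B (a \<otimes>\<^bsub>A\<^esub> a') (b \<otimes>\<^bsub>B\<^esub> b')"
    by (rule tlift_pure[OF A B T f assms(7,8)])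
  finally show ?thesis .
qed

lemma tmap_linear:
  assumes "module K A" "module K B" "module K A'" "module K B'"
    and "\<phi> \<in> klinear K A A'" "\<psi> \<in> klinear K B B'"
  shows "tmap K A' B' \<phi> \<psi> \<in> klinear K (tensor K A B) (tensor K A' B')"
  unfolding tmap_def
  by (intro tlift_linear[OF assms(1,2) tensor_module[OF assms(3,4)]] bilinearI
      bilinear_left[OF pure_bilinear[OF assms(3,4)]] bilinear_right[OF pure_bilinear[OF assms(3,4)]]
      klinear_closed[OF assms(5)] klinear_closed[OF assms(6)] assms(5,6))

lemma tlift_tmap:
  assumes "module K A" "module K B" and A': "module K A'" and B': "module K B'" and M: "module K M"
    and \<phi>: "\<phi> \<in> klinear K A A'" and \<psi>: "\<psi> \<in> klinear K B B'"
    and f: "bilinear K A' B' M f" and t: "t \<in> carrier (tensor K A B)"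
  shows "tlift M f (tmap K A' B' \<phi> \<psi> t) = tlift M (\<lambda>a b. f (\<phi> a) (\<psi> b)) t"
proof -
  have "tlift M f (tmap K A' B' \<phi> \<psi> t) = tlift M (\<lambda>a b. tlift M f (pure K A' B' (\<phi> a) (\<psi> b))) t"
    unfolding tmap_def
    by (intro klinear_tlift[OF assms(1,2) tensor_module[OF A' B'] M t tlift_linear[OF A' B' M f]]
        pure_closed klinear_closed[OF \<phi>] klinear_closed[OF \<psi>])
  also have "\<dots> = tlift M (\<lambda>a b. f (\<phi> a) (\<psi> b)) t"
    by (intro tlift_cong[OF assms(1,2) t] tlift_pure[OF A' B' M f] klinear_closed[OF \<phi>] klinear_closed[OF \<psi>])
  finally show ?thesis .
qed

lemma mult_map_tmap:
  assumes P: "module K P" and Q: "module K Q" and Z: "module K Z" and mult: "bilinear K Z Z Z (mult Z)"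
    and f: "f \<in> klinear K P Z" and g: "g \<in> klinear K Q Z"
    and s: "s \<in> carrier P" and t: "t \<in> carrier Q"
  shows "mult_map Z (tmap K Z Z f g (pure K P Q s t)) = f s \<otimes>\<^bsub>Z\<^esub> g t"
proof -
  have "tlift Z (mult Z) (tmap K Z Z f g (pure K P Q s t)) = tlift Z (\<lambda>a b. f a \<otimes>\<^bsub>Z\<^esub> g b) (pure K P Q s t)"
    by (rule tlift_tmap[OF P Q Z Z Z f g mult pure_closed[OF s t]])
  also have "\<dots> = f s \<otimes>\<^bsub>Z\<^esub> g t"
    by (intro tlift_pure[OF P Q Z _ s t] bilinearI bilinear_left[OF mult] bilinear_right[OF mult] f g
        klinear_closed[OF f] klinear_closed[OF g])
  finally show ?thesis by (simp add: mult_map_def)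
qed

lemma mult_tlift:
  assumes A: "module K A" and B: "module K B" and C: "module K C" and D: "module K D" and Z: "module K Z"
    and mult: "bilinear K Z Z Z (mult Z)"
    and s: "s \<in> carrier (tensor K A B)" and t: "t \<in> carrier (tensor K C D)"
    and F: "\<And>a b. \<lbrakk>a \<in> carrier A; b \<in> carrier B\<rbrakk> \<Longrightarrow> F a b \<in> carrier Z"
    and G: "\<And>c d. \<lbrakk>c \<in> carrier C; d \<in> carrier D\<rbrakk> \<Longrightarrow> G c d \<in> carrier Z"
  shows "tlift Z F s \<otimes>\<^bsub>Z\<^esub> tlift Z G t = tlift Z (\<lambda>a b. tlift Z (\<lambda>c d. F a b \<otimes>\<^bsub>Z\<^esub> G c d) t) s"
proof -
  have "tlift Z F s \<otimes>\<^bsub>Z\<^esub> tlift Z G t = tlift Z (\<lambda>a b. F a b \<otimes>\<^bsub>Z\<^esub> tlift Z G t) s"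
    by (intro klinear_tlift[OF A B Z Z s] bilinear_left[OF mult] klinear_ident tlift_closed[OF C D Z t] F G)
  also have "\<dots> = tlift Z (\<lambda>a b. tlift Z (\<lambda>c d. F a b \<otimes>\<^bsub>Z\<^esub> G c d) t) s"
    by (intro tlift_cong[OF A B s] klinear_tlift[OF C D Z Z t] bilinear_right[OF mult] klinear_ident F G)
  finally show ?thesis .
qed

section \<open>Sweedler calculus in a Hopf algebra\<close>

lemma kalgebra_mult_bilinear:
  assumes "kalgebra K A" shows "bilinear K A A A (mult A)"
proof -
  interpret kalgebra K A by fact
  show ?thesis
    by (intro bilinearI klinearI)
      (simp_all add: A.l_distr A.r_distr smult_mult_left smult_mult_right)
qed

context hopf_algebra
begin

lemma module_H: "module K H" by (rule module_axioms)

lemma comult_linear: "comult H \<in> klinear K H (tensor K H H)"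
  using comult_hom by (simp add: kalg_hom_def)

lemma counit_linear: "counit H \<in> klinear K H (self_alg K)"
  using counit_hom by (simp add: kalg_hom_def)

lemmas mult_bilinear = kalgebra_mult_bilinear[OF kalgebra_axioms]

lemma comult_closed: "h \<in> carrier H \<Longrightarrow> comult H h \<in> carrier (tensor K H H)"
  by (rule klinear_closed[OF comult_linear])

lemma antipode_closed: "h \<in> carrier H \<Longrightarrow> antipode H h \<in> carrier H"
  by (rule klinear_closed[OF antipode_linear])

lemma counit_closed: "h \<in> carrier H \<Longrightarrow> counit H h \<in> carrier K"
  using klinear_closed[OF counit_linear] by simp

lemma comult_trilinear:
  assumes M: "module K M" and h: "h \<in> carrier H"
    and "\<And>k l. \<lbrakk>k \<in> carrier H; l \<in> carrier H\<rbrakk> \<Longrightarrow> (\<lambda>y. f y k l) \<in> klinear K H M"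
    and "\<And>y l. \<lbrakk>y \<in> carrier H; l \<in> carrier H\<rbrakk> \<Longrightarrow> (\<lambda>k. f y k l) \<in> klinear K H M"
    and "\<And>y k. \<lbrakk>y \<in> carrier H; k \<in> carrier H\<rbrakk> \<Longrightarrow> (\<lambda>l. f y k l) \<in> klinear K H M"
  shows "tlift M (\<lambda>u l. tlift M (\<lambda>y k. f y k l) (comult H u)) (comult H h)
    = tlift M (\<lambda>y l. tlift M (\<lambda>k l'. f y k l') (comult H l)) (comult H h)"
  by (rule coaction_trilinear[OF module_H module_H M comult_linear comult_linear comult_closed[OF h]
        coassoc[OF h]]) (fact assms)+

lemma comult_mult:
  assumes M: "module K M" and f: "bilinear K H H M f" and h: "h \<in> carrier H" "k \<in> carrier H"
  shows "tlift M f (comult H (h \<otimes>\<^bsub>H\<^esub> k))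
    = tlift M (\<lambda>a b. tlift M (\<lambda>c d. f (a \<otimes>\<^bsub>H\<^esub> c) (b \<otimes>\<^bsub>H\<^esub> d)) (comult H k)) (comult H h)"
proof -
  let ?T = "tensor K H H"
  note m = module_H and c = comult_closed
  note T = tensor_module[OF m m] and tl = klinear_tlift[OF m m tensor_module[OF m m] M _ tlift_linear[OF m m M f]]
  have "comult H (h \<otimes>\<^bsub>H\<^esub> k) = comult H h \<otimes>\<^bsub>?T\<^esub> comult H k"
    using comult_hom h by (simp add: kalg_hom_def ring_hom_def)
  then have "tlift M f (comult H (h \<otimes>\<^bsub>H\<^esub> k)) = tlift M f (tlift ?T (\<lambda>a b. tlift ?T
      (\<lambda>a' b'. pure K H H (a \<otimes>\<^bsub>H\<^esub> a') (b \<otimes>\<^bsub>H\<^esub> b')) (comult H k)) (comult H h))"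
    by (simp add: tensor_mult[OF m m mult_bilinear mult_bilinear c[OF h(1)] c[OF h(2)]])
  also have "\<dots> = tlift M (\<lambda>a b. tlift M f (tlift ?T
      (\<lambda>a' b'. pure K H H (a \<otimes>\<^bsub>H\<^esub> a') (b \<otimes>\<^bsub>H\<^esub> b')) (comult H k))) (comult H h)"
    by (intro tl c h tlift_closed[OF m m T] pure_closed A.m_closed) assumption+
  also have "\<dots> = tlift M (\<lambda>a b. tlift M (\<lambda>a' b'. tlift M f (pure K H H (a \<otimes>\<^bsub>H\<^esub> a') (b \<otimes>\<^bsub>H\<^esub> b')))
      (comult H k)) (comult H h)"
    by (intro tlift_cong[OF m m] tl c h pure_closed A.m_closed) assumption+
  also have "\<dots> = tlift M (\<lambda>a b. tlift M (\<lambda>c d. f (a \<otimes>\<^bsub>H\<^esub> c) (b \<otimes>\<^bsub>H\<^esub> d)) (comult H k)) (comult H h)"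
    by (intro tlift_cong[OF m m] tlift_pure[OF m m M f] c h A.m_closed) assumption+
  finally show ?thesis .
qed

lemma comult_one:
  assumes M: "module K M" and f: "bilinear K H H M f"
  shows "tlift M f (comult H \<one>\<^bsub>H\<^esub>) = f \<one>\<^bsub>H\<^esub> \<one>\<^bsub>H\<^esub>"
proof -
  have "comult H \<one>\<^bsub>H\<^esub> = pure K H H \<one>\<^bsub>H\<^esub> \<one>\<^bsub>H\<^esub>"
    using comult_hom by (simp add: kalg_hom_def ring_hom_def tensor_def)
  then show ?thesis using tlift_pure[OF module_H module_H M f] by simp
qed

lemma counit_left_linear:
  assumes M: "module K M" and f: "f \<in> klinear K H M" and h: "h \<in> carrier H"
  shows "tlift M (\<lambda>a b. counit H a \<odot>\<^bsub>M\<^esub> f b) (comult H h) = f h"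
proof -
  note m = module_H
  have "f h = f (tlift H (\<lambda>a b. counit H a \<odot>\<^bsub>H\<^esub> b) (comult H h))" by (simp add: counit_left[OF h])
  also have "\<dots> = tlift M (\<lambda>a b. f (counit H a \<odot>\<^bsub>H\<^esub> b)) (comult H h)"
    by (rule klinear_tlift[OF m m m M comult_closed[OF h] f]) (simp add: counit_closed)
  also have "\<dots> = tlift M (\<lambda>a b. counit H a \<odot>\<^bsub>M\<^esub> f b) (comult H h)"
    by (intro tlift_cong[OF m m] comult_closed h klinear_smult[OF f] counit_closed) assumption+
  finally show ?thesis by simp
qed

lemma counit_right_linear:
  assumes M: "module K M" and f: "f \<in> klinear K H M" and h: "h \<in> carrier H"
  shows "tlift M (\<lambda>a b. counit H b \<odot>\<^bsub>M\<^esub> f a) (comult H h) = f h"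
proof -
  note m = module_H
  have "f h = f (tlift H (\<lambda>a b. counit H b \<odot>\<^bsub>H\<^esub> a) (comult H h))" by (simp add: counit_right[OF h])
  also have "\<dots> = tlift M (\<lambda>a b. f (counit H b \<odot>\<^bsub>H\<^esub> a)) (comult H h)"
    by (rule klinear_tlift[OF m m m M comult_closed[OF h] f]) (simp add: counit_closed)
  also have "\<dots> = tlift M (\<lambda>a b. counit H b \<odot>\<^bsub>M\<^esub> f a) (comult H h)"
    by (intro tlift_cong[OF m m] comult_closed h klinear_smult[OF f] counit_closed) assumption+
  finally show ?thesis by simp
qed

lemma antipode_left_linear:
  assumes M: "module K M" and f: "f \<in> klinear K H M" and h: "h \<in> carrier H"
  shows "tlift M (\<lambda>a b. f (antipode H a \<otimes>\<^bsub>H\<^esub> b)) (comult H h) = counit H h \<odot>\<^bsub>M\<^esub> f \<one>\<^bsub>H\<^esub>"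
proof -
  note m = module_H
  have "tlift M (\<lambda>a b. f (antipode H a \<otimes>\<^bsub>H\<^esub> b)) (comult H h)
      = f (tlift H (\<lambda>a b. antipode H a \<otimes>\<^bsub>H\<^esub> b) (comult H h))"
    by (rule klinear_tlift[OF m m m M comult_closed[OF h] f, symmetric]) (simp add: antipode_closed)
  then show ?thesis
    using klinear_smult[OF f counit_closed[OF h] A.one_closed] by (simp add: antipode_left[OF h])
qed

lemma antipode_right_linear:
  assumes M: "module K M" and f: "f \<in> klinear K H M" and h: "h \<in> carrier H"
  shows "tlift M (\<lambda>a b. f (a \<otimes>\<^bsub>H\<^esub> antipode H b)) (comult H h) = counit H h \<odot>\<^bsub>M\<^esub> f \<one>\<^bsub>H\<^esub>"
proof -
  note m = module_H
  have "tlift M (\<lambda>a b. f (a \<otimes>\<^bsub>H\<^esub> antipode H b)) (comult H h)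
      = f (tlift H (\<lambda>a b. a \<otimes>\<^bsub>H\<^esub> antipode H b) (comult H h))"
    by (rule klinear_tlift[OF m m m M comult_closed[OF h] f, symmetric]) (simp add: antipode_closed)
  then show ?thesis
    using klinear_smult[OF f counit_closed[OF h] A.one_closed] by (simp add: antipode_right[OF h])
qed

lemma counit_mult:
  "\<lbrakk>a \<in> carrier H; b \<in> carrier H\<rbrakk> \<Longrightarrow> counit H (a \<otimes>\<^bsub>H\<^esub> b) = counit H a \<otimes>\<^bsub>K\<^esub> counit H b"
  using counit_hom by (simp add: kalg_hom_def ring_hom_def)

lemma counit_one: "counit H \<one>\<^bsub>H\<^esub> = \<one>\<^bsub>K\<^esub>"
  using counit_hom by (simp add: kalg_hom_def ring_hom_def)

text \<open>Both sides equal \<open>\<epsilon>(S(h\<^sub>1)) \<epsilon>(h\<^sub>2) = \<epsilon>(S(h\<^sub>1) h\<^sub>2)\<close>.\<close>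

lemma counit_antipode:
  assumes h: "h \<in> carrier H"
  shows "counit H (antipode H h) = counit H h"
proof -
  note m = module_H and k = module_self_alg[OF R.is_cring]
  note eS = klinear_compose[OF counit_linear antipode_linear]
  have "counit H (antipode H h) = tlift (self_alg K)
      (\<lambda>a b. counit H b \<odot>\<^bsub>self_alg K\<^esub> counit H (antipode H a)) (comult H h)"
    by (rule counit_right_linear[OF k eS h, symmetric])
  also have "\<dots> = tlift (self_alg K) (\<lambda>a b. counit H (antipode H a \<otimes>\<^bsub>H\<^esub> b)) (comult H h)"
    by (rule tlift_cong[OF m m comult_closed[OF h]])
      (simp add: counit_mult antipode_closed counit_closed R.m_comm)
  also have "\<dots> = counit H h"
    using antipode_left_linear[OF k counit_linear h] counit_closed[OF h] by (simp add: counit_one)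
  finally show ?thesis .
qed

text \<open>In Sweedler notation:
  \<open>p u\<^sub>1 S(u\<^sub>4) \<otimes> q u\<^sub>2 S(u\<^sub>3) = \<epsilon>(u) (p \<otimes> q)\<close>.
  The inner pair \<open>u\<^sub>2 S(u\<^sub>3)\<close> cancels first and then the outer one.  So
  \<open>v \<mapsto> S(v\<^sub>2) \<otimes> S(v\<^sub>1)\<close> is a right convolution inverse of the
  coproduct.\<close>

lemma antipode_comult_aux:
  assumes M: "module K M" and g: "bilinear K H H M g"
    and p: "p \<in> carrier H" and q: "q \<in> carrier H" and u: "u \<in> carrier H"
  shows "tlift M (\<lambda>a v. tlift M (\<lambda>r s. tlift M (\<lambda>c d.
        g (p \<otimes>\<^bsub>H\<^esub> r \<otimes>\<^bsub>H\<^esub> antipode H d) (q \<otimes>\<^bsub>H\<^esub> s \<otimes>\<^bsub>H\<^esub> antipode H c)) (comult H v)) (comult H a)) (comult H u)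
    = counit H u \<odot>\<^bsub>M\<^esub> g p q"
proof -
  note m = module_H and c = comult_closed
  note cong = tlift_cong[OF m m]
  note gl = bilinear_left[OF g] and gr = bilinear_right[OF g]
    and ml = bilinear_left[OF mult_bilinear] and mr = bilinear_right[OF mult_bilinear]
  note lin = bilinearI gl gr ml mr klinear_ident antipode_linear A.m_closed antipode_closed p q
    klinear_tlift_param[OF m m M] klinear_tlift_arg[OF m m M _ comult_linear] c
  let ?g = "\<lambda>r s c d. g (p \<otimes>\<^bsub>H\<^esub> r \<otimes>\<^bsub>H\<^esub> antipode H d) (q \<otimes>\<^bsub>H\<^esub> s \<otimes>\<^bsub>H\<^esub> antipode H c)"
  have "tlift M (\<lambda>a v. tlift M (\<lambda>r s. tlift M (\<lambda>c d. ?g r s c d) (comult H v)) (comult H a)) (comult H u)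
      = tlift M (\<lambda>r w. tlift M (\<lambda>s v. tlift M (\<lambda>c d. ?g r s c d) (comult H v)) (comult H w)) (comult H u)"
    by (rule comult_trilinear[OF M u]) (intro lin | assumption)+
  also have "\<dots> = tlift M (\<lambda>r w. tlift M (\<lambda>z d. tlift M (\<lambda>s c. ?g r s c d) (comult H z)) (comult H w)) (comult H u)"
    by (intro cong c u comult_trilinear[OF M, symmetric]) (intro lin | assumption)+
  also have "\<dots> = tlift M (\<lambda>r w. tlift M (\<lambda>z d. counit H z \<odot>\<^bsub>M\<^esub>
      g (p \<otimes>\<^bsub>H\<^esub> r \<otimes>\<^bsub>H\<^esub> antipode H d) q) (comult H w)) (comult H u)"
  proof (intro cong c u)
    fix r w z d assume *: "r \<in> carrier H" "z \<in> carrier H" "d \<in> carrier H"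
    let ?x = "p \<otimes>\<^bsub>H\<^esub> r \<otimes>\<^bsub>H\<^esub> antipode H d"
    have x: "?x \<in> carrier H" using * p by (simp add: antipode_closed)
    have "tlift M (\<lambda>s c. ?g r s c d) (comult H z)
        = tlift M (\<lambda>s c. g ?x (q \<otimes>\<^bsub>H\<^esub> (s \<otimes>\<^bsub>H\<^esub> antipode H c))) (comult H z)"
      by (rule cong[OF c[OF *(2)]]) (simp add: A.m_assoc q antipode_closed)
    also have "\<dots> = counit H z \<odot>\<^bsub>M\<^esub> g ?x (q \<otimes>\<^bsub>H\<^esub> \<one>\<^bsub>H\<^esub>)"
      by (rule antipode_right_linear[OF M _ *(2)]) (intro lin x)
    finally show "tlift M (\<lambda>s c. ?g r s c d) (comult H z) = counit H z \<odot>\<^bsub>M\<^esub> g ?x q" using q by simp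
  qed
  also have "\<dots> = tlift M (\<lambda>r w. g (p \<otimes>\<^bsub>H\<^esub> r \<otimes>\<^bsub>H\<^esub> antipode H w) q) (comult H u)"
    by (intro cong c u counit_left_linear[OF M]) (intro lin | assumption)+
  also have "\<dots> = tlift M (\<lambda>r w. g (p \<otimes>\<^bsub>H\<^esub> (r \<otimes>\<^bsub>H\<^esub> antipode H w)) q) (comult H u)"
    by (rule cong[OF c[OF u]]) (simp add: A.m_assoc p antipode_closed)
  also have "\<dots> = counit H u \<odot>\<^bsub>M\<^esub> g (p \<otimes>\<^bsub>H\<^esub> \<one>\<^bsub>H\<^esub>) q"
    by (rule antipode_right_linear[OF M _ u]) (intro lin)
  finally show ?thesis using p by simp
qed

text \<open>The antipode reverses the coproduct.  As for inverses in a group, both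
  \<open>h \<mapsto> \<Delta>(S(h))\<close> and
  \<open>h \<mapsto> S(h\<^sub>2) \<otimes> S(h\<^sub>1)\<close> are convolution inverses of
  \<open>\<Delta>\<close>, and they are compared by evaluating
  \<open>\<Delta>(S(h\<^sub>1)) \<Delta>(h\<^sub>2) (S(h\<^sub>4) \<otimes> S(h\<^sub>3))\<close> in two ways:
  \<open>antipode_comult_aux\<close> removes the last two factors, and multiplicativity of
  \<open>\<Delta>\<close> removes the first two.\<close>

lemma antipode_comult:
  assumes M: "module K M" and g: "bilinear K H H M g" and h: "h \<in> carrier H"
  shows "tlift M g (comult H (antipode H h)) = tlift M (\<lambda>a b. g (antipode H b) (antipode H a)) (comult H h)"
proof -
  interpret M: module K M by fact
  note m = module_H and c = comult_closed
  note cong = tlift_cong[OF m m]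
  note gl = bilinear_left[OF g] and gr = bilinear_right[OF g]
    and ml = bilinear_left[OF mult_bilinear] and mr = bilinear_right[OF mult_bilinear]
  \<comment> \<open>\<open>G v P Q\<close> is \<open>g\<close> applied to
    \<open>(P \<otimes> Q) (S(v\<^sub>2) \<otimes> S(v\<^sub>1))\<close>.\<close>
  define G where "G = (\<lambda>v P Q. tlift M (\<lambda>c d. g (P \<otimes>\<^bsub>H\<^esub> antipode H d) (Q \<otimes>\<^bsub>H\<^esub> antipode H c)) (comult H v))"
  note lin = bilinearI gl gr ml mr klinear_ident antipode_linear A.m_closed antipode_closed
    klinear_tlift_param[OF m m M] c klinear_tlift_arg[OF m m M _ comult_linear]
    klinear_tlift_arg[OF m m M _ klinear_compose[OF comult_linear antipode_linear]]
  have G: "bilinear K H H M (G v)" if "v \<in> carrier H" for v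
    unfolding G_def by (intro lin that) assumption+
  have Gv: "(\<lambda>v. G v P Q) \<in> klinear K H M" if "P \<in> carrier H" "Q \<in> carrier H" for P Q
    unfolding G_def by (intro lin that) assumption+
  have Gc: "G v P Q \<in> carrier M" if "v \<in> carrier H" "P \<in> carrier H" "Q \<in> carrier H" for v P Q
    by (rule bilinear_closed[OF G]) (fact that)+
  note Gl = bilinear_left[OF G] and Gr = bilinear_right[OF G]
  have "tlift M g (comult H (antipode H h))
      = tlift M (\<lambda>k u. counit H u \<odot>\<^bsub>M\<^esub> tlift M g (comult H (antipode H k))) (comult H h)"
    by (rule counit_right_linear[OF M _ h, symmetric]) (intro lin g)
  also have "\<dots> = tlift M (\<lambda>k u. tlift M (\<lambda>p q. counit H u \<odot>\<^bsub>M\<^esub> g p q) (comult H (antipode H k))) (comult H h)"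
    by (intro cong c h klinear_tlift[OF m m M M] klinear_smult_const[OF M] klinear_ident
        counit_closed antipode_closed bilinear_closed[OF g]) assumption+
  also have "\<dots> = tlift M (\<lambda>k u. tlift M (\<lambda>p q. tlift M (\<lambda>a v. tlift M (\<lambda>r s.
        G v (p \<otimes>\<^bsub>H\<^esub> r) (q \<otimes>\<^bsub>H\<^esub> s)) (comult H a)) (comult H u)) (comult H (antipode H k))) (comult H h)"
    unfolding G_def
    by (intro cong c h antipode_closed antipode_comult_aux[OF M g, symmetric]) assumption+
  also have "\<dots> = tlift M (\<lambda>k u. tlift M (\<lambda>a v. tlift M (\<lambda>p q. tlift M (\<lambda>r s.
        G v (p \<otimes>\<^bsub>H\<^esub> r) (q \<otimes>\<^bsub>H\<^esub> s)) (comult H a)) (comult H (antipode H k))) (comult H u)) (comult H h)"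
    by (intro cong c h antipode_closed tlift_swap[OF m m m m M] tlift_closed[OF m m M] Gc A.m_closed)
      assumption+
  also have "\<dots> = tlift M (\<lambda>w v. tlift M (\<lambda>k a. tlift M (\<lambda>p q. tlift M (\<lambda>r s.
        G v (p \<otimes>\<^bsub>H\<^esub> r) (q \<otimes>\<^bsub>H\<^esub> s)) (comult H a)) (comult H (antipode H k))) (comult H w)) (comult H h)"
    by (rule comult_trilinear[OF M h, symmetric]) (intro lin Gl Gr Gv | assumption)+
  also have "\<dots> = tlift M (\<lambda>w v. tlift M (\<lambda>k a. tlift M (G v) (comult H (antipode H k \<otimes>\<^bsub>H\<^esub> a)))
        (comult H w)) (comult H h)"
    by (intro cong c h comult_mult[OF M, symmetric] G antipode_closed) assumption+
  also have "\<dots> = tlift M (\<lambda>w v. counit H w \<odot>\<^bsub>M\<^esub> G v \<one>\<^bsub>H\<^esub> \<one>\<^bsub>H\<^esub>) (comult H h)"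
  proof (intro cong c h)
    fix w v assume *: "w \<in> carrier H" "v \<in> carrier H"
    have "tlift M (\<lambda>k a. tlift M (G v) (comult H (antipode H k \<otimes>\<^bsub>H\<^esub> a))) (comult H w)
        = counit H w \<odot>\<^bsub>M\<^esub> tlift M (G v) (comult H \<one>\<^bsub>H\<^esub>)"
      by (rule antipode_left_linear[OF M _ *(1)]) (intro lin G *)
    then show "tlift M (\<lambda>k a. tlift M (G v) (comult H (antipode H k \<otimes>\<^bsub>H\<^esub> a))) (comult H w)
        = counit H w \<odot>\<^bsub>M\<^esub> G v \<one>\<^bsub>H\<^esub> \<one>\<^bsub>H\<^esub>"
      by (simp add: comult_one[OF M G[OF *(2)]])
  qed
  also have "\<dots> = G h \<one>\<^bsub>H\<^esub> \<one>\<^bsub>H\<^esub>"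
    by (rule counit_left_linear[OF M Gv h]) simp_all
  also have "\<dots> = tlift M (\<lambda>a b. g (antipode H b) (antipode H a)) (comult H h)"
    unfolding G_def by (rule cong[OF c[OF h]]) (simp add: antipode_closed)
  finally show ?thesis .
qed

end

section \<open>The dual of a finite-dimensional Hopf algebra\<close>

lemma klinear_finsum:
  assumes "module K V" "module K M" "\<phi> \<in> klinear K V M" "finite B" "f \<in> B \<rightarrow> carrier V"
  shows "\<phi> (\<Oplus>\<^bsub>V\<^esub>b\<in>B. f b) = (\<Oplus>\<^bsub>M\<^esub>b\<in>B. \<phi> (f b))"
proof -
  interpret V: module K V by fact
  interpret M: module K M by fact
  show ?thesis using assms(4,5)
  proof (induction B rule: finite_induct)
    case empty
    then show ?case by (simp add: klinear_zero[OF assms(1-3)])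
  next
    case (insert x F)
    have "(\<lambda>b. \<phi> (f b)) \<in> F \<rightarrow> carrier M" "\<phi> (f x) \<in> carrier M"
      using insert.prems klinear_closed[OF assms(3)] by auto
    then show ?case
      using insert klinear_add[OF assms(3), of "f x" "finsum V f F"]
      by (simp add: Pi_iff)
  qed
qed

lemma tlift_self_alg: "tlift (self_alg K) f t = tlift K f t"
  by (simp add: tlift_def)

context hopf_algebra
begin

lemma dual_simps:
  "carrier (dual K H) = klinear K H (self_alg K) \<inter> extensional (carrier H)"
  "mult (dual K H) = (\<lambda>\<theta> \<theta>'. \<lambda>h \<in> carrier H. tlift K (\<lambda>h1 h2. \<theta> h1 \<otimes>\<^bsub>K\<^esub> \<theta>' h2) (comult H h))"
  "one (dual K H) = (\<lambda>h \<in> carrier H. counit H h)"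
  "zero (dual K H) = (\<lambda>h \<in> carrier H. \<zero>\<^bsub>K\<^esub>)"
  "add (dual K H) = (\<lambda>\<theta> \<theta>'. \<lambda>h \<in> carrier H. \<theta> h \<oplus>\<^bsub>K\<^esub> \<theta>' h)"
  "smult (dual K H) = (\<lambda>c \<theta>. \<lambda>h \<in> carrier H. c \<otimes>\<^bsub>K\<^esub> \<theta> h)"
  "counit (dual K H) = (\<lambda>\<theta>. \<theta> \<one>\<^bsub>H\<^esub>)"
  by (simp_all add: dual_def dual_alg_def module.extend_def hopf.fields_def)

lemma comult_dual_def:
  "comult (dual K H) \<theta> = (THE t. t \<in> carrier (tensor K (dual_alg K H) (dual_alg K H)) \<and>
     (\<forall>h \<in> carrier H. \<forall>h' \<in> carrier H.
       \<theta> (h \<otimes>\<^bsub>H\<^esub> h') = tlift K (\<lambda>\<theta>1 \<theta>2. \<theta>1 h \<otimes>\<^bsub>K\<^esub> \<theta>2 h') t))"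
  by (simp add: dual_def module.extend_def hopf.fields_def)

lemma dual_same_space: "same_space (dual K H) (dual_alg K H)"
  by (simp add: same_space_def dual_def dual_alg_def module.extend_def)

lemma module_K: "module K (self_alg K)"
  by (rule module_self_alg[OF R.is_cring])

lemma dual_linear: "\<theta> \<in> carrier (dual K H) \<Longrightarrow> \<theta> \<in> klinear K H (self_alg K)"
  by (simp add: dual_simps)

lemma dual_app_closed: "\<lbrakk>\<theta> \<in> carrier (dual K H); h \<in> carrier H\<rbrakk> \<Longrightarrow> \<theta> h \<in> carrier K"
  using klinear_closed[OF dual_linear] by simp

lemma dual_add_app: "h \<in> carrier H \<Longrightarrow> (\<theta> \<oplus>\<^bsub>dual K H\<^esub> \<theta>') h = \<theta> h \<oplus>\<^bsub>K\<^esub> \<theta>' h"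
  by (simp add: dual_simps)

lemma dual_smult_app: "h \<in> carrier H \<Longrightarrow> (c \<odot>\<^bsub>dual K H\<^esub> \<theta>) h = c \<otimes>\<^bsub>K\<^esub> \<theta> h"
  by (simp add: dual_simps)

lemma dual_eqI:
  "\<lbrakk>\<theta> \<in> carrier (dual K H); \<theta>' \<in> carrier (dual K H); \<And>h. h \<in> carrier H \<Longrightarrow> \<theta> h = \<theta>' h\<rbrakk> \<Longrightarrow> \<theta> = \<theta>'"
  by (auto simp: dual_simps intro: extensionalityI)

lemma dual_memI:
  assumes "(\<lambda>h. f h) \<in> klinear K H (self_alg K)"
  shows "(\<lambda>h \<in> carrier H. f h) \<in> carrier (dual K H)"
  using klinear_cong[OF module_H assms, of "\<lambda>h \<in> carrier H. f h"] by (simp add: dual_simps)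

lemma module_dual: "module K (dual K H)"
proof -
  note app = dual_app_closed
  have add: "\<theta> \<oplus>\<^bsub>dual K H\<^esub> \<theta>' \<in> carrier (dual K H)"
    if "\<theta> \<in> carrier (dual K H)" "\<theta>' \<in> carrier (dual K H)" for \<theta> \<theta>'
    unfolding dual_simps(5)
    by (rule dual_memI) (use that[THEN dual_linear] in \<open>auto simp: klinear_def Pi_iff R.add.m_ac R.r_distr\<close>)
  have smult: "c \<odot>\<^bsub>dual K H\<^esub> \<theta> \<in> carrier (dual K H)"
    if "c \<in> carrier K" "\<theta> \<in> carrier (dual K H)" for c \<theta>
    unfolding dual_simps(6)
    using klinear_smult_const[OF module_K that(1) dual_linear[OF that(2)]] by (intro dual_memI) simp
  have zero: "\<zero>\<^bsub>dual K H\<^esub> \<in> carrier (dual K H)"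
    unfolding dual_simps(4) by (rule dual_memI) (auto simp: klinear_def)
  have at: "(\<theta> \<oplus>\<^bsub>dual K H\<^esub> \<theta>') h = \<theta> h \<oplus>\<^bsub>K\<^esub> \<theta>' h" "(c \<odot>\<^bsub>dual K H\<^esub> \<theta>) h = c \<otimes>\<^bsub>K\<^esub> \<theta> h"
    "\<zero>\<^bsub>dual K H\<^esub> h = \<zero>\<^bsub>K\<^esub>" if "h \<in> carrier H" for \<theta> \<theta>' c h
    using that by (simp_all add: dual_simps)
  have neg: "\<exists>\<theta>' \<in> carrier (dual K H). \<theta>' \<oplus>\<^bsub>dual K H\<^esub> \<theta> = \<zero>\<^bsub>dual K H\<^esub>" if "\<theta> \<in> carrier (dual K H)" for \<theta>
  proof
    show "(\<ominus>\<^bsub>K\<^esub> \<one>\<^bsub>K\<^esub>) \<odot>\<^bsub>dual K H\<^esub> \<theta> \<in> carrier (dual K H)" by (rule smult) (simp_all add: that)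
    then show "(\<ominus>\<^bsub>K\<^esub> \<one>\<^bsub>K\<^esub>) \<odot>\<^bsub>dual K H\<^esub> \<theta> \<oplus>\<^bsub>dual K H\<^esub> \<theta> = \<zero>\<^bsub>dual K H\<^esub>"
      by (intro dual_eqI add zero that) (simp_all add: at R.l_minus R.l_neg app[OF that])
  qed
  show ?thesis
    by (intro module.intro module_axioms.intro abelian_groupI R.is_cring neg; (rule dual_eqI)?)
      (simp_all add: add smult zero at app R.add.m_ac R.l_distr R.r_distr R.m_assoc)
qed

lemma dual_eval_linear: "h \<in> carrier H \<Longrightarrow> (\<lambda>\<theta>. \<theta> h) \<in> klinear K (dual K H) (self_alg K)"
  by (rule klinearI) (simp_all add: dual_app_closed, simp_all add: dual_simps)

text \<open>Linear maps into the dual are recognized pointwise.\<close>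

lemma klinear_dualI:
  assumes V: "module K V" and cl: "\<And>v. v \<in> carrier V \<Longrightarrow> F v \<in> carrier (dual K H)"
    and lin: "\<And>h. h \<in> carrier H \<Longrightarrow> (\<lambda>v. F v h) \<in> klinear K V (self_alg K)"
  shows "F \<in> klinear K V (dual K H)"
proof -
  interpret V: module K V by fact
  interpret D: module K "dual K H" by (rule module_dual)
  show ?thesis
  proof (rule klinearI)
    fix x y assume *: "x \<in> carrier V" "y \<in> carrier V"
    show "F (x \<oplus>\<^bsub>V\<^esub> y) = F x \<oplus>\<^bsub>dual K H\<^esub> F y"
      using * klinear_add[OF lin] by (intro dual_eqI cl D.add.m_closed V.add.m_closed) (auto simp: dual_simps)
  next
    fix c x assume *: "c \<in> carrier K" "x \<in> carrier V"
    show "F (c \<odot>\<^bsub>V\<^esub> x) = c \<odot>\<^bsub>dual K H\<^esub> F x"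
      using * klinear_smult[OF lin] by (intro dual_eqI cl D.smult_closed V.smult_closed) (auto simp: dual_simps)
  qed (rule cl)
qed

lemma klinear_app_mult:
  assumes "f \<in> klinear K V (self_alg K)" "c \<in> carrier K"
  shows "(\<lambda>v. f v \<otimes>\<^bsub>K\<^esub> c) \<in> klinear K V (self_alg K)" "(\<lambda>v. c \<otimes>\<^bsub>K\<^esub> f v) \<in> klinear K V (self_alg K)"
  using klinear_smult_vec[OF module_K, of c f V] klinear_smult_const[OF module_K, of c f V] assms by simp_all

lemma dual_mult_app:
  "h \<in> carrier H \<Longrightarrow> (\<theta> \<otimes>\<^bsub>dual K H\<^esub> \<theta>') h = tlift (self_alg K) (\<lambda>a b. \<theta> a \<otimes>\<^bsub>K\<^esub> \<theta>' b) (comult H h)"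
  by (simp add: dual_simps tlift_self_alg)

lemma dual_mult_closed:
  assumes "\<theta> \<in> carrier (dual K H)" "\<theta>' \<in> carrier (dual K H)"
  shows "\<theta> \<otimes>\<^bsub>dual K H\<^esub> \<theta>' \<in> carrier (dual K H)"
  unfolding dual_simps(2) tlift_self_alg[of K, symmetric]
  by (intro dual_memI klinear_tlift_arg[OF module_H module_H module_K _ comult_linear] bilinearI
      klinear_app_mult dual_linear[OF assms(1)] dual_linear[OF assms(2)] dual_app_closed[OF assms(1)] dual_app_closed[OF assms(2)] assms)

lemma dual_mult_bilinear: "bilinear K (dual K H) (dual K H) (dual K H) (mult (dual K H))"
proof -
  note m = module_H and D = module_dual
  show ?thesis
  proof (intro bilinearI klinear_dualI D dual_mult_closed)
    fix \<theta> h assume *: "\<theta> \<in> carrier (dual K H)" "h \<in> carrier H"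
    have "(\<lambda>\<theta>'. tlift (self_alg K) (\<lambda>a b. \<theta>' a \<otimes>\<^bsub>K\<^esub> \<theta> b) (comult H h)) \<in> klinear K (dual K H) (self_alg K)"
      by (intro klinear_tlift_param[OF m m module_K] comult_closed *(2) klinear_app_mult
          dual_eval_linear dual_app_closed[OF *(1)]) assumption+
    then show "(\<lambda>\<theta>'. (\<theta>' \<otimes>\<^bsub>dual K H\<^esub> \<theta>) h) \<in> klinear K (dual K H) (self_alg K)"
      by (simp only: dual_mult_app[OF *(2)])
    have "(\<lambda>\<theta>'. tlift (self_alg K) (\<lambda>a b. \<theta> a \<otimes>\<^bsub>K\<^esub> \<theta>' b) (comult H h)) \<in> klinear K (dual K H) (self_alg K)"
      by (intro klinear_tlift_param[OF m m module_K] comult_closed *(2) klinear_app_mult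
          dual_eval_linear dual_app_closed[OF *(1)]) assumption+
    then show "(\<lambda>\<theta>'. (\<theta> \<otimes>\<^bsub>dual K H\<^esub> \<theta>') h) \<in> klinear K (dual K H) (self_alg K)"
      by (simp only: dual_mult_app[OF *(2)])
  qed
qed

lemma dual_one_closed: "\<one>\<^bsub>dual K H\<^esub> \<in> carrier (dual K H)"
  unfolding dual_simps(3) using dual_memI[OF counit_linear] by simp

lemma dual_one_app: "h \<in> carrier H \<Longrightarrow> \<one>\<^bsub>dual K H\<^esub> h = counit H h"
  by (simp add: dual_simps)

lemma dual_one_left:
  assumes "\<theta> \<in> carrier (dual K H)" shows "\<one>\<^bsub>dual K H\<^esub> \<otimes>\<^bsub>dual K H\<^esub> \<theta> = \<theta>"
proof (rule dual_eqI)
  fix h assume h: "h \<in> carrier H"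
  have "(\<one>\<^bsub>dual K H\<^esub> \<otimes>\<^bsub>dual K H\<^esub> \<theta>) h = tlift (self_alg K) (\<lambda>a b. counit H a \<odot>\<^bsub>self_alg K\<^esub> \<theta> b) (comult H h)"
    unfolding dual_mult_app[OF h]
    by (rule tlift_cong[OF module_H module_H comult_closed[OF h]]) (simp add: dual_one_app)
  then show "(\<one>\<^bsub>dual K H\<^esub> \<otimes>\<^bsub>dual K H\<^esub> \<theta>) h = \<theta> h"
    using counit_left_linear[OF module_K dual_linear[OF assms] h] by simp
qed (intro dual_mult_closed dual_one_closed assms)+

lemma dual_one_right:
  assumes "\<theta> \<in> carrier (dual K H)" shows "\<theta> \<otimes>\<^bsub>dual K H\<^esub> \<one>\<^bsub>dual K H\<^esub> = \<theta>"
proof (rule dual_eqI)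
  fix h assume h: "h \<in> carrier H"
  have "(\<theta> \<otimes>\<^bsub>dual K H\<^esub> \<one>\<^bsub>dual K H\<^esub>) h = tlift (self_alg K) (\<lambda>a b. counit H b \<odot>\<^bsub>self_alg K\<^esub> \<theta> a) (comult H h)"
    unfolding dual_mult_app[OF h]
    by (rule tlift_cong[OF module_H module_H comult_closed[OF h]])
      (simp add: dual_one_app R.m_comm counit_closed dual_app_closed[OF assms])
  then show "(\<theta> \<otimes>\<^bsub>dual K H\<^esub> \<one>\<^bsub>dual K H\<^esub>) h = \<theta> h"
    using counit_right_linear[OF module_K dual_linear[OF assms] h] by simp
qed (intro dual_mult_closed dual_one_closed assms)+

text \<open>The canonical element \<open>\<Sum>\<^sub>i h\<^sub>i\<^sup>* \<otimes> h\<^sub>i\<close>.  It is the only place where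
  a basis is chosen; further on, finite dimension is used through this element, and expansions in the
  basis become ordinary Sweedler sums.\<close>

lemma canonical_element_exists:
  assumes "finite_dim K H"
  obtains E where "E \<in> carrier (tensor K (dual K H) H)"
    and "\<And>h. h \<in> carrier H \<Longrightarrow> tlift H (\<lambda>\<theta> b. \<theta> h \<odot>\<^bsub>H\<^esub> b) E = h"
proof -
  obtain B where basis: "finite_basis K H B"
    using assms by (auto simp: finite_dim_def)
  have B: "finite B" "B \<subseteq> carrier H" using basis by (simp_all add: finite_basis_def)
  have ex: "\<exists>!c. c \<in> B \<rightarrow>\<^sub>E carrier K \<and> v = (\<Oplus>\<^bsub>H\<^esub>b\<in>B. c b \<odot>\<^bsub>H\<^esub> b)"
    if "v \<in> carrier H" for v
    using basis that unfolding finite_basis_def by (elim conjE) (rule bspec)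
  \<comment> \<open>The coordinate functions are linear because coordinates are unique.\<close>
  define cf where "cf = (\<lambda>v. THE c. c \<in> B \<rightarrow>\<^sub>E carrier K \<and> v = (\<Oplus>\<^bsub>H\<^esub>b\<in>B. c b \<odot>\<^bsub>H\<^esub> b))"
  have cf: "cf v \<in> B \<rightarrow>\<^sub>E carrier K" "v = (\<Oplus>\<^bsub>H\<^esub>b\<in>B. cf v b \<odot>\<^bsub>H\<^esub> b)" if "v \<in> carrier H" for v
    using theI'[OF ex[OF that]] unfolding cf_def by auto
  have cfb: "cf v b \<in> carrier K" if "v \<in> carrier H" "b \<in> B" for v b
    using cf(1)[OF that(1)] that(2) by auto
  have uniq: "cf v = c" if "c \<in> B \<rightarrow>\<^sub>E carrier K" "v = (\<Oplus>\<^bsub>H\<^esub>b\<in>B. c b \<odot>\<^bsub>H\<^esub> b)" "v \<in> carrier H" for v c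
    using ex[OF that(3)] cf[OF that(3)] that(1,2) by blast
  have lin: "(\<lambda>v. cf v b) \<in> klinear K H (self_alg K)" if b: "b \<in> B" for b
  proof (rule klinearI)
    fix v w assume *: "v \<in> carrier H" "w \<in> carrier H"
    have "v \<oplus>\<^bsub>H\<^esub> w = (\<Oplus>\<^bsub>H\<^esub>b\<in>B. cf v b \<odot>\<^bsub>H\<^esub> b) \<oplus>\<^bsub>H\<^esub> (\<Oplus>\<^bsub>H\<^esub>b\<in>B. cf w b \<odot>\<^bsub>H\<^esub> b)"
      using cf(2) * by simp
    also have "\<dots> = (\<Oplus>\<^bsub>H\<^esub>b\<in>B. cf v b \<odot>\<^bsub>H\<^esub> b \<oplus>\<^bsub>H\<^esub> cf w b \<odot>\<^bsub>H\<^esub> b)"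
      using B cfb * by (intro M.finsum_addf[symmetric]) auto
    also have "\<dots> = (\<Oplus>\<^bsub>H\<^esub>b\<in>B. (\<lambda>b \<in> B. cf v b \<oplus>\<^bsub>K\<^esub> cf w b) b \<odot>\<^bsub>H\<^esub> b)"
      using B cfb * by (intro M.finsum_cong') (auto simp: smult_l_distr)
    finally have "cf (v \<oplus>\<^bsub>H\<^esub> w) = (\<lambda>b \<in> B. cf v b \<oplus>\<^bsub>K\<^esub> cf w b)"
      using cfb * by (intro uniq[OF _ _ M.add.m_closed[OF *]]) auto
    then show "cf (v \<oplus>\<^bsub>H\<^esub> w) b = cf v b \<oplus>\<^bsub>self_alg K\<^esub> cf w b" using b by simp
  next
    fix c v assume *: "c \<in> carrier K" "v \<in> carrier H"
    have "c \<odot>\<^bsub>H\<^esub> v = c \<odot>\<^bsub>H\<^esub> (\<Oplus>\<^bsub>H\<^esub>b\<in>B. cf v b \<odot>\<^bsub>H\<^esub> b)" using cf(2)[OF *(2)] by simp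
    also have "\<dots> = (\<Oplus>\<^bsub>H\<^esub>b\<in>B. c \<odot>\<^bsub>H\<^esub> (cf v b \<odot>\<^bsub>H\<^esub> b))"
      using B cfb * by (intro finsum_smult_ldistr) auto
    also have "\<dots> = (\<Oplus>\<^bsub>H\<^esub>b\<in>B. (\<lambda>b \<in> B. c \<otimes>\<^bsub>K\<^esub> cf v b) b \<odot>\<^bsub>H\<^esub> b)"
      using B cfb * by (intro M.finsum_cong') (auto simp: smult_assoc1)
    finally have "cf (c \<odot>\<^bsub>H\<^esub> v) = (\<lambda>b \<in> B. c \<otimes>\<^bsub>K\<^esub> cf v b)"
      using cfb * by (intro uniq[OF _ _ smult_closed[OF *]]) auto
    then show "cf (c \<odot>\<^bsub>H\<^esub> v) b = c \<odot>\<^bsub>self_alg K\<^esub> cf v b" using b by simp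
  qed (use cfb b in simp)
  let ?c = "\<lambda>b. \<lambda>v \<in> carrier H. cf v b"
  have c: "?c b \<in> carrier (dual K H)" if "b \<in> B" for b by (rule dual_memI[OF lin[OF that]])
  let ?T = "tensor K (dual K H) H"
  define E where "E = (\<Oplus>\<^bsub>?T\<^esub>b\<in>B. pure K (dual K H) H (?c b) b)"
  note D = module_dual and m = module_H
  interpret T: module K ?T by (rule tensor_module[OF D m])
  have pc: "(\<lambda>b. pure K (dual K H) H (?c b) b) \<in> B \<rightarrow> carrier ?T"
    using c B(2) by (auto intro!: pure_closed)
  have "E \<in> carrier ?T" unfolding E_def by (rule T.finsum_closed[OF pc])
  moreover have "tlift H (\<lambda>\<theta> b. \<theta> h \<odot>\<^bsub>H\<^esub> b) E = h" if h: "h \<in> carrier H" for h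
  proof -
    have bil: "bilinear K (dual K H) H H (\<lambda>\<theta> b. \<theta> h \<odot>\<^bsub>H\<^esub> b)"
      by (intro bilinearI klinear_smult_vec[OF m] klinear_smult_const[OF m] dual_eval_linear
          klinear_ident h | erule dual_app_closed | assumption)+
    have "tlift H (\<lambda>\<theta> b. \<theta> h \<odot>\<^bsub>H\<^esub> b) E
        = (\<Oplus>\<^bsub>H\<^esub>b\<in>B. tlift H (\<lambda>\<theta> b. \<theta> h \<odot>\<^bsub>H\<^esub> b) (pure K (dual K H) H (?c b) b))"
      unfolding E_def
      by (rule klinear_finsum[OF T.module_axioms m tlift_linear[OF D m m bil] B(1) pc])
    also have "\<dots> = (\<Oplus>\<^bsub>H\<^esub>b\<in>B. cf h b \<odot>\<^bsub>H\<^esub> b)"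
    proof (rule M.finsum_cong')
      fix b assume b: "b \<in> B"
      then have "tlift H (\<lambda>\<theta> b. \<theta> h \<odot>\<^bsub>H\<^esub> b) (pure K (dual K H) H (?c b) b) = ?c b h \<odot>\<^bsub>H\<^esub> b"
        using B(2) by (intro tlift_pure[OF D m m bil] c) auto
      then show "tlift H (\<lambda>\<theta> b. \<theta> h \<odot>\<^bsub>H\<^esub> b) (pure K (dual K H) H (?c b) b) = cf h b \<odot>\<^bsub>H\<^esub> b"
        using h by simp
    qed (use cfb h B(2) in auto)
    also have "\<dots> = h" using cf(2)[OF h] by simp
    finally show ?thesis .
  qed
  ultimately show ?thesis using that by blast
qed

text \<open>Expanding the first factor of a tensor over the dual along the canonical element writes it as
  \<open>\<Sum>\<^sub>i h\<^sub>i\<^sup>* \<otimes> t\<^sub>i\<close>, where \<open>t\<^sub>i\<close> is the functional obtained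
  by evaluating the first factor at \<open>h\<^sub>i\<close>.  Hence evaluations in both factors determine it.\<close>

lemma tensor_dual_eqI:
  assumes fd: "finite_dim K H"
    and s: "s \<in> carrier (tensor K (dual K H) (dual K H))" and t: "t \<in> carrier (tensor K (dual K H) (dual K H))"
    and eq: "\<And>h h'. \<lbrakk>h \<in> carrier H; h' \<in> carrier H\<rbrakk> \<Longrightarrow>
      tlift K (\<lambda>\<theta>1 \<theta>2. \<theta>1 h \<otimes>\<^bsub>K\<^esub> \<theta>2 h') s = tlift K (\<lambda>\<theta>1 \<theta>2. \<theta>1 h \<otimes>\<^bsub>K\<^esub> \<theta>2 h') t"
  shows "s = t"
proof -
  let ?D = "dual K H"
  let ?T = "tensor K ?D ?D"
  note D = module_dual and m = module_H
  note T = tensor_module[OF D D] and P = pure_bilinear[OF D D]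
  interpret D: module K ?D by (rule module_dual)
  obtain E where E: "E \<in> carrier (tensor K ?D H)"
    and Eh: "\<And>h. h \<in> carrier H \<Longrightarrow> tlift H (\<lambda>\<theta> b. \<theta> h \<odot>\<^bsub>H\<^esub> b) E = h"
    by (rule canonical_element_exists[OF fd]) blast
  have expand: "tlift ?D (\<lambda>c b. \<theta> b \<odot>\<^bsub>?D\<^esub> c) E = \<theta>" if \<theta>: "\<theta> \<in> carrier ?D" for \<theta>
  proof (rule dual_eqI)
    show "tlift ?D (\<lambda>c b. \<theta> b \<odot>\<^bsub>?D\<^esub> c) E \<in> carrier ?D"
      by (intro tlift_closed[OF D m D E] D.smult_closed dual_app_closed[OF \<theta>])
    fix h assume h: "h \<in> carrier H"
    have "tlift ?D (\<lambda>c b. \<theta> b \<odot>\<^bsub>?D\<^esub> c) E h = tlift (self_alg K) (\<lambda>c b. (\<theta> b \<odot>\<^bsub>?D\<^esub> c) h) E"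
      by (intro klinear_tlift[OF D m D module_K E dual_eval_linear[OF h]] D.smult_closed dual_app_closed[OF \<theta>])
    also have "\<dots> = tlift (self_alg K) (\<lambda>c b. \<theta> (c h \<odot>\<^bsub>H\<^esub> b)) E"
      using klinear_smult[OF dual_linear[OF \<theta>]]
      by (intro tlift_cong[OF D m E]) (simp add: h dual_app_closed \<theta> dual_simps(6) R.m_comm)
    also have "\<dots> = \<theta> (tlift H (\<lambda>c b. c h \<odot>\<^bsub>H\<^esub> b) E)"
      by (intro klinear_tlift[OF D m m module_K E dual_linear[OF \<theta>], symmetric] smult_closed h | assumption | erule dual_app_closed)+
    also have "\<dots> = \<theta> h" by (simp add: Eh h)
    finally show "tlift ?D (\<lambda>c b. \<theta> b \<odot>\<^bsub>?D\<^esub> c) E h = \<theta> h" .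
  qed (rule \<theta>)
  \<comment> \<open>The functional that accompanies the basis vector dual to \<open>b\<close>.\<close>
  define part where "part = (\<lambda>t b. tlift ?D (\<lambda>(\<theta> :: 'h \<Rightarrow> 'k) \<theta>'. \<theta> b \<odot>\<^bsub>?D\<^esub> \<theta>') t)"
  have decomp: "t = tlift ?T (\<lambda>c b. pure K ?D ?D c (part t b)) E" if t: "t \<in> carrier ?T" for t
  proof -
    have "t = tlift ?T (pure K ?D ?D) t" by (rule tlift_pure_id[OF D D t, symmetric])
    also have "\<dots> = tlift ?T (\<lambda>\<theta> \<theta>'. tlift ?T (\<lambda>c b. pure K ?D ?D c (\<theta> b \<odot>\<^bsub>?D\<^esub> \<theta>')) E) t"
    proof (rule tlift_cong[OF D D t])
      fix \<theta> \<theta>' assume *: "\<theta> \<in> carrier ?D" "\<theta>' \<in> carrier ?D"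
      have "pure K ?D ?D \<theta> \<theta>' = pure K ?D ?D (tlift ?D (\<lambda>c b. \<theta> b \<odot>\<^bsub>?D\<^esub> c) E) \<theta>'"
        by (simp only: expand[OF *(1)])
      also have "\<dots> = tlift ?T (\<lambda>c b. pure K ?D ?D (\<theta> b \<odot>\<^bsub>?D\<^esub> c) \<theta>') E"
        by (intro klinear_tlift[OF D m D T E] bilinear_left[OF P] klinear_ident D.smult_closed dual_app_closed[OF *(1)] *)
      also have "\<dots> = tlift ?T (\<lambda>c b. pure K ?D ?D c (\<theta> b \<odot>\<^bsub>?D\<^esub> \<theta>')) E"
        using * by (intro tlift_cong[OF D m E])
          (auto simp: pure_def intro!: tclass_eq tensor_eq.balanced dual_app_closed[OF *(1)])
      finally show "pure K ?D ?D \<theta> \<theta>' = \<dots>" .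
    qed
    also have "\<dots> = tlift ?T (\<lambda>c b. tlift ?T (\<lambda>\<theta> \<theta>'. pure K ?D ?D c (\<theta> b \<odot>\<^bsub>?D\<^esub> \<theta>')) t) E"
      by (intro tlift_swap[OF D D D m T t E] pure_closed D.smult_closed | assumption | erule dual_app_closed)+
    also have "\<dots> = tlift ?T (\<lambda>c b. pure K ?D ?D c (part t b)) E"
      unfolding part_def
      by (intro tlift_cong[OF D m E] klinear_tlift[OF D D D T t, symmetric] bilinear_right[OF P]
          klinear_ident D.smult_closed | assumption | erule dual_app_closed)+
    finally show ?thesis .
  qed
  have part_closed: "part t b \<in> carrier ?D" if "t \<in> carrier ?T" "b \<in> carrier H" for t b
    unfolding part_def by (intro tlift_closed[OF D D D] that D.smult_closed | assumption | erule dual_app_closed)+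
  have part_app: "part t b h = tlift K (\<lambda>\<theta>1 \<theta>2. \<theta>1 b \<otimes>\<^bsub>K\<^esub> \<theta>2 h) t"
    if "t \<in> carrier ?T" "b \<in> carrier H" "h \<in> carrier H" for t b h
  proof -
    have "part t b h = tlift (self_alg K) (\<lambda>\<theta> \<theta>'. (\<theta> b \<odot>\<^bsub>?D\<^esub> \<theta>') h) t"
      unfolding part_def
      by (intro klinear_tlift[OF D D D module_K] dual_eval_linear that D.smult_closed | assumption | erule dual_app_closed)+
    then show ?thesis using that by (simp add: tlift_self_alg dual_simps(6))
  qed
  have "part s b = part t b" if "b \<in> carrier H" for b
    by (rule dual_eqI) (use s t that in \<open>simp_all add: part_closed part_app eq\<close>)
  then have "tlift ?T (\<lambda>c b. pure K ?D ?D c (part s b)) E = tlift ?T (\<lambda>c b. pure K ?D ?D c (part t b)) E"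
    by (intro tlift_cong[OF D m E]) simp
  then show ?thesis using decomp[OF s] decomp[OF t] by simp
qed

text \<open>The coproduct of \<open>\<theta>\<close> is
  \<open>\<Sum>\<^sub>i h\<^sub>i\<^sup>* \<otimes> \<theta>(h\<^sub>i -)\<close>; uniqueness is \<open>tensor_dual_eqI\<close>.  So the
  definite description in the definition of the dual denotes, and has the intended property.\<close>

lemma comult_dual:
  assumes fd: "finite_dim K H" and \<theta>: "\<theta> \<in> carrier (dual K H)"
  shows "comult (dual K H) \<theta> \<in> carrier (tensor K (dual K H) (dual K H))"
    and "\<And>h h'. \<lbrakk>h \<in> carrier H; h' \<in> carrier H\<rbrakk> \<Longrightarrow>
      tlift K (\<lambda>\<theta>1 \<theta>2. \<theta>1 h \<otimes>\<^bsub>K\<^esub> \<theta>2 h') (comult (dual K H) \<theta>) = \<theta> (h \<otimes>\<^bsub>H\<^esub> h')"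
proof -
  let ?D = "dual K H"
  let ?T = "tensor K ?D ?D"
  note D = module_dual and m = module_H
  note T = tensor_module[OF D D] and P = pure_bilinear[OF D D]
  obtain E where E: "E \<in> carrier (tensor K ?D H)"
    and Eh: "\<And>h. h \<in> carrier H \<Longrightarrow> tlift H (\<lambda>\<theta> b. \<theta> h \<odot>\<^bsub>H\<^esub> b) E = h"
    by (rule canonical_element_exists[OF fd]) blast
  define Q where "Q = (\<lambda>t. t \<in> carrier ?T \<and> (\<forall>h \<in> carrier H. \<forall>h' \<in> carrier H.
      \<theta> (h \<otimes>\<^bsub>H\<^esub> h') = tlift K (\<lambda>\<theta>1 \<theta>2. \<theta>1 h \<otimes>\<^bsub>K\<^esub> \<theta>2 h') t))"
  let ?r = "\<lambda>b. \<lambda>h \<in> carrier H. \<theta> (b \<otimes>\<^bsub>H\<^esub> h)"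
  have r: "?r b \<in> carrier ?D" if "b \<in> carrier H" for b
    by (intro dual_memI klinear_compose[OF dual_linear[OF \<theta>]] bilinear_right[OF mult_bilinear] that klinear_ident)
  let ?t = "tlift ?T (\<lambda>c b. pure K ?D ?D c (?r b)) E"
  have t: "?t \<in> carrier ?T" by (intro tlift_closed[OF D m T E] pure_closed r)
  have "tlift K (\<lambda>\<theta>1 \<theta>2. \<theta>1 h \<otimes>\<^bsub>K\<^esub> \<theta>2 h') ?t = \<theta> (h \<otimes>\<^bsub>H\<^esub> h')"
    if h: "h \<in> carrier H" "h' \<in> carrier H" for h h'
  proof -
    let ?e = "\<lambda>\<theta>1 \<theta>2. \<theta>1 h \<otimes>\<^bsub>K\<^esub> \<theta>2 h'"
    have e: "bilinear K ?D ?D (self_alg K) ?e"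
      by (intro bilinearI klinear_app_mult dual_eval_linear h | assumption | erule dual_app_closed)+
    have l: "(\<lambda>x. \<theta> (x \<otimes>\<^bsub>H\<^esub> h')) \<in> klinear K H (self_alg K)"
      by (intro klinear_compose[OF dual_linear[OF \<theta>]] bilinear_left[OF mult_bilinear] h klinear_ident)
    have "tlift (self_alg K) ?e ?t = tlift (self_alg K) (\<lambda>c b. tlift (self_alg K) ?e (pure K ?D ?D c (?r b))) E"
      by (intro klinear_tlift[OF D m T module_K E tlift_linear[OF D D module_K e]] pure_closed r)
    also have "\<dots> = tlift (self_alg K) (\<lambda>c b. c h \<otimes>\<^bsub>K\<^esub> ?r b h') E"
      by (intro tlift_cong[OF D m E] tlift_pure[OF D D module_K e] r)
    also have "\<dots> = tlift (self_alg K) (\<lambda>c b. \<theta> ((c h \<odot>\<^bsub>H\<^esub> b) \<otimes>\<^bsub>H\<^esub> h')) E"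
      using klinear_smult[OF l]
      by (intro tlift_cong[OF D m E]) (simp add: h dual_app_closed)
    also have "\<dots> = \<theta> (tlift H (\<lambda>c b. c h \<odot>\<^bsub>H\<^esub> b) E \<otimes>\<^bsub>H\<^esub> h')"
      by (intro klinear_tlift[OF D m m module_K E l, symmetric] smult_closed h | assumption | erule dual_app_closed)+
    finally show ?thesis by (simp add: Eh h tlift_self_alg)
  qed
  with t have "Q ?t" unfolding Q_def by simp
  moreover have "u = ?t" if "Q u" for u
  proof (rule tensor_dual_eqI[OF fd _ t])
    show "u \<in> carrier ?T" using that by (simp add: Q_def)
    fix h h' assume "h \<in> carrier H" "h' \<in> carrier H"
    then show "tlift K (\<lambda>\<theta>1 \<theta>2. \<theta>1 h \<otimes>\<^bsub>K\<^esub> \<theta>2 h') u = tlift K (\<lambda>\<theta>1 \<theta>2. \<theta>1 h \<otimes>\<^bsub>K\<^esub> \<theta>2 h') ?t"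
      using that \<open>Q ?t\<close> by (simp add: Q_def)
  qed
  ultimately have "Q (THE t. Q t)" by (rule theI)
  moreover have "comult ?D \<theta> = (THE t. Q t)"
    using tensor_same_space[OF dual_same_space dual_same_space, of K]
    unfolding comult_dual_def Q_def by (simp add: same_space_def)
  ultimately have Q: "Q (comult ?D \<theta>)" by simp
  then show "comult ?D \<theta> \<in> carrier ?T" by (simp add: Q_def)
  show "tlift K (\<lambda>\<theta>1 \<theta>2. \<theta>1 h \<otimes>\<^bsub>K\<^esub> \<theta>2 h') (comult ?D \<theta>) = \<theta> (h \<otimes>\<^bsub>H\<^esub> h')"
    if "h \<in> carrier H" "h' \<in> carrier H" for h h'
    using Q that by (simp add: Q_def)
qed

lemma comult_dual_linear:
  assumes fd: "finite_dim K H"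
  shows "comult (dual K H) \<in> klinear K (dual K H) (tensor K (dual K H) (dual K H))"
proof -
  let ?D = "dual K H"
  let ?T = "tensor K ?D ?D"
  note D = module_dual
  note c = comult_dual[OF fd]
  interpret D: module K ?D by (rule module_dual)
  interpret T: module K ?T by (rule tensor_module[OF D D])
  have e: "tlift K (\<lambda>\<theta>1 \<theta>2. \<theta>1 h \<otimes>\<^bsub>K\<^esub> \<theta>2 h') \<in> klinear K ?T (self_alg K)"
    if "h \<in> carrier H" "h' \<in> carrier H" for h h'
    using tlift_linear[OF D D module_K, of "\<lambda>\<theta>1 \<theta>2. \<theta>1 h \<otimes>\<^bsub>K\<^esub> \<theta>2 h'"] that
      bilinearI[of ?D "\<lambda>\<theta>1 \<theta>2. \<theta>1 h \<otimes>\<^bsub>K\<^esub> \<theta>2 h'" K ?D "self_alg K"]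
      klinear_app_mult[OF dual_eval_linear dual_app_closed]
    by (simp add: tlift_self_alg[abs_def])
  show ?thesis
  proof (rule klinearI)
    fix \<theta> \<theta>' assume *: "\<theta> \<in> carrier ?D" "\<theta>' \<in> carrier ?D"
    show "comult ?D (\<theta> \<oplus>\<^bsub>?D\<^esub> \<theta>') = comult ?D \<theta> \<oplus>\<^bsub>?T\<^esub> comult ?D \<theta>'"
      using * klinear_add[OF e]
      by (intro tensor_dual_eqI[OF fd]) (simp_all add: c dual_add_app)
  next
    fix k \<theta> assume *: "k \<in> carrier K" "\<theta> \<in> carrier ?D"
    show "comult ?D (k \<odot>\<^bsub>?D\<^esub> \<theta>) = k \<odot>\<^bsub>?T\<^esub> comult ?D \<theta>"
      using * klinear_smult[OF e]
      by (intro tensor_dual_eqI[OF fd]) (simp_all add: c dual_smult_app)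
  qed (rule c)
qed

text \<open>Evaluating at \<open>(1, h)\<close> turns the coproduct back into \<open>\<theta>(1 h)\<close>.\<close>

lemma comult_dual_counit_left:
  assumes fd: "finite_dim K H" and \<theta>: "\<theta> \<in> carrier (dual K H)"
    and M: "module K M" and f: "f \<in> klinear K (dual K H) M"
  shows "tlift M (\<lambda>\<theta>1 \<theta>2. \<theta>1 \<one>\<^bsub>H\<^esub> \<odot>\<^bsub>M\<^esub> f \<theta>2) (comult (dual K H) \<theta>) = f \<theta>"
proof -
  let ?D = "dual K H"
  note D = module_dual and c = comult_dual[OF fd \<theta>]
  interpret D: module K ?D by (rule module_dual)
  have cl: "\<theta>1 \<one>\<^bsub>H\<^esub> \<odot>\<^bsub>?D\<^esub> \<theta>2 \<in> carrier ?D" if "\<theta>1 \<in> carrier ?D" "\<theta>2 \<in> carrier ?D" for \<theta>1 \<theta>2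
    using that by (simp add: dual_app_closed)
  have "tlift ?D (\<lambda>\<theta>1 \<theta>2. \<theta>1 \<one>\<^bsub>H\<^esub> \<odot>\<^bsub>?D\<^esub> \<theta>2) (comult ?D \<theta>) = \<theta>"
  proof (rule dual_eqI)
    fix h assume h: "h \<in> carrier H"
    have "tlift ?D (\<lambda>\<theta>1 \<theta>2. \<theta>1 \<one>\<^bsub>H\<^esub> \<odot>\<^bsub>?D\<^esub> \<theta>2) (comult ?D \<theta>) h
        = tlift (self_alg K) (\<lambda>\<theta>1 \<theta>2. (\<theta>1 \<one>\<^bsub>H\<^esub> \<odot>\<^bsub>?D\<^esub> \<theta>2) h) (comult ?D \<theta>)"
      by (rule klinear_tlift[OF D D D module_K c(1) dual_eval_linear[OF h] cl])
    also have "\<dots> = \<theta> h" using c(2)[of "\<one>\<^bsub>H\<^esub>" h] h by (simp add: dual_simps(6) tlift_self_alg)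
    finally show "tlift ?D (\<lambda>\<theta>1 \<theta>2. \<theta>1 \<one>\<^bsub>H\<^esub> \<odot>\<^bsub>?D\<^esub> \<theta>2) (comult ?D \<theta>) h = \<theta> h" .
  qed (intro tlift_closed[OF D D D c(1)] cl \<theta> | assumption)+
  then have "f \<theta> = f (tlift ?D (\<lambda>\<theta>1 \<theta>2. \<theta>1 \<one>\<^bsub>H\<^esub> \<odot>\<^bsub>?D\<^esub> \<theta>2) (comult ?D \<theta>))" by simp
  also have "\<dots> = tlift M (\<lambda>\<theta>1 \<theta>2. f (\<theta>1 \<one>\<^bsub>H\<^esub> \<odot>\<^bsub>?D\<^esub> \<theta>2)) (comult ?D \<theta>)"
    by (rule klinear_tlift[OF D D D M c(1) f cl])
  also have "\<dots> = tlift M (\<lambda>\<theta>1 \<theta>2. \<theta>1 \<one>\<^bsub>H\<^esub> \<odot>\<^bsub>M\<^esub> f \<theta>2) (comult ?D \<theta>)"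
    by (rule tlift_cong[OF D D c(1)]) (rule klinear_smult[OF f]; simp add: dual_app_closed)
  finally show ?thesis by simp
qed

end

section \<open>The Heisenberg algebra\<close>

context hopf_algebra
begin

lemma heisenberg_same_space: "same_space (tensor K H (dual K H)) (heisenberg K H)"
  by (simp add: same_space_def heisenberg_def Let_def)

lemma module_heisenberg: "module K (heisenberg K H)"
  by (rule module_same_space[OF tensor_module[OF module_H module_dual] heisenberg_same_space])

lemma dual_antipode_linear:
  "\<theta> \<in> carrier (dual K H) \<Longrightarrow> (\<lambda>h. \<theta> (antipode H h)) \<in> klinear K H (self_alg K)"
  by (rule klinear_compose[OF dual_linear antipode_linear])

text \<open>The product \<open>(h # \<theta>) (h' # \<theta>')\<close> of pure tensors.\<close>

definition heisenberg_term :: "'h \<Rightarrow> ('h \<Rightarrow> 'k) \<Rightarrow> 'h \<Rightarrow> ('h \<Rightarrow> 'k) \<Rightarrow> ('h, 'h \<Rightarrow> 'k) tens"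
  where "heisenberg_term h \<theta> h' \<theta>' =
    tlift (tensor K H (dual K H)) (\<lambda>h'1 h'2. tlift (tensor K H (dual K H)) (\<lambda>\<theta>1 \<theta>2.
      pure K H (dual K H) (\<theta>1 h'2 \<odot>\<^bsub>H\<^esub> (h \<otimes>\<^bsub>H\<^esub> h'1)) (\<theta>2 \<otimes>\<^bsub>dual K H\<^esub> \<theta>')) (comult (dual K H) \<theta>)) (comult H h')"

lemma heisenberg_term_linear:
  assumes fd: "finite_dim K H"
  shows "\<lbrakk>\<theta> \<in> carrier (dual K H); h' \<in> carrier H; \<theta>' \<in> carrier (dual K H)\<rbrakk> \<Longrightarrow>
      (\<lambda>h. heisenberg_term h \<theta> h' \<theta>') \<in> klinear K H (tensor K H (dual K H))"
    and "\<lbrakk>h \<in> carrier H; h' \<in> carrier H; \<theta>' \<in> carrier (dual K H)\<rbrakk> \<Longrightarrow>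
      (\<lambda>\<theta>. heisenberg_term h \<theta> h' \<theta>') \<in> klinear K (dual K H) (tensor K H (dual K H))"
    and "\<lbrakk>h \<in> carrier H; \<theta> \<in> carrier (dual K H); \<theta>' \<in> carrier (dual K H)\<rbrakk> \<Longrightarrow>
      (\<lambda>h'. heisenberg_term h \<theta> h' \<theta>') \<in> klinear K H (tensor K H (dual K H))"
    and "\<lbrakk>h \<in> carrier H; \<theta> \<in> carrier (dual K H); h' \<in> carrier H\<rbrakk> \<Longrightarrow>
      (\<lambda>\<theta>'. heisenberg_term h \<theta> h' \<theta>') \<in> klinear K (dual K H) (tensor K H (dual K H))"
proof -
  note m = module_H and D = module_dual
  note T = tensor_module[OF m D] and P = pure_bilinear[OF m D]
  note lin = bilinearI klinear_tlift_param[OF m m T] klinear_tlift_param[OF D D T]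
    klinear_tlift_arg[OF m m T _ comult_linear] klinear_tlift_arg[OF D D T _ comult_dual_linear[OF fd]]
    bilinear_left[OF P] bilinear_right[OF P] bilinear_left[OF mult_bilinear] bilinear_right[OF mult_bilinear]
    bilinear_left[OF dual_mult_bilinear] bilinear_right[OF dual_mult_bilinear]
    klinear_smult_const[OF m] klinear_smult_vec[OF m] dual_eval_linear klinear_ident
    comult_closed comult_dual(1)[OF fd] smult_closed A.m_closed dual_mult_closed
  show "\<lbrakk>\<theta> \<in> carrier (dual K H); h' \<in> carrier H; \<theta>' \<in> carrier (dual K H)\<rbrakk> \<Longrightarrow>
      (\<lambda>h. heisenberg_term h \<theta> h' \<theta>') \<in> klinear K H (tensor K H (dual K H))"
    unfolding heisenberg_term_def
    by (intro lin | assumption | erule dual_app_closed)+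
  show "\<lbrakk>h \<in> carrier H; h' \<in> carrier H; \<theta>' \<in> carrier (dual K H)\<rbrakk> \<Longrightarrow>
      (\<lambda>\<theta>. heisenberg_term h \<theta> h' \<theta>') \<in> klinear K (dual K H) (tensor K H (dual K H))"
    unfolding heisenberg_term_def
    by (intro lin | assumption | erule dual_app_closed)+
  show "\<lbrakk>h \<in> carrier H; \<theta> \<in> carrier (dual K H); \<theta>' \<in> carrier (dual K H)\<rbrakk> \<Longrightarrow>
      (\<lambda>h'. heisenberg_term h \<theta> h' \<theta>') \<in> klinear K H (tensor K H (dual K H))"
    unfolding heisenberg_term_def
    by (intro lin | assumption | erule dual_app_closed | erule dual_linear)+
  show "\<lbrakk>h \<in> carrier H; \<theta> \<in> carrier (dual K H); h' \<in> carrier H\<rbrakk> \<Longrightarrow>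
      (\<lambda>\<theta>'. heisenberg_term h \<theta> h' \<theta>') \<in> klinear K (dual K H) (tensor K H (dual K H))"
    unfolding heisenberg_term_def
    by (intro lin | assumption | erule dual_app_closed)+
qed

lemma heisenberg_mult:
  "s \<otimes>\<^bsub>heisenberg K H\<^esub> t = tlift (tensor K H (dual K H)) (\<lambda>h \<theta>.
     tlift (tensor K H (dual K H)) (\<lambda>h' \<theta>'. heisenberg_term h \<theta> h' \<theta>') t) s"
  by (simp add: heisenberg_def Let_def heisenberg_term_def)

lemma heisenberg_mult_bilinear:
  assumes fd: "finite_dim K H"
  shows "bilinear K (heisenberg K H) (heisenberg K H) (heisenberg K H) (mult (heisenberg K H))"
proof -
  let ?T = "tensor K H (dual K H)"
  note m = module_H and D = module_dual
  note T = tensor_module[OF m D] and lin = heisenberg_term_linear[OF fd]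
  have "bilinear K ?T ?T ?T (\<lambda>s t. tlift ?T (\<lambda>h \<theta>. tlift ?T (\<lambda>h' \<theta>'. heisenberg_term h \<theta> h' \<theta>') t) s)"
    by (intro bilinearI klinear_tlift_param[OF m D T] tlift_linear[OF m D T] lin) assumption+
  then show ?thesis
    using heisenberg_same_space
    unfolding bilinear_def klinear_same_space[OF heisenberg_same_space] heisenberg_mult[abs_def]
    by (simp add: same_space_def)
qed

lemma heisenberg_mult_pure:
  assumes fd: "finite_dim K H"
    and "h \<in> carrier H" "\<theta> \<in> carrier (dual K H)" "h' \<in> carrier H" "\<theta>' \<in> carrier (dual K H)"
  shows "pure K H (dual K H) h \<theta> \<otimes>\<^bsub>heisenberg K H\<^esub> pure K H (dual K H) h' \<theta>' = heisenberg_term h \<theta> h' \<theta>'"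
proof -
  let ?T = "tensor K H (dual K H)"
  note m = module_H and D = module_dual
  note T = tensor_module[OF m D] and lin = heisenberg_term_linear[OF fd]
  have "pure K H (dual K H) h \<theta> \<otimes>\<^bsub>heisenberg K H\<^esub> pure K H (dual K H) h' \<theta>'
      = tlift ?T (\<lambda>h' \<theta>'. heisenberg_term h \<theta> h' \<theta>') (pure K H (dual K H) h' \<theta>')"
    unfolding heisenberg_mult
    by (intro tlift_pure[OF m D T] bilinearI klinear_tlift_param[OF m D T] lin pure_closed assms) assumption+
  also have "\<dots> = heisenberg_term h \<theta> h' \<theta>'"
    by (intro tlift_pure[OF m D T] bilinearI lin assms) assumption+
  finally show ?thesis .
qed

text \<open>Here both splittings are trivial: that of \<open>1 \<in> H\<close> because the coproduct is unital,
  that of the unit of the dual because its first part is evaluated at \<open>1\<close>.\<close>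

lemma heisenberg_left_right:
  assumes fd: "finite_dim K H" and h: "h \<in> carrier H" and \<theta>: "\<theta> \<in> carrier (dual K H)"
  shows "pure K H (dual K H) h \<one>\<^bsub>dual K H\<^esub> \<otimes>\<^bsub>heisenberg K H\<^esub> pure K H (dual K H) \<one>\<^bsub>H\<^esub> \<theta> = pure K H (dual K H) h \<theta>"
proof -
  let ?D = "dual K H"
  let ?T = "tensor K H ?D"
  note m = module_H and D = module_dual
  note T = tensor_module[OF m D] and P = pure_bilinear[OF m D]
  interpret D: module K ?D by (rule D)
  note lin = bilinearI klinear_tlift_param[OF D D T]
    bilinear_left[OF P] bilinear_right[OF P] bilinear_left[OF mult_bilinear] bilinear_right[OF mult_bilinear]
    bilinear_left[OF dual_mult_bilinear]
    klinear_smult_const[OF m] klinear_smult_vec[OF m] dual_eval_linear klinear_ident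
    comult_dual(1)[OF fd] smult_closed A.m_closed dual_mult_closed \<theta> h dual_one_closed
  have "pure K H ?D h \<one>\<^bsub>?D\<^esub> \<otimes>\<^bsub>heisenberg K H\<^esub> pure K H ?D \<one>\<^bsub>H\<^esub> \<theta> = heisenberg_term h \<one>\<^bsub>?D\<^esub> \<one>\<^bsub>H\<^esub> \<theta>"
    by (intro heisenberg_mult_pure fd h \<theta> dual_one_closed A.one_closed)
  also have "\<dots> = tlift ?T (\<lambda>\<theta>1 \<theta>2. pure K H ?D (\<theta>1 \<one>\<^bsub>H\<^esub> \<odot>\<^bsub>H\<^esub> (h \<otimes>\<^bsub>H\<^esub> \<one>\<^bsub>H\<^esub>)) (\<theta>2 \<otimes>\<^bsub>?D\<^esub> \<theta>)) (comult ?D \<one>\<^bsub>?D\<^esub>)"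
    unfolding heisenberg_term_def
    by (rule comult_one[OF T]) (intro lin | assumption | erule dual_app_closed | erule dual_linear)+
  also have "\<dots> = tlift ?T (\<lambda>\<theta>1 \<theta>2. \<theta>1 \<one>\<^bsub>H\<^esub> \<odot>\<^bsub>?T\<^esub> pure K H ?D h (\<theta>2 \<otimes>\<^bsub>?D\<^esub> \<theta>)) (comult ?D \<one>\<^bsub>?D\<^esub>)"
  proof (rule tlift_cong[OF D D comult_dual(1)[OF fd dual_one_closed]])
    fix \<theta>1 \<theta>2 assume *: "\<theta>1 \<in> carrier ?D" "\<theta>2 \<in> carrier ?D"
    have "pure K H ?D (\<theta>1 \<one>\<^bsub>H\<^esub> \<odot>\<^bsub>H\<^esub> h) (\<theta>2 \<otimes>\<^bsub>?D\<^esub> \<theta>) = \<theta>1 \<one>\<^bsub>H\<^esub> \<odot>\<^bsub>?T\<^esub> pure K H ?D h (\<theta>2 \<otimes>\<^bsub>?D\<^esub> \<theta>)"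
      by (rule klinear_smult[OF bilinear_left[OF P dual_mult_closed klinear_ident]])
        (use * \<theta> h in \<open>auto intro: dual_app_closed\<close>)
    then show "pure K H ?D (\<theta>1 \<one>\<^bsub>H\<^esub> \<odot>\<^bsub>H\<^esub> (h \<otimes>\<^bsub>H\<^esub> \<one>\<^bsub>H\<^esub>)) (\<theta>2 \<otimes>\<^bsub>?D\<^esub> \<theta>) = \<theta>1 \<one>\<^bsub>H\<^esub> \<odot>\<^bsub>?T\<^esub> pure K H ?D h (\<theta>2 \<otimes>\<^bsub>?D\<^esub> \<theta>)"
      using h by simp
  qed
  also have "\<dots> = pure K H ?D h (\<one>\<^bsub>?D\<^esub> \<otimes>\<^bsub>?D\<^esub> \<theta>)"
    by (rule comult_dual_counit_left[OF fd dual_one_closed T]) (intro lin)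
  finally show ?thesis by (simp add: dual_one_left \<theta>)
qed

text \<open>This product is not a pure tensor; the interaction between \<open>H\<close> and its dual in the
  Heisenberg condition comes from here.\<close>

lemma heisenberg_right_left:
  assumes fd: "finite_dim K H" and h: "h \<in> carrier H" and \<theta>: "\<theta> \<in> carrier (dual K H)"
  shows "pure K H (dual K H) \<one>\<^bsub>H\<^esub> \<theta> \<otimes>\<^bsub>heisenberg K H\<^esub> pure K H (dual K H) h \<one>\<^bsub>dual K H\<^esub>
    = tlift (tensor K H (dual K H)) (\<lambda>h1 h2. tlift (tensor K H (dual K H)) (\<lambda>\<theta>1 \<theta>2.
        pure K H (dual K H) (\<theta>1 h2 \<odot>\<^bsub>H\<^esub> h1) \<theta>2) (comult (dual K H) \<theta>)) (comult H h)"
  unfolding heisenberg_mult_pure[OF fd A.one_closed \<theta> h dual_one_closed] heisenberg_term_def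
  by (intro tlift_cong[OF module_H module_H comult_closed[OF h]]
      tlift_cong[OF module_dual module_dual comult_dual(1)[OF fd \<theta>]]) (simp add: dual_one_right)

end

section \<open>A pair of coactions in Sweedler notation\<close>

lemma right_coaction_linear:
  "right_coaction K X L \<alpha> \<Longrightarrow> \<alpha> \<in> klinear K X (tensor K X L)"
  by (simp add: right_coaction_def kalg_hom_def)

lemma right_coaction_trilinear:
  assumes "right_coaction K X L \<alpha>" and "module K X" "module K L" "module K M"
    and "comult L \<in> klinear K L (tensor K L L)" and x: "x \<in> carrier X"
    and "\<And>k l. \<lbrakk>k \<in> carrier L; l \<in> carrier L\<rbrakk> \<Longrightarrow> (\<lambda>y. f y k l) \<in> klinear K X M"
    and "\<And>y l. \<lbrakk>y \<in> carrier X; l \<in> carrier L\<rbrakk> \<Longrightarrow> (\<lambda>k. f y k l) \<in> klinear K L M"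
    and "\<And>y k. \<lbrakk>y \<in> carrier X; k \<in> carrier L\<rbrakk> \<Longrightarrow> (\<lambda>l. f y k l) \<in> klinear K L M"
  shows "tlift M (\<lambda>u l. tlift M (\<lambda>y k. f y k l) (\<alpha> u)) (\<alpha> x)
    = tlift M (\<lambda>y l. tlift M (\<lambda>k l'. f y k l') (comult L l)) (\<alpha> x)"
  by (rule coaction_trilinear[OF assms(2-4) right_coaction_linear[OF assms(1)] assms(5)
        klinear_closed[OF right_coaction_linear[OF assms(1)] x]])
    (use assms(1,6-9) in \<open>simp_all add: right_coaction_def\<close>)

lemma right_coaction_counit:
  assumes co: "right_coaction K X L \<alpha>" and X: "module K X" and L: "module K L" and M: "module K M"
    and counit: "\<And>l. l \<in> carrier L \<Longrightarrow> counit L l \<in> carrier K"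
    and x: "x \<in> carrier X" and f: "f \<in> klinear K X M"
  shows "tlift M (\<lambda>y l. counit L l \<odot>\<^bsub>M\<^esub> f y) (\<alpha> x) = f x"
proof -
  interpret X: module K X by fact
  note \<alpha>x = klinear_closed[OF right_coaction_linear[OF co] x]
  have "f x = f (tlift X (\<lambda>y l. counit L l \<odot>\<^bsub>X\<^esub> y) (\<alpha> x))"
    using co x by (simp add: right_coaction_def)
  also have "\<dots> = tlift M (\<lambda>y l. f (counit L l \<odot>\<^bsub>X\<^esub> y)) (\<alpha> x)"
    by (rule klinear_tlift[OF X L X M \<alpha>x f]) (simp add: counit)
  also have "\<dots> = tlift M (\<lambda>y l. counit L l \<odot>\<^bsub>M\<^esub> f y) (\<alpha> x)"
    by (intro tlift_cong[OF X L \<alpha>x] klinear_smult[OF f] counit) assumption+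
  finally show ?thesis by simp
qed

locale coaction_pair = hopf_algebra K H
  for K :: "('k, 'm) ring_scheme" (structure) and H :: "('k, 'h, 'm1) hopf_scheme" (structure) +
  fixes X :: "('k, 'x, 'm2) module_scheme"
    and \<alpha> :: "'x \<Rightarrow> ('x, 'h) tens" and \<beta> :: "'x \<Rightarrow> ('x, 'h \<Rightarrow> 'k) tens"
  assumes finite_dim: "finite_dim K H"
    and kalgebra_X: "kalgebra K X"
    and coaction_\<alpha>: "right_coaction K X (opp H) \<alpha>"
    and coaction_\<beta>: "right_coaction K X (dual K H) \<beta>"
begin

abbreviation D where "D \<equiv> dual K H"
abbreviation HD where "HD \<equiv> tensor K H D"
abbreviation Z where "Z \<equiv> tensor K X (heisenberg K H)"

lemma module_X: "module K X"
  using kalgebra_X by (simp add: kalgebra_def)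

lemma mult_X: "bilinear K X X X (mult X)"
  by (rule kalgebra_mult_bilinear[OF kalgebra_X])

lemma mult_X_closed: "\<lbrakk>a \<in> carrier X; b \<in> carrier X\<rbrakk> \<Longrightarrow> a \<otimes>\<^bsub>X\<^esub> b \<in> carrier X"
  by (rule bilinear_closed[OF mult_X])

lemma module_HD: "module K HD"
  by (rule tensor_module[OF module_H module_dual])

lemma module_Z: "module K Z"
  by (rule tensor_module[OF module_X module_heisenberg])

lemma pure_HD: "bilinear K H D HD (pure K H D)"
  by (rule pure_bilinear[OF module_H module_dual])

lemma pure_HD_closed: "\<lbrakk>h \<in> carrier H; \<theta> \<in> carrier D\<rbrakk> \<Longrightarrow> pure K H D h \<theta> \<in> carrier HD"
  by (rule pure_closed)

lemma heisenberg_carrier: "carrier (heisenberg K H) = carrier HD"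
  using heisenberg_same_space by (simp add: same_space_def)

lemma pure_Z: "bilinear K X HD Z (pure K X (heisenberg K H))"
  using pure_bilinear[OF module_X module_heisenberg]
  unfolding bilinear_def klinear_same_space(1)[OF heisenberg_same_space] heisenberg_carrier .

lemma pure_Z_closed: "\<lbrakk>a \<in> carrier X; w \<in> carrier HD\<rbrakk> \<Longrightarrow> pure K X (heisenberg K H) a w \<in> carrier Z"
  by (rule bilinear_closed[OF pure_Z])

lemma opp_same_space: "same_space H (opp H)"
  by (simp add: same_space_def opp_def)

lemma opp_simps: "carrier (opp H) = carrier H" "comult (opp H) = comult H" "counit (opp H) = counit H"
  by (simp_all add: opp_def)

lemma module_opp: "module K (opp H)"
  by (rule module_same_space[OF module_H opp_same_space])

lemma \<alpha>_linear: "\<alpha> \<in> klinear K X (tensor K X H)"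
  using right_coaction_linear[OF coaction_\<alpha>]
  by (simp add: klinear_same_space(2)[OF tensor_same_space[OF same_space_refl opp_same_space]])

lemma \<beta>_linear: "\<beta> \<in> klinear K X (tensor K X D)"
  by (rule right_coaction_linear[OF coaction_\<beta>])

lemma \<alpha>_closed: "x \<in> carrier X \<Longrightarrow> \<alpha> x \<in> carrier (tensor K X H)"
  by (rule klinear_closed[OF \<alpha>_linear])

lemma \<beta>_closed: "x \<in> carrier X \<Longrightarrow> \<beta> x \<in> carrier (tensor K X D)"
  by (rule klinear_closed[OF \<beta>_linear])

lemma \<alpha>_trilinear:
  assumes "module K M" "x \<in> carrier X"
    and "\<And>k l. \<lbrakk>k \<in> carrier H; l \<in> carrier H\<rbrakk> \<Longrightarrow> (\<lambda>y. f y k l) \<in> klinear K X M"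
    and "\<And>y l. \<lbrakk>y \<in> carrier X; l \<in> carrier H\<rbrakk> \<Longrightarrow> (\<lambda>k. f y k l) \<in> klinear K H M"
    and "\<And>y k. \<lbrakk>y \<in> carrier X; k \<in> carrier H\<rbrakk> \<Longrightarrow> (\<lambda>l. f y k l) \<in> klinear K H M"
  shows "tlift M (\<lambda>u l. tlift M (\<lambda>y k. f y k l) (\<alpha> u)) (\<alpha> x)
    = tlift M (\<lambda>y l. tlift M (\<lambda>k l'. f y k l') (comult H l)) (\<alpha> x)"
proof -
  have "comult (opp H) \<in> klinear K (opp H) (tensor K (opp H) (opp H))"
    using comult_linear
    by (simp add: opp_simps klinear_same_space(1)[OF opp_same_space]
      klinear_same_space(2)[OF tensor_same_space[OF opp_same_space opp_same_space]])
  from right_coaction_trilinear[OF coaction_\<alpha> module_X module_opp assms(1) this assms(2)]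
  show ?thesis
    using assms(3-5) unfolding opp_simps klinear_same_space(1)[OF opp_same_space] by blast
qed

lemmas \<beta>_trilinear = right_coaction_trilinear[OF coaction_\<beta> module_X module_dual _ comult_dual_linear[OF finite_dim]]

lemma \<alpha>_counit:
  assumes "module K M" "x \<in> carrier X" "f \<in> klinear K X M"
  shows "tlift M (\<lambda>y k. counit H k \<odot>\<^bsub>M\<^esub> f y) (\<alpha> x) = f x"
  using right_coaction_counit[OF coaction_\<alpha> module_X module_opp assms(1) _ assms(2,3)] counit_closed
  by (simp add: opp_simps)

lemma \<beta>_counit:
  assumes "module K M" "x \<in> carrier X" "f \<in> klinear K X M"
  shows "tlift M (\<lambda>y \<theta>. \<theta> \<one>\<^bsub>H\<^esub> \<odot>\<^bsub>M\<^esub> f y) (\<beta> x) = f x"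
  using right_coaction_counit[OF coaction_\<beta> module_X module_dual assms(1) _ assms(2,3)]
  by (simp add: dual_simps(7) dual_app_closed)

section \<open>The two Heisenberg products\<close>

text \<open>The element \<open>R(x, y) = (S(x\<^sub>1) \<rhd> y) x\<^sub>0\<close> with which braided commutativity
  compares the product \<open>x y\<close>.\<close>

definition twisted_product :: "'x \<Rightarrow> 'x \<Rightarrow> 'x"
  where "twisted_product x y = tlift X (\<lambda>x0 x1. act X \<beta> (antipode H x1) y \<otimes>\<^bsub>X\<^esub> x0) (\<alpha> x)"

text \<open>\<open>P(x\<^sub>0, y\<^sub>0) \<otimes> (S(x\<^sub>1) # y\<^sub>1)\<close>.\<close>

definition spread :: "('x \<Rightarrow> 'x \<Rightarrow> 'x) \<Rightarrow> 'x \<Rightarrow> 'x \<Rightarrow> ('x, ('h, 'h \<Rightarrow> 'k) tens) tens"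
  where "spread P x y = tlift Z (\<lambda>a k. tlift Z (\<lambda>b \<theta>.
     pure K X (heisenberg K H) (P a b) (pure K H D (antipode H k) \<theta>)) (\<beta> y)) (\<alpha> x)"

lemma act_linear:
  "h \<in> carrier H \<Longrightarrow> (\<lambda>x. act X \<beta> h x) \<in> klinear K X X"
  "x \<in> carrier X \<Longrightarrow> (\<lambda>h. act X \<beta> h x) \<in> klinear K H X"
  unfolding act_def
  by (intro klinear_tlift_arg[OF module_X module_dual module_X _ \<beta>_linear]
      klinear_tlift_param[OF module_X module_dual module_X \<beta>_closed] bilinearI
      klinear_smult_vec[OF module_X] klinear_smult_const[OF module_X] dual_eval_linear klinear_ident
    | assumption | erule dual_app_closed | erule dual_linear)+

lemma twisted_product_bilinear: "bilinear K X X X twisted_product"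
  unfolding twisted_product_def
  by (intro bilinearI klinear_tlift_arg[OF module_X module_H module_X _ \<alpha>_linear]
      klinear_tlift_param[OF module_X module_H module_X \<alpha>_closed]
      bilinear_left[OF mult_X] bilinear_right[OF mult_X] klinear_ident
      klinear_compose[OF act_linear(2) antipode_linear] act_linear(1) antipode_closed
      klinear_closed[OF act_linear(1)]) assumption+

lemma alpha_dot_closed: "x \<in> carrier X \<Longrightarrow> alpha_dot K H X \<alpha> x \<in> carrier (tensor K X H)"
  unfolding alpha_dot_def
  by (rule klinear_closed[OF tmap_linear[OF module_X module_H module_X module_H klinear_ident klinear_ident]
        \<alpha>_closed])

lemma antipode_alpha_dot_closed:
  "x \<in> carrier X \<Longrightarrow> tmap K X H (\<lambda>x. x) (antipode H) (alpha_dot K H X \<alpha> x) \<in> carrier (tensor K X H)"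
  by (rule klinear_closed[OF tmap_linear[OF module_X module_H module_X module_H klinear_ident antipode_linear]
        alpha_dot_closed])

lemma tlift_antipode_alpha_dot:
  assumes M: "module K M" and f: "bilinear K X H M f" and x: "x \<in> carrier X"
  shows "tlift M f (tmap K X H (\<lambda>x. x) (antipode H) (alpha_dot K H X \<alpha> x)) = tlift M (\<lambda>a k. f a (antipode H k)) (\<alpha> x)"
proof -
  note X = module_X and m = module_H
  have f': "bilinear K X H M (\<lambda>a k. f a (antipode H k))"
    by (intro bilinearI bilinear_left[OF f] bilinear_right[OF f] klinear_ident antipode_linear antipode_closed)
  have "tlift M f (tmap K X H (\<lambda>x. x) (antipode H) (alpha_dot K H X \<alpha> x))
      = tlift M (\<lambda>a k. f a (antipode H k)) (alpha_dot K H X \<alpha> x)"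
    by (rule tlift_tmap[OF X m X m M klinear_ident antipode_linear f alpha_dot_closed[OF x]])
  also have "\<dots> = tlift M (\<lambda>a k. f a (antipode H k)) (\<alpha> x)"
    unfolding alpha_dot_def
    by (rule tlift_tmap[OF X m X m M klinear_ident klinear_ident f' \<alpha>_closed[OF x]])
  finally show ?thesis .
qed

lemma iota_linear:
  "iota1 K H X \<in> klinear K (tensor K X H) Z" "iota2 K H X \<in> klinear K (tensor K X D) Z"
proof -
  note heis = klinear_same_space(2)[OF heisenberg_same_space]
  have "(\<lambda>h. pure K H D h \<one>\<^bsub>D\<^esub>) \<in> klinear K H (heisenberg K H)"
    unfolding heis by (rule bilinear_left[OF pure_HD dual_one_closed klinear_ident])
  then show "iota1 K H X \<in> klinear K (tensor K X H) Z"
    unfolding iota1_def by (intro tmap_linear module_X module_H module_heisenberg klinear_ident)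
  have "(\<lambda>\<theta>. pure K H D \<one>\<^bsub>H\<^esub> \<theta>) \<in> klinear K D (heisenberg K H)"
    unfolding heis by (rule bilinear_right[OF pure_HD A.one_closed klinear_ident])
  then show "iota2 K H X \<in> klinear K (tensor K X D) Z"
    unfolding iota2_def by (intro tmap_linear module_X module_dual module_heisenberg klinear_ident)
qed

lemma mult_Z: "bilinear K Z Z Z (mult Z)"
  by (rule tensor_mult_bilinear[OF module_X module_heisenberg mult_X heisenberg_mult_bilinear[OF finite_dim]])

lemma mult_Z_pure:
  assumes "a \<in> carrier X" "b \<in> carrier X" "v \<in> carrier HD" "w \<in> carrier HD"
  shows "pure K X (heisenberg K H) a v \<otimes>\<^bsub>Z\<^esub> pure K X (heisenberg K H) b w
    = pure K X (heisenberg K H) (a \<otimes>\<^bsub>X\<^esub> b) (v \<otimes>\<^bsub>heisenberg K H\<^esub> w)"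
  by (rule tensor_mult_pure[OF module_X module_heisenberg mult_X heisenberg_mult_bilinear[OF finite_dim]])
    (use assms in \<open>simp_all add: heisenberg_carrier\<close>)

lemma heisenberg_product_left:
  assumes s: "s \<in> carrier (tensor K X H)" and t: "t \<in> carrier (tensor K X D)"
  shows "mult_map Z (tmap K Z Z (iota1 K H X) (iota2 K H X) (pure K (tensor K X H) (tensor K X D) s t))
    = tlift Z (\<lambda>a h. tlift Z (\<lambda>b \<theta>. pure K X (heisenberg K H) (a \<otimes>\<^bsub>X\<^esub> b) (pure K H D h \<theta>)) t) s"
proof -
  note X = module_X and m = module_H and D = module_dual
  note cl = pure_Z_closed pure_HD_closed dual_one_closed A.one_closed
  have "mult_map Z (tmap K Z Z (iota1 K H X) (iota2 K H X) (pure K (tensor K X H) (tensor K X D) s t))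
      = iota1 K H X s \<otimes>\<^bsub>Z\<^esub> iota2 K H X t"
    by (rule mult_map_tmap[OF tensor_module[OF X m] tensor_module[OF X D] module_Z mult_Z iota_linear s t])
  also have "\<dots> = tlift Z (\<lambda>a h. tlift Z (\<lambda>b \<theta>. pure K X (heisenberg K H) a (pure K H D h \<one>\<^bsub>D\<^esub>)
      \<otimes>\<^bsub>Z\<^esub> pure K X (heisenberg K H) b (pure K H D \<one>\<^bsub>H\<^esub> \<theta>)) t) s"
    unfolding iota1_def iota2_def tmap_def
    by (rule mult_tlift[OF X m X D module_Z mult_Z s t]) (intro cl | assumption)+
  also have "\<dots> = tlift Z (\<lambda>a h. tlift Z (\<lambda>b \<theta>. pure K X (heisenberg K H) (a \<otimes>\<^bsub>X\<^esub> b) (pure K H D h \<theta>)) t) s"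
    by (intro tlift_cong[OF X m s] tlift_cong[OF X D t])
      (simp add: mult_Z_pure heisenberg_left_right finite_dim cl)
  finally show ?thesis .
qed

lemma heisenberg_product_right:
  assumes s: "s \<in> carrier (tensor K X H)" and t: "t \<in> carrier (tensor K X D)"
  shows "mult_map Z (tmap K Z Z (iota2 K H X) (iota1 K H X) (pure K (tensor K X D) (tensor K X H) t s))
    = tlift Z (\<lambda>b \<theta>. tlift Z (\<lambda>a h. pure K X (heisenberg K H) (b \<otimes>\<^bsub>X\<^esub> a)
        (pure K H D \<one>\<^bsub>H\<^esub> \<theta> \<otimes>\<^bsub>heisenberg K H\<^esub> pure K H D h \<one>\<^bsub>D\<^esub>)) s) t"
proof -
  note X = module_X and m = module_H and D = module_dual
  note cl = pure_Z_closed pure_HD_closed dual_one_closed A.one_closed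
  have "mult_map Z (tmap K Z Z (iota2 K H X) (iota1 K H X) (pure K (tensor K X D) (tensor K X H) t s))
      = iota2 K H X t \<otimes>\<^bsub>Z\<^esub> iota1 K H X s"
    by (rule mult_map_tmap[OF tensor_module[OF X D] tensor_module[OF X m] module_Z mult_Z iota_linear(2,1) t s])
  also have "\<dots> = tlift Z (\<lambda>b \<theta>. tlift Z (\<lambda>a h. pure K X (heisenberg K H) b (pure K H D \<one>\<^bsub>H\<^esub> \<theta>)
      \<otimes>\<^bsub>Z\<^esub> pure K X (heisenberg K H) a (pure K H D h \<one>\<^bsub>D\<^esub>)) s) t"
    unfolding iota1_def iota2_def tmap_def
    by (rule mult_tlift[OF X D X m module_Z mult_Z t s]) (intro cl | assumption)+
  also have "\<dots> = tlift Z (\<lambda>b \<theta>. tlift Z (\<lambda>a h. pure K X (heisenberg K H) (b \<otimes>\<^bsub>X\<^esub> a)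
        (pure K H D \<one>\<^bsub>H\<^esub> \<theta> \<otimes>\<^bsub>heisenberg K H\<^esub> pure K H D h \<one>\<^bsub>D\<^esub>)) s) t"
    by (intro tlift_cong[OF X m s] tlift_cong[OF X D t]) (simp add: mult_Z_pure cl)
  finally show ?thesis .
qed

lemma left_side:
  assumes x: "x \<in> carrier X" and y: "y \<in> carrier X"
  shows "mult_map Z (tmap K Z Z (iota1 K H X) (iota2 K H X) (pure K (tensor K X H) (tensor K X D)
      (tmap K X H (\<lambda>x. x) (antipode H) (alpha_dot K H X \<alpha> x)) (\<beta> y))) = spread (mult X) x y"
proof -
  let ?f = "\<lambda>a h. tlift Z (\<lambda>b \<theta>. pure K X (heisenberg K H) (a \<otimes>\<^bsub>X\<^esub> b) (pure K H D h \<theta>)) (\<beta> y)"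
  have f: "bilinear K X H Z ?f"
    by (intro bilinearI klinear_tlift_param[OF module_X module_dual module_Z \<beta>_closed[OF y]]
        bilinear_left[OF pure_Z] bilinear_right[OF pure_Z] bilinear_left[OF pure_HD] bilinear_left[OF mult_X]
        klinear_ident mult_X_closed pure_HD_closed) assumption+
  show ?thesis
    unfolding heisenberg_product_left[OF antipode_alpha_dot_closed[OF x] \<beta>_closed[OF y]] spread_def
    by (rule tlift_antipode_alpha_dot[OF module_Z f x])
qed

text \<open>In Sweedler notation, with \<open>\<theta> = y\<^sub>1\<close> and \<open>k = x\<^sub>1\<close>: the Heisenberg
  product contributes \<open>\<theta>\<^sub>1(S(k\<^sub>1)) S(k\<^sub>2) # \<theta>\<^sub>2\<close>.  The coaction axioms
  replace \<open>x\<^sub>0 \<otimes> k\<^sub>1 \<otimes> k\<^sub>2\<close> and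
  \<open>y\<^sub>0 \<otimes> \<theta>\<^sub>1 \<otimes> \<theta>\<^sub>2\<close> by iterated coactions; then the
  inner coactions together with the pairing \<open>\<theta>\<^sub>1(S(k\<^sub>1))\<close> assemble to the twisted product
  of the outer components.\<close>

lemma right_side:
  assumes x: "x \<in> carrier X" and y: "y \<in> carrier X"
  shows "mult_map Z (tmap K Z Z (iota2 K H X) (iota1 K H X) (pure K (tensor K X D) (tensor K X H)
      (\<beta> y) (tmap K X H (\<lambda>x. x) (antipode H) (alpha_dot K H X \<alpha> x)))) = spread twisted_product x y"
proof -
  note X = module_X and m = module_H and D = module_dual and Z = module_Z and T = module_HD
  interpret XM: module K X by (rule X)
  let ?p = "pure K X (heisenberg K H)" and ?q = "pure K H D"
  let ?S = "antipode H" and ?\<delta> = "comult D"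
  \<comment> \<open>The summand after straightening; \<open>c\<close>, \<open>d\<close> and \<open>\<theta>1\<close>,
    \<open>\<theta>2\<close> are the parts of \<open>k\<close> and \<open>\<theta>\<close>.  Each of the six
    arguments has to be shown to enter linearly.\<close>
  define N where "N = (\<lambda>b \<theta>1 a c d \<theta>2. ?p (b \<otimes>\<^bsub>X\<^esub> a) (?q (\<theta>1 (?S c) \<odot>\<^bsub>H\<^esub> ?S d) \<theta>2))"
  note cX = tlift_cong[OF X m \<alpha>_closed] and cD = tlift_cong[OF X D \<beta>_closed]
  have sm: "\<theta> (?S c) \<odot>\<^bsub>H\<^esub> ?S d \<in> carrier H" if "\<theta> \<in> carrier D" "c \<in> carrier H" "d \<in> carrier H" for \<theta> c d
    using that by (simp add: dual_app_closed antipode_closed)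
  have \<delta>c: "?\<delta> \<theta> \<in> carrier (tensor K D D)" if "\<theta> \<in> carrier D" for \<theta>
    by (rule comult_dual(1)[OF finite_dim that])
  note lin0 = bilinear_left[OF pure_Z] bilinear_right[OF pure_Z] bilinear_left[OF pure_HD] bilinear_right[OF pure_HD]
    bilinear_left[OF mult_X] bilinear_right[OF mult_X] klinear_smult_vec[OF m] klinear_smult_const[OF m]
    klinear_ident antipode_linear dual_eval_linear mult_X_closed pure_HD_closed sm antipode_closed
  have Nc: "N b \<theta>1 a c d \<theta>2 \<in> carrier Z"
    if "b \<in> carrier X" "\<theta>1 \<in> carrier D" "a \<in> carrier X" "c \<in> carrier H" "d \<in> carrier H" "\<theta>2 \<in> carrier D"
    for b \<theta>1 a c d \<theta>2
    unfolding N_def using that by (intro pure_Z_closed mult_X_closed pure_HD_closed sm)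
  have N1: "(\<lambda>b. N b \<theta>1 a c d \<theta>2) \<in> klinear K X Z"
    if "\<theta>1 \<in> carrier D" "a \<in> carrier X" "c \<in> carrier H" "d \<in> carrier H" "\<theta>2 \<in> carrier D" for \<theta>1 a c d \<theta>2
    unfolding N_def using that by (intro lin0)
  have N2: "(\<lambda>\<theta>1. N b \<theta>1 a c d \<theta>2) \<in> klinear K D Z"
    if "b \<in> carrier X" "a \<in> carrier X" "c \<in> carrier H" "d \<in> carrier H" "\<theta>2 \<in> carrier D" for b a c d \<theta>2
    unfolding N_def using that by (intro lin0)
  have N3: "(\<lambda>a. N b \<theta>1 a c d \<theta>2) \<in> klinear K X Z"
    if "b \<in> carrier X" "\<theta>1 \<in> carrier D" "c \<in> carrier H" "d \<in> carrier H" "\<theta>2 \<in> carrier D" for b \<theta>1 c d \<theta>2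
    unfolding N_def using that by (intro lin0)
  have N4: "(\<lambda>c. N b \<theta>1 a c d \<theta>2) \<in> klinear K H Z"
    if "b \<in> carrier X" "\<theta>1 \<in> carrier D" "a \<in> carrier X" "d \<in> carrier H" "\<theta>2 \<in> carrier D" for b \<theta>1 a d \<theta>2
    unfolding N_def using that by (intro lin0 dual_antipode_linear)
  have N5: "(\<lambda>d. N b \<theta>1 a c d \<theta>2) \<in> klinear K H Z"
    if "b \<in> carrier X" "\<theta>1 \<in> carrier D" "a \<in> carrier X" "c \<in> carrier H" "\<theta>2 \<in> carrier D" for b \<theta>1 a c \<theta>2
    unfolding N_def using that by (intro lin0 dual_app_closed[OF that(2)])
  have N6: "(\<lambda>\<theta>2. N b \<theta>1 a c d \<theta>2) \<in> klinear K D Z"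
    if "b \<in> carrier X" "\<theta>1 \<in> carrier D" "a \<in> carrier X" "c \<in> carrier H" "d \<in> carrier H" for b \<theta>1 a c d
    unfolding N_def using that by (intro lin0)
  note par = klinear_tlift_param[OF X m Z \<alpha>_closed] klinear_tlift_param[OF X D Z \<beta>_closed]
    klinear_tlift_param[OF D D Z \<delta>c] klinear_tlift_param[OF m m Z comult_closed]
  note arg = klinear_tlift_arg[OF X m Z _ \<alpha>_linear] klinear_tlift_arg[OF X D Z _ \<beta>_linear]
    klinear_tlift_arg[OF m m Z _ comult_linear]
  note lin = N1 N2 N3 N4 N5 N6 par arg bilinearI
  note cl = tlift_closed[OF X m Z \<alpha>_closed] tlift_closed[OF X D Z \<beta>_closed]
    tlift_closed[OF D D Z \<delta>c] tlift_closed[OF m m Z comult_closed] Nc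
  \<comment> \<open>Here the antipode reverses the coproduct, so that \<open>\<theta>1\<close> is paired with
    \<open>S(k\<^sub>1)\<close>, the part of \<open>k\<close> next to \<open>x\<^sub>0\<close>.\<close>
  have straighten: "?p (b \<otimes>\<^bsub>X\<^esub> a) (?q \<one>\<^bsub>H\<^esub> \<theta> \<otimes>\<^bsub>heisenberg K H\<^esub> ?q (?S k) \<one>\<^bsub>D\<^esub>)
      = tlift Z (\<lambda>c d. tlift Z (\<lambda>\<theta>1 \<theta>2. N b \<theta>1 a c d \<theta>2) (?\<delta> \<theta>)) (comult H k)"
    if *: "b \<in> carrier X" "a \<in> carrier X" "\<theta> \<in> carrier D" "k \<in> carrier H" for a b \<theta> k
  proof -
    have ba: "b \<otimes>\<^bsub>X\<^esub> a \<in> carrier X" using * by (simp add: mult_X_closed)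
    note p = bilinear_right[OF pure_Z ba klinear_ident]
    let ?g = "\<lambda>h1 h2. tlift HD (\<lambda>\<theta>1 \<theta>2. ?q (\<theta>1 h2 \<odot>\<^bsub>H\<^esub> h1) \<theta>2) (?\<delta> \<theta>)"
    have qc: "?q (\<theta>1 h2 \<odot>\<^bsub>H\<^esub> h1) \<theta>2 \<in> carrier HD"
      if "\<theta>1 \<in> carrier D" "\<theta>2 \<in> carrier D" "h1 \<in> carrier H" "h2 \<in> carrier H" for \<theta>1 \<theta>2 h1 h2
      using that by (intro pure_HD_closed) (simp_all add: dual_app_closed)
    have g: "bilinear K H H HD ?g"
      by (intro bilinearI klinear_tlift_param[OF D D T \<delta>c[OF *(3)]] bilinear_left[OF pure_HD]
          klinear_smult_vec[OF m] klinear_smult_const[OF m] klinear_ident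
        | assumption | erule dual_linear | erule dual_app_closed)+
    have "?q \<one>\<^bsub>H\<^esub> \<theta> \<otimes>\<^bsub>heisenberg K H\<^esub> ?q (?S k) \<one>\<^bsub>D\<^esub> = tlift HD ?g (comult H (?S k))"
      by (rule heisenberg_right_left[OF finite_dim antipode_closed[OF *(4)] *(3)])
    also have "\<dots> = tlift HD (\<lambda>c d. ?g (?S d) (?S c)) (comult H k)"
      by (rule antipode_comult[OF T g *(4)])
    finally have "?p (b \<otimes>\<^bsub>X\<^esub> a) (?q \<one>\<^bsub>H\<^esub> \<theta> \<otimes>\<^bsub>heisenberg K H\<^esub> ?q (?S k) \<one>\<^bsub>D\<^esub>)
        = ?p (b \<otimes>\<^bsub>X\<^esub> a) (tlift HD (\<lambda>c d. ?g (?S d) (?S c)) (comult H k))" by simp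
    also have "\<dots> = tlift Z (\<lambda>c d. ?p (b \<otimes>\<^bsub>X\<^esub> a) (?g (?S d) (?S c))) (comult H k)"
      by (intro klinear_tlift[OF m m T Z comult_closed[OF *(4)] p] tlift_closed[OF D D T \<delta>c[OF *(3)]] qc
          antipode_closed)
    also have "\<dots> = tlift Z (\<lambda>c d. tlift Z (\<lambda>\<theta>1 \<theta>2. N b \<theta>1 a c d \<theta>2) (?\<delta> \<theta>)) (comult H k)"
      unfolding N_def
      by (intro tlift_cong[OF m m comult_closed[OF *(4)]] klinear_tlift[OF D D T Z \<delta>c[OF *(3)] p] qc
          antipode_closed)
    finally show ?thesis .
  qed
  have collect: "tlift Z (\<lambda>a' c. tlift Z (\<lambda>b' \<theta>1. N b' \<theta>1 a' c d \<theta>2) (\<beta> b)) (\<alpha> a)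
      = ?p (twisted_product a b) (?q (?S d) \<theta>2)"
    if *: "b \<in> carrier X" "a \<in> carrier X" "d \<in> carrier H" "\<theta>2 \<in> carrier D" for a b d \<theta>2
  proof -
    let ?w = "?q (?S d) \<theta>2"
    have w: "?w \<in> carrier HD" using * by (intro pure_HD_closed antipode_closed)
    note p = bilinear_left[OF pure_Z w klinear_ident]
    have N: "N b' \<theta>1 a' c d \<theta>2 = ?p ((\<theta>1 (?S c) \<odot>\<^bsub>X\<^esub> b') \<otimes>\<^bsub>X\<^esub> a') ?w"
      if "b' \<in> carrier X" "\<theta>1 \<in> carrier D" "a' \<in> carrier X" "c \<in> carrier H" for b' \<theta>1 a' c
    proof -
      have k: "\<theta>1 (?S c) \<in> carrier K" using that by (simp add: dual_app_closed antipode_closed)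
      have "?q (\<theta>1 (?S c) \<odot>\<^bsub>H\<^esub> ?S d) \<theta>2 = \<theta>1 (?S c) \<odot>\<^bsub>HD\<^esub> ?w"
        by (rule klinear_smult[OF bilinear_left[OF pure_HD *(4) klinear_ident] k antipode_closed[OF *(3)]])
      moreover have "?p (b' \<otimes>\<^bsub>X\<^esub> a') (\<theta>1 (?S c) \<odot>\<^bsub>HD\<^esub> ?w) = \<theta>1 (?S c) \<odot>\<^bsub>Z\<^esub> ?p (b' \<otimes>\<^bsub>X\<^esub> a') ?w"
        by (rule klinear_smult[OF bilinear_right[OF pure_Z _ klinear_ident] k w]) (simp add: mult_X_closed that)
      moreover have "?p (\<theta>1 (?S c) \<odot>\<^bsub>X\<^esub> (b' \<otimes>\<^bsub>X\<^esub> a')) ?w = \<theta>1 (?S c) \<odot>\<^bsub>Z\<^esub> ?p (b' \<otimes>\<^bsub>X\<^esub> a') ?w"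
        by (rule klinear_smult[OF p k]) (simp add: mult_X_closed that)
      moreover have "(\<theta>1 (?S c) \<odot>\<^bsub>X\<^esub> b') \<otimes>\<^bsub>X\<^esub> a' = \<theta>1 (?S c) \<odot>\<^bsub>X\<^esub> (b' \<otimes>\<^bsub>X\<^esub> a')"
        by (rule klinear_smult[OF bilinear_left[OF mult_X that(3) klinear_ident] k that(1)])
      ultimately show ?thesis by (simp add: N_def)
    qed
    have "tlift Z (\<lambda>a' c. tlift Z (\<lambda>b' \<theta>1. N b' \<theta>1 a' c d \<theta>2) (\<beta> b)) (\<alpha> a)
        = tlift Z (\<lambda>a' c. tlift Z (\<lambda>b' \<theta>1. ?p ((\<theta>1 (?S c) \<odot>\<^bsub>X\<^esub> b') \<otimes>\<^bsub>X\<^esub> a') ?w) (\<beta> b)) (\<alpha> a)"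
      by (intro cX cD * N) assumption+
    also have "\<dots> = tlift Z (\<lambda>a' c. ?p (act X \<beta> (?S c) b \<otimes>\<^bsub>X\<^esub> a') ?w) (\<alpha> a)"
    proof (intro cX *)
      fix a' c assume **: "a' \<in> carrier X" "c \<in> carrier H"
      show "tlift Z (\<lambda>b' \<theta>1. ?p ((\<theta>1 (?S c) \<odot>\<^bsub>X\<^esub> b') \<otimes>\<^bsub>X\<^esub> a') ?w) (\<beta> b) = ?p (act X \<beta> (?S c) b \<otimes>\<^bsub>X\<^esub> a') ?w"
        unfolding act_def
        by (rule klinear_tlift[OF X D X Z \<beta>_closed[OF *(1)]
              klinear_compose[OF p bilinear_left[OF mult_X **(1) klinear_ident]], symmetric])
          (use ** in \<open>simp add: dual_app_closed antipode_closed\<close>)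
    qed
    also have "\<dots> = ?p (twisted_product a b) ?w"
      unfolding twisted_product_def
      by (rule klinear_tlift[OF X m X Z \<alpha>_closed[OF *(2)] p, symmetric])
        (use * in \<open>simp add: mult_X_closed klinear_closed[OF act_linear(1)] antipode_closed\<close>)
    finally show ?thesis .
  qed
  have "mult_map Z (tmap K Z Z (iota2 K H X) (iota1 K H X) (pure K (tensor K X D) (tensor K X H)
      (\<beta> y) (tmap K X H (\<lambda>x. x) ?S (alpha_dot K H X \<alpha> x))))
    = tlift Z (\<lambda>b \<theta>. tlift Z (\<lambda>a k. ?p (b \<otimes>\<^bsub>X\<^esub> a) (?q \<one>\<^bsub>H\<^esub> \<theta> \<otimes>\<^bsub>heisenberg K H\<^esub> ?q (?S k) \<one>\<^bsub>D\<^esub>)) (\<alpha> x)) (\<beta> y)"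
    unfolding heisenberg_product_right[OF antipode_alpha_dot_closed[OF x] \<beta>_closed[OF y]]
  proof (intro cD y tlift_antipode_alpha_dot[OF Z _ x])
    fix b \<theta> assume *: "b \<in> carrier X" "\<theta> \<in> carrier D"
    have "(\<lambda>h. ?q \<one>\<^bsub>H\<^esub> \<theta> \<otimes>\<^bsub>heisenberg K H\<^esub> ?q h \<one>\<^bsub>D\<^esub>) \<in> klinear K H (heisenberg K H)"
      by (rule bilinear_right[OF heisenberg_mult_bilinear[OF finite_dim]])
        (use * in \<open>simp_all add: heisenberg_carrier klinear_same_space(2)[OF heisenberg_same_space]
           pure_HD_closed bilinear_left[OF pure_HD dual_one_closed klinear_ident]\<close>)
    then have W: "(\<lambda>h. ?q \<one>\<^bsub>H\<^esub> \<theta> \<otimes>\<^bsub>heisenberg K H\<^esub> ?q h \<one>\<^bsub>D\<^esub>) \<in> klinear K H HD"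
      by (simp add: klinear_same_space(2)[OF heisenberg_same_space])
    show "bilinear K X H Z (\<lambda>a h. ?p (b \<otimes>\<^bsub>X\<^esub> a) (?q \<one>\<^bsub>H\<^esub> \<theta> \<otimes>\<^bsub>heisenberg K H\<^esub> ?q h \<one>\<^bsub>D\<^esub>))"
      by (intro bilinearI bilinear_left[OF pure_Z] bilinear_right[OF pure_Z] bilinear_right[OF mult_X]
          klinear_ident W klinear_closed[OF W] mult_X_closed *)
  qed
  also have "\<dots> = tlift Z (\<lambda>b \<theta>. tlift Z (\<lambda>a k. tlift Z (\<lambda>c d. tlift Z (\<lambda>\<theta>1 \<theta>2. N b \<theta>1 a c d \<theta>2) (?\<delta> \<theta>))
      (comult H k)) (\<alpha> x)) (\<beta> y)"
    by (intro cX cD x y straighten) assumption+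
  also have "\<dots> = tlift Z (\<lambda>b \<theta>. tlift Z (\<lambda>a d. tlift Z (\<lambda>a' c. tlift Z (\<lambda>\<theta>1 \<theta>2. N b \<theta>1 a' c d \<theta>2) (?\<delta> \<theta>))
      (\<alpha> a)) (\<alpha> x)) (\<beta> y)"
    by (intro cD y x \<alpha>_trilinear[OF Z, symmetric] lin) assumption+
  also have "\<dots> = tlift Z (\<lambda>b \<theta>. tlift Z (\<lambda>a d. tlift Z (\<lambda>\<theta>1 \<theta>2. tlift Z (\<lambda>a' c. N b \<theta>1 a' c d \<theta>2) (\<alpha> a))
      (?\<delta> \<theta>)) (\<alpha> x)) (\<beta> y)"
    by (intro cD cX x y tlift_swap[OF X m D D Z] \<alpha>_closed \<delta>c Nc) assumption+
  also have "\<dots> = tlift Z (\<lambda>b \<theta>. tlift Z (\<lambda>\<theta>1 \<theta>2. tlift Z (\<lambda>a d. tlift Z (\<lambda>a' c. N b \<theta>1 a' c d \<theta>2) (\<alpha> a))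
      (\<alpha> x)) (?\<delta> \<theta>)) (\<beta> y)"
    by (intro cD x y tlift_swap[OF X m D D Z] \<alpha>_closed \<delta>c cl) assumption+
  also have "\<dots> = tlift Z (\<lambda>b \<theta>2. tlift Z (\<lambda>b' \<theta>1. tlift Z (\<lambda>a d. tlift Z (\<lambda>a' c. N b' \<theta>1 a' c d \<theta>2) (\<alpha> a))
      (\<alpha> x)) (\<beta> b)) (\<beta> y)"
    by (intro x y \<beta>_trilinear[OF Z, symmetric] lin) assumption+
  also have "\<dots> = tlift Z (\<lambda>b \<theta>2. tlift Z (\<lambda>a d. tlift Z (\<lambda>b' \<theta>1. tlift Z (\<lambda>a' c. N b' \<theta>1 a' c d \<theta>2) (\<alpha> a))
      (\<beta> b)) (\<alpha> x)) (\<beta> y)"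
    by (intro cD x y tlift_swap[OF X D X m Z] \<alpha>_closed \<beta>_closed cl) assumption+
  also have "\<dots> = tlift Z (\<lambda>b \<theta>2. tlift Z (\<lambda>a d. tlift Z (\<lambda>a' c. tlift Z (\<lambda>b' \<theta>1. N b' \<theta>1 a' c d \<theta>2) (\<beta> b))
      (\<alpha> a)) (\<alpha> x)) (\<beta> y)"
    by (intro cD cX x y tlift_swap[OF X D X m Z] \<alpha>_closed \<beta>_closed Nc) assumption+
  also have "\<dots> = tlift Z (\<lambda>b \<theta>. tlift Z (\<lambda>a d. ?p (twisted_product a b) (?q (?S d) \<theta>)) (\<alpha> x)) (\<beta> y)"
    by (intro cD cX x y collect) assumption+
  also have "\<dots> = spread twisted_product x y"
    unfolding spread_def
    by (intro tlift_swap[OF X D X m Z] \<alpha>_closed \<beta>_closed x y pure_Z_closed pure_HD_closed antipode_closed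
        bilinear_closed[OF twisted_product_bilinear])
  finally show ?thesis .
qed

section \<open>Equivalence of the two conditions\<close>

lemma spread_cong:
  assumes "\<And>a b. \<lbrakk>a \<in> carrier X; b \<in> carrier X\<rbrakk> \<Longrightarrow> P a b = Q a b" "x \<in> carrier X" "y \<in> carrier X"
  shows "spread P x y = spread Q x y"
  unfolding spread_def
  by (intro tlift_cong[OF module_X module_H \<alpha>_closed] tlift_cong[OF module_X module_dual \<beta>_closed] assms(2,3))
    (simp add: assms(1))

text \<open>The map \<open>id \<otimes> \<epsilon> \<otimes> \<epsilon>\<close> on \<open>X \<otimes> (H # dual K H)\<close>; the
  counit of the dual is evaluation at \<open>1\<close>.\<close>

definition collapse :: "('x, ('h, 'h \<Rightarrow> 'k) tens) tens \<Rightarrow> 'x"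
  where "collapse = tlift X (\<lambda>z w. tlift (self_alg K) (\<lambda>h \<theta>. counit H h \<otimes>\<^bsub>K\<^esub> \<theta> \<one>\<^bsub>H\<^esub>) w \<odot>\<^bsub>X\<^esub> z)"

text \<open>The counits undo the coactions \<open>\<alpha>\<close> and \<open>\<beta>\<close> that
  \<open>spread\<close> applies, the antipode in between being absorbed by
  \<open>\<epsilon> \<circ> S = \<epsilon>\<close>.  Hence \<open>spread\<close> is injective on bilinear maps.\<close>

lemma collapse_spread:
  assumes P: "bilinear K X X X P" and x: "x \<in> carrier X" and y: "y \<in> carrier X"
  shows "collapse (spread P x y) = P x y"
proof -
  note X = module_X and m = module_H and D = module_dual and Z = module_Z and T = module_HD
  interpret XM: module K X by (rule X)
  let ?p = "pure K X (heisenberg K H)" and ?q = "pure K H D"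
  note cX = tlift_cong[OF X m \<alpha>_closed[OF x]] and cD = tlift_cong[OF X D \<beta>_closed[OF y]]
  note Pc = bilinear_closed[OF P]
  let ?e = "\<lambda>h \<theta>. counit H h \<otimes>\<^bsub>K\<^esub> \<theta> \<one>\<^bsub>H\<^esub>"
  have e: "bilinear K H D (self_alg K) ?e"
    by (intro bilinearI klinear_app_mult counit_linear dual_eval_linear counit_closed A.one_closed
       | assumption | erule dual_app_closed)+
  have ec: "tlift (self_alg K) ?e w \<in> carrier K" if "w \<in> carrier HD" for w
    using klinear_closed[OF tlift_linear[OF m D module_K e] that] by simp
  let ?c = "\<lambda>z w. tlift (self_alg K) ?e w \<odot>\<^bsub>X\<^esub> z"
  have c: "bilinear K X HD X ?c"
    by (intro bilinearI klinear_smult_const[OF X] klinear_smult_vec[OF X] klinear_ident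
        tlift_linear[OF m D module_K e] ec)
  have c': "bilinear K X (heisenberg K H) X ?c"
    using c unfolding bilinear_def klinear_same_space(1)[OF heisenberg_same_space] heisenberg_carrier .
  have lin: "collapse \<in> klinear K Z X"
    unfolding collapse_def by (rule tlift_linear[OF X module_heisenberg X c'])
  have eval: "collapse (?p z (?q (antipode H k) \<theta>)) = counit H k \<odot>\<^bsub>X\<^esub> (\<theta> \<one>\<^bsub>H\<^esub> \<odot>\<^bsub>X\<^esub> z)"
    if "z \<in> carrier X" "k \<in> carrier H" "\<theta> \<in> carrier D" for z k \<theta>
  proof -
    have w: "?q (antipode H k) \<theta> \<in> carrier HD" using that by (simp add: pure_HD_closed antipode_closed)
    have "collapse (?p z (?q (antipode H k) \<theta>)) = ?c z (?q (antipode H k) \<theta>)"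
      unfolding collapse_def
      by (rule tlift_pure[OF X module_heisenberg X c' that(1)]) (simp add: heisenberg_carrier w)
    also have "tlift (self_alg K) ?e (?q (antipode H k) \<theta>) = ?e (antipode H k) \<theta>"
      by (rule tlift_pure[OF m D module_K e antipode_closed[OF that(2)] that(3)])
    finally show ?thesis
      using that by (simp add: counit_antipode XM.smult_assoc1 counit_closed dual_app_closed)
  qed
  note cl = pure_Z_closed pure_HD_closed antipode_closed Pc
  have "collapse (spread P x y) = tlift X (\<lambda>a k. collapse (tlift Z (\<lambda>b \<theta>.
      ?p (P a b) (?q (antipode H k) \<theta>)) (\<beta> y))) (\<alpha> x)"
    unfolding spread_def
    by (intro klinear_tlift[OF X m Z X \<alpha>_closed[OF x] lin] tlift_closed[OF X D Z \<beta>_closed[OF y]] cl)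
  also have "\<dots> = tlift X (\<lambda>a k. tlift X (\<lambda>b \<theta>. collapse (?p (P a b) (?q (antipode H k) \<theta>))) (\<beta> y)) (\<alpha> x)"
    by (intro cX klinear_tlift[OF X D Z X \<beta>_closed[OF y] lin] cl)
  also have "\<dots> = tlift X (\<lambda>a k. tlift X (\<lambda>b \<theta>. counit H k \<odot>\<^bsub>X\<^esub> (\<theta> \<one>\<^bsub>H\<^esub> \<odot>\<^bsub>X\<^esub> P a b)) (\<beta> y)) (\<alpha> x)"
    by (intro cX cD eval Pc)
  also have "\<dots> = tlift X (\<lambda>a k. counit H k \<odot>\<^bsub>X\<^esub> P a y) (\<alpha> x)"
  proof (rule cX)
    fix a k assume *: "a \<in> carrier X" "k \<in> carrier H"
    have "tlift X (\<lambda>b \<theta>. counit H k \<odot>\<^bsub>X\<^esub> (\<theta> \<one>\<^bsub>H\<^esub> \<odot>\<^bsub>X\<^esub> P a b)) (\<beta> y)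
        = counit H k \<odot>\<^bsub>X\<^esub> tlift X (\<lambda>b \<theta>. \<theta> \<one>\<^bsub>H\<^esub> \<odot>\<^bsub>X\<^esub> P a b) (\<beta> y)"
      by (rule klinear_tlift[OF X D X X \<beta>_closed[OF y] klinear_smult_const[OF X _ klinear_ident], symmetric])
        (use * Pc in \<open>simp_all add: counit_closed dual_app_closed\<close>)
    also have "tlift X (\<lambda>b \<theta>. \<theta> \<one>\<^bsub>H\<^esub> \<odot>\<^bsub>X\<^esub> P a b) (\<beta> y) = P a y"
      by (rule \<beta>_counit[OF X y bilinear_right[OF P *(1) klinear_ident]])
    finally show "tlift X (\<lambda>b \<theta>. counit H k \<odot>\<^bsub>X\<^esub> (\<theta> \<one>\<^bsub>H\<^esub> \<odot>\<^bsub>X\<^esub> P a b)) (\<beta> y) = counit H k \<odot>\<^bsub>X\<^esub> P a y" .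
  qed
  also have "\<dots> = P x y"
    by (rule \<alpha>_counit[OF X x bilinear_left[OF P y klinear_ident]])
  finally show ?thesis .
qed

theorem braided_commutative_iff:
  "braided_commutative_heisenberg K H X \<alpha> \<beta> \<longleftrightarrow> braided_commutative H X (act X \<beta>) \<alpha>"
proof -
  have "braided_commutative_heisenberg K H X \<alpha> \<beta> \<longleftrightarrow>
      (\<forall>x \<in> carrier X. \<forall>y \<in> carrier X. spread (mult X) x y = spread twisted_product x y)"
    unfolding braided_commutative_heisenberg_def Let_def
    by (intro ball_cong HOL.refl) (simp only: left_side right_side)
  also have "\<dots> \<longleftrightarrow> (\<forall>x \<in> carrier X. \<forall>y \<in> carrier X. x \<otimes>\<^bsub>X\<^esub> y = twisted_product x y)"
  proof (intro iffI ballI)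
    fix x y assume "\<forall>x \<in> carrier X. \<forall>y \<in> carrier X. spread (mult X) x y = spread twisted_product x y"
      and "x \<in> carrier X" "y \<in> carrier X"
    then show "x \<otimes>\<^bsub>X\<^esub> y = twisted_product x y"
      using collapse_spread[OF mult_X, of x y] collapse_spread[OF twisted_product_bilinear, of x y] by simp
  next
    fix x y assume "\<forall>x \<in> carrier X. \<forall>y \<in> carrier X. x \<otimes>\<^bsub>X\<^esub> y = twisted_product x y"
      and "x \<in> carrier X" "y \<in> carrier X"
    then show "spread (mult X) x y = spread twisted_product x y" by (intro spread_cong) simp_all
  qed
  finally show ?thesis by (simp add: braided_commutative_def twisted_product_def)
qed

end

theorem proposition4p18:
  fixes K :: "('k, 'm) ring_scheme"
    and H :: "('k, 'h, 'm1) hopf_scheme"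
    and X :: "('k, 'x, 'm2) module_scheme"
    and \<alpha> :: "'x \<Rightarrow> ('x, 'h) tens"
    and \<beta> :: "'x \<Rightarrow> ('x, 'h \<Rightarrow> 'k) tens"
  assumes "field K"
    and "hopf_algebra K H"
    and "finite_dim K H"
    and "yetter_drinfeld_algebra K H X \<alpha> \<beta>"
  shows "braided_commutative_heisenberg K H X \<alpha> \<beta> \<longleftrightarrow>
    braided_commutative H X (act X \<beta>) \<alpha>"
proof -
  interpret coaction_pair K H X \<alpha> \<beta>
    using assms(2-4)
    by (simp add: coaction_pair_def coaction_pair_axioms_def yetter_drinfeld_algebra_def)
  show ?thesis by (rule braided_commutative_iff)
qed

end
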